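(* Let $V_{\mathrm{reg}}=H^2(\Omega)$ and, with $a$, $N^c$, $N^s_1$, $\mathcal{L}$ and $V_h$ as defined in the context, let $$A^\ast(u,v) := a(u,v)+N^c(u,v)+N^c(v,u)+2\,a(\mathcal{L}(u),\mathcal{L}(v))+N^s_1(u,v).$$ Then the bilinear form $A^\ast(\cdot,\cdot)$ is well-defined on $V_{\mathrm{reg}}+V_h$, and it is coercive on $V_h$ with respect to the norm $\|v\|_A:=\sqrt{a(v,v)+N^s_1(v,v)}$ with coercivity constant $\tfrac12$, i.e. $$A^\ast(u_h,u_h)\;\ge\;\tfrac12\,\|u_h\|_A^2\qquad\text{for all }u_h\in V_h.$$
   Context: Let $\Omega \subset \mathbb{R}^d$ be a bounded polyhedral domain with a shape-regular, quasi-uniform simplicial triangulation $\mathcal{T}_h$ of characteristic mesh size $h>0$ that is fitted to the boundary (the elements exactly triangulate $\Omega$). Let $k\ge 1$ be an integer. $\mathcal{P}^k(T)$ denotes the polynomials of degree at most $k$ on $T$. For a set $S$, $(u,v)_S=\int_S u\,v\,ds$ (with the dot product for vector-valued functions). $V_h\subset H^1(\Omega)$ is the finite element space of all continuous functions on $\overline\Omega$ whose restriction to each $T\in\mathcal{T}_h$ belongs to $\mathcal{P}^k(T)$ (no boundary condition is imposed). $\partial_n$ is the outward normal derivative on $\partial\Omega$. Bilinear forms: - $a(u,v)=\sum_{T\in\mathcal{T}_h} a_T(u,v)$ with $a_T(u,v)=(\nabla u,\nabla v)_T$. The gradient is taken elementwise ("broken"), so $a$ is defined for elementwise $H^1$ functions.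 - $N^c(u,v)=\sum_{T\in\mathcal{T}_h} N^c_T(u,v)$ with $N^c_T(u,v)=(-\partial_n u, v)_{\partial\Omega\cap \partial T}$, so that $N^c(u,v)=(-\partial_n u,v)_{\partial\Omega}$. - $N^s_1(u,v)=\frac{1}{h}(u,v)_{\partial\Omega}$ (the Nitsche penalty term with penalty parameter $\lambda=1$). Lifting operator: let $\mathcal{P}^k_0(T)$ be the space of polynomials in $\mathcal{P}^k(T)$ that are $L^2(T)$-orthogonal to constants. For an element $T$ located at the boundary (i.e. $\partial T\cap\partial\Omega$ has positive $(d-1)$-dimensional measure), $\mathcal{L}_T:H^1(T)\to\mathcal{P}^k_0(T)$ is defined by $$a_T(\mathcal{L}_T(u),v)=N^c_T(v,u)\qquad \text{for all } v\in\mathcal{P}^k_0(T).$$ For all other elements set $\mathcal{L}_T=0$. The global lifting $\mathcal{L}$, defined on functions that are elementwise $H^1$, is given by $\mathcal{L}(u)|_T:=\mathcal{L}_T(u|_T)$. In general $\mathcal{L}(u)$ is discontinuous across element interfaces. *)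

theory Defs
  imports "HOL-Analysis.Analysis"
begin

text \<open>Sobolev spaces consist of representatives, i.e. functions on the whole type of which only the
  values on the given set matter, up to null sets.\<close>

definition square_integrable :: "'b measure \<Rightarrow> ('b \<Rightarrow> real) \<Rightarrow> bool" where
  "square_integrable M f \<longleftrightarrow> f \<in> borel_measurable M \<and> integrable M (\<lambda>x. (f x)\<^sup>2)"

definition ex1_AE :: "'b measure \<Rightarrow> (('b \<Rightarrow> 'c) \<Rightarrow> bool) \<Rightarrow> bool" where
  "ex1_AE M P \<longleftrightarrow> (\<exists>f. P f) \<and> (\<forall>f g. P f \<longrightarrow> P g \<longrightarrow> (AE x in M. f x = g x))"

abbreviation partial_deriv :: "('a::euclidean_space \<Rightarrow> real) \<Rightarrow> 'a \<Rightarrow> 'a \<Rightarrow> real" where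
  "partial_deriv f b x \<equiv> frechet_derivative f (at x) b"

primrec C_k :: "nat \<Rightarrow> ('a::euclidean_space \<Rightarrow> real) \<Rightarrow> bool" where
  "C_k 0 f \<longleftrightarrow> continuous_on UNIV f"
| "C_k (Suc m) f \<longleftrightarrow>
     (\<forall>x. f differentiable (at x)) \<and> (\<forall>b\<in>Basis. C_k m (partial_deriv f b))"

definition smooth :: "('a::euclidean_space \<Rightarrow> real) \<Rightarrow> bool" where
  "smooth f \<longleftrightarrow> (\<forall>m. C_k m f)"

definition test_function :: "'a::euclidean_space set \<Rightarrow> ('a \<Rightarrow> real) \<Rightarrow> bool" where
  "test_function S \<phi> \<longleftrightarrow>
     smooth \<phi> \<and> compact (closure {x. \<phi> x \<noteq> 0}) \<and> closure {x. \<phi> x \<noteq> 0} \<subseteq> S"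

definition weak_partial ::
    "'a::euclidean_space set \<Rightarrow> 'a \<Rightarrow> ('a \<Rightarrow> real) \<Rightarrow> ('a \<Rightarrow> real) \<Rightarrow> bool" where
  "weak_partial S b u g \<longleftrightarrow>
     square_integrable (lebesgue_on S) u \<and> square_integrable (lebesgue_on S) g \<and>
     (\<forall>\<phi>. test_function S \<phi> \<longrightarrow>
        (LINT x|lebesgue_on S. u x * partial_deriv \<phi> b x) = - (LINT x|lebesgue_on S. g x * \<phi> x))"

text \<open>\<open>sobolev m S\<close> is \<open>H\<^sup>m(S)\<close> for open \<open>S\<close>.\<close>

primrec sobolev :: "nat \<Rightarrow> 'a::euclidean_space set \<Rightarrow> ('a \<Rightarrow> real) set" where
  "sobolev 0 S = {u. square_integrable (lebesgue_on S) u}"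
| "sobolev (Suc m) S =
     {u. square_integrable (lebesgue_on S) u \<and> (\<forall>b\<in>Basis. \<exists>g\<in>sobolev m S. weak_partial S b u g)}"

definition weak_gradient ::
    "'a::euclidean_space set \<Rightarrow> ('a \<Rightarrow> real) \<Rightarrow> ('a \<Rightarrow> 'a) \<Rightarrow> bool" where
  "weak_gradient S u G \<longleftrightarrow> (\<forall>b\<in>Basis. weak_partial S b u (\<lambda>x. G x \<bullet> b))"

text \<open>The gradient of \<open>u\<close> on the element \<open>T\<close>: some representative, determined almost everywhere.\<close>

definition grad :: "'a::euclidean_space set \<Rightarrow> ('a \<Rightarrow> real) \<Rightarrow> 'a \<Rightarrow> 'a" where
  "grad T u = (SOME G. weak_gradient (interior T) u G)"


definition multi_indices :: "nat \<Rightarrow> ('a::euclidean_space \<Rightarrow> nat) set" where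
  "multi_indices k = {\<alpha>. (\<forall>b. b \<notin> Basis \<longrightarrow> \<alpha> b = 0) \<and> (\<Sum>b\<in>Basis. \<alpha> b) \<le> k}"

text \<open>Elements of \<open>P\<^sup>k(T)\<close> are identified with the polynomials on the whole space that extend them;
  for \<open>T\<close> with nonempty interior the extension is unique.\<close>

definition polys :: "nat \<Rightarrow> ('a::euclidean_space \<Rightarrow> real) set" where
  "polys k = {p. \<exists>c. \<forall>x. p x = (\<Sum>\<alpha>\<in>multi_indices k. c \<alpha> * (\<Prod>b\<in>Basis. (x \<bullet> b) ^ \<alpha> b))}"

definition polys0 :: "nat \<Rightarrow> 'a::euclidean_space set \<Rightarrow> ('a \<Rightarrow> real) set" where
  "polys0 k T = {p \<in> polys k. (LINT x|lebesgue_on T. p x) = 0}"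


definition polyhedral_domain :: "'a::euclidean_space set \<Rightarrow> bool" where
  "polyhedral_domain \<Omega> \<longleftrightarrow>
     open \<Omega> \<and> connected \<Omega> \<and> \<Omega> \<noteq> {} \<and> interior (closure \<Omega>) = \<Omega> \<and>
     (\<exists>\<P>. finite \<P> \<and> (\<forall>P\<in>\<P>. polytope P) \<and> closure \<Omega> = \<Union>\<P>)"

definition fitted_triangulation :: "'a::euclidean_space set \<Rightarrow> 'a set set \<Rightarrow> bool" where
  "fitted_triangulation \<Omega> \<T> \<longleftrightarrow>
     triangulation \<T> \<and> (\<forall>T\<in>\<T>. int DIM('a) simplex T) \<and> \<Union>\<T> = closure \<Omega>"

definition inradius :: "'a::euclidean_space set \<Rightarrow> real" where
  "inradius T = Sup {r. 0 \<le> r \<and> (\<exists>x. cball x r \<subseteq> T)}"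

definition shape_regular :: "real \<Rightarrow> 'a::euclidean_space set set \<Rightarrow> bool" where
  "shape_regular \<kappa> \<T> \<longleftrightarrow> (\<forall>T\<in>\<T>. diameter T \<le> \<kappa> * inradius T)"

definition quasi_uniform :: "real \<Rightarrow> real \<Rightarrow> real \<Rightarrow> 'a::euclidean_space set set \<Rightarrow> bool" where
  "quasi_uniform c C h \<T> \<longleftrightarrow> (\<forall>T\<in>\<T>. c * h \<le> diameter T \<and> diameter T \<le> C * h)"


definition outer_normal :: "'a::euclidean_space set \<Rightarrow> 'a set \<Rightarrow> 'a" where
  "outer_normal T F = (THE n. norm n = 1 \<and>
     (\<exists>c. T \<subseteq> {x. x \<bullet> n \<le> c} \<and> F = T \<inter> {x. x \<bullet> n = c}))"

text \<open>The \<open>(d-1)\<close>-dimensional Lebesgue measure on the hyperplane through \<open>p\<close> with unit normal \<open>n\<close>.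
  A subset \<open>A\<close> of the hyperplane is measured by the \<open>d\<close>-dimensional volume of the right prism with
  base \<open>A\<close> and height 1, which equals the area of \<open>A\<close> by Fubini's theorem.  For \<open>d = 1\<close> this is the
  unit point mass at \<open>p\<close>.\<close>

definition hyperplane_measure :: "'a::euclidean_space \<Rightarrow> 'a \<Rightarrow> 'a measure" where
  "hyperplane_measure n p =
     distr (restrict_space lborel {y. 0 \<le> (y - p) \<bullet> n \<and> (y - p) \<bullet> n \<le> 1}) borel
       (\<lambda>y. y - ((y - p) \<bullet> n) *\<^sub>R n)"

definition facet_measure :: "'a::euclidean_space set \<Rightarrow> 'a set \<Rightarrow> 'a measure" where
  "facet_measure T F = restrict_space (hyperplane_measure (outer_normal T F) (SOME p. p \<in> F)) F"

text \<open>\<open>is_trace T F u g\<close>: the trace on the facet \<open>F\<close> of \<open>u \<in> H\<^sup>1(T)\<close> is \<open>g \<in> L\<^sup>2(F)\<close>.  As usual, the trace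
  is the continuous extension to \<open>H\<^sup>1(T)\<close> of the restriction to \<open>F\<close> of functions smooth up to the
  boundary.\<close>

definition is_trace ::
    "'a::euclidean_space set \<Rightarrow> 'a set \<Rightarrow> ('a \<Rightarrow> real) \<Rightarrow> ('a \<Rightarrow> real) \<Rightarrow> bool" where
  "is_trace T F u g \<longleftrightarrow>
     square_integrable (facet_measure T F) g \<and>
     (\<exists>G \<phi>. weak_gradient (interior T) u G \<and> (\<forall>m. smooth (\<phi> m)) \<and>
        (\<lambda>m::nat. LINT x|lebesgue_on T. (\<phi> m x - u x)\<^sup>2) \<longlonglongrightarrow> 0 \<and>
        (\<forall>b\<in>Basis. (\<lambda>m. LINT x|lebesgue_on T. (partial_deriv (\<phi> m) b x - G x \<bullet> b)\<^sup>2) \<longlonglongrightarrow> 0) \<and>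
        (\<lambda>m. LINT x|facet_measure T F. (\<phi> m x - g x)\<^sup>2) \<longlonglongrightarrow> 0)"

definition facet_trace ::
    "'a::euclidean_space set \<Rightarrow> 'a set \<Rightarrow> ('a \<Rightarrow> real) \<Rightarrow> 'a \<Rightarrow> real" where
  "facet_trace T F u = (SOME g. is_trace T F u g)"

text \<open>For \<open>u \<in> H\<^sup>2(T)\<close>: \<open>N\<close> is the componentwise trace on \<open>F\<close> of the gradient of \<open>u\<close>.\<close>

definition is_gradient_trace ::
    "'a::euclidean_space set \<Rightarrow> 'a set \<Rightarrow> ('a \<Rightarrow> real) \<Rightarrow> ('a \<Rightarrow> 'a) \<Rightarrow> bool" where
  "is_gradient_trace T F u N \<longleftrightarrow>
     (\<exists>G. weak_gradient (interior T) u G \<and>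
        (\<forall>b\<in>Basis. is_trace T F (\<lambda>x. G x \<bullet> b) (\<lambda>x. N x \<bullet> b)))"

definition normal_deriv ::
    "'a::euclidean_space set \<Rightarrow> 'a set \<Rightarrow> ('a \<Rightarrow> real) \<Rightarrow> 'a \<Rightarrow> real" where
  "normal_deriv T F u = (\<lambda>x. (SOME N. is_gradient_trace T F u N) x \<bullet> outer_normal T F)"

text \<open>The integral over \<open>\<partial>T \<inter> \<partial>\<Omega>\<close>; the integrand may depend on the facet, as traces and normal
  derivatives do.  Since \<open>\<Omega>\<close> is the interior of its closure, a facet shared by two elements meets
  \<open>\<partial>\<Omega>\<close> in a null set only, so that summing over all elements gives the integral over \<open>\<partial>\<Omega>\<close>.\<close>

definition boundary_integral ::
    "'a::euclidean_space set \<Rightarrow> 'a set \<Rightarrow> ('a set \<Rightarrow> 'a \<Rightarrow> real) \<Rightarrow> real" where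
  "boundary_integral \<Omega> T f =
     (\<Sum>F | F facet_of T. LINT x:F \<inter> frontier \<Omega>|facet_measure T F. f F x)"

definition boundary_element :: "'a::euclidean_space set \<Rightarrow> 'a set \<Rightarrow> bool" where
  "boundary_element \<Omega> T \<longleftrightarrow>
     (\<exists>F. F facet_of T \<and> emeasure (facet_measure T F) (F \<inter> frontier \<Omega>) > 0)"


definition a_elem :: "'a::euclidean_space set \<Rightarrow> ('a \<Rightarrow> real) \<Rightarrow> ('a \<Rightarrow> real) \<Rightarrow> real" where
  "a_elem T u v = (LINT x|lebesgue_on T. grad T u x \<bullet> grad T v x)"

definition a_form :: "'a::euclidean_space set set \<Rightarrow> ('a \<Rightarrow> real) \<Rightarrow> ('a \<Rightarrow> real) \<Rightarrow> real" where
  "a_form \<T> u v = (\<Sum>T\<in>\<T>. a_elem T u v)"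

definition Nc_elem ::
    "'a::euclidean_space set \<Rightarrow> 'a set \<Rightarrow> ('a \<Rightarrow> real) \<Rightarrow> ('a \<Rightarrow> real) \<Rightarrow> real" where
  "Nc_elem \<Omega> T u v =
     boundary_integral \<Omega> T (\<lambda>F x. - normal_deriv T F u x * facet_trace T F v x)"

definition Nc_form ::
    "'a::euclidean_space set \<Rightarrow> 'a set set \<Rightarrow> ('a \<Rightarrow> real) \<Rightarrow> ('a \<Rightarrow> real) \<Rightarrow> real" where
  "Nc_form \<Omega> \<T> u v = (\<Sum>T\<in>\<T>. Nc_elem \<Omega> T u v)"

definition Ns_form ::
    "'a::euclidean_space set \<Rightarrow> 'a set set \<Rightarrow> real \<Rightarrow> ('a \<Rightarrow> real) \<Rightarrow> ('a \<Rightarrow> real) \<Rightarrow> real" where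
  "Ns_form \<Omega> \<T> h u v =
     1 / h * (\<Sum>T\<in>\<T>. boundary_integral \<Omega> T (\<lambda>F x. facet_trace T F u x * facet_trace T F v x))"

definition is_lift_elem ::
    "'a::euclidean_space set \<Rightarrow> nat \<Rightarrow> 'a set \<Rightarrow> ('a \<Rightarrow> real) \<Rightarrow> ('a \<Rightarrow> real) \<Rightarrow> bool" where
  "is_lift_elem \<Omega> k T u p \<longleftrightarrow>
     p \<in> polys0 k T \<and> (\<forall>v\<in>polys0 k T. a_elem T p v = Nc_elem \<Omega> T v u)"

definition lift_elem ::
    "'a::euclidean_space set \<Rightarrow> nat \<Rightarrow> 'a set \<Rightarrow> ('a \<Rightarrow> real) \<Rightarrow> 'a \<Rightarrow> real" where
  "lift_elem \<Omega> k T u =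
     (if boundary_element \<Omega> T then (THE p. is_lift_elem \<Omega> k T u p) else (\<lambda>x. 0))"

text \<open>The global lifting is set to 0 on the element boundaries, where it is multivalued; they form a
  null set.\<close>

definition lifting ::
    "'a::euclidean_space set \<Rightarrow> 'a set set \<Rightarrow> nat \<Rightarrow> ('a \<Rightarrow> real) \<Rightarrow> 'a \<Rightarrow> real" where
  "lifting \<Omega> \<T> k u = (\<lambda>x. \<Sum>T\<in>\<T>. indicator (interior T) x * lift_elem \<Omega> k T u x)"

definition A_star :: "'a::euclidean_space set \<Rightarrow> 'a set set \<Rightarrow> nat \<Rightarrow> real \<Rightarrow>
    ('a \<Rightarrow> real) \<Rightarrow> ('a \<Rightarrow> real) \<Rightarrow> real" where
  "A_star \<Omega> \<T> k h u v =
     a_form \<T> u v + Nc_form \<Omega> \<T> u v + Nc_form \<Omega> \<T> v u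
     + 2 * a_form \<T> (lifting \<Omega> \<T> k u) (lifting \<Omega> \<T> k v) + Ns_form \<Omega> \<T> h u v"

definition norm_A ::
    "'a::euclidean_space set \<Rightarrow> 'a set set \<Rightarrow> real \<Rightarrow> ('a \<Rightarrow> real) \<Rightarrow> real" where
  "norm_A \<Omega> \<T> h v = sqrt (a_form \<T> v v + Ns_form \<Omega> \<T> h v v)"

definition V_h :: "'a::euclidean_space set \<Rightarrow> 'a set set \<Rightarrow> nat \<Rightarrow> ('a \<Rightarrow> real) set" where
  "V_h \<Omega> \<T> k = {v. continuous_on (closure \<Omega>) v \<and> (\<forall>T\<in>\<T>. \<exists>p\<in>polys k. \<forall>x\<in>T. v x = p x)}"

abbreviation V_reg :: "'a::euclidean_space set \<Rightarrow> ('a \<Rightarrow> real) set" where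
  "V_reg \<Omega> \<equiv> sobolev 2 \<Omega>"

definition V_sum :: "'a::euclidean_space set \<Rightarrow> 'a set set \<Rightarrow> nat \<Rightarrow> ('a \<Rightarrow> real) set" where
  "V_sum \<Omega> \<T> k = {\<lambda>x. w x + v x | w v. w \<in> V_reg \<Omega> \<and> v \<in> V_h \<Omega> \<T> k}"


text \<open>The operators applied to a single function in \<open>A_star\<close> have exactly one value, up to null sets
  for function-valued ones: elementwise gradient, traces of the function and of its gradient,
  lifting, and elementwise gradient of the lifting.\<close>

definition operators_well_defined ::
    "'a::euclidean_space set \<Rightarrow> 'a set set \<Rightarrow> nat \<Rightarrow> ('a \<Rightarrow> real) \<Rightarrow> bool" where
  "operators_well_defined \<Omega> \<T> k u \<longleftrightarrow>
     (\<forall>T\<in>\<T>.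
        ex1_AE (lebesgue_on T) (weak_gradient (interior T) u) \<and>
        (\<forall>F. F facet_of T \<longrightarrow>
           ex1_AE (facet_measure T F) (is_trace T F u) \<and>
           ex1_AE (facet_measure T F) (is_gradient_trace T F u)) \<and>
        (boundary_element \<Omega> T \<longrightarrow> (\<exists>!p. is_lift_elem \<Omega> k T u p)) \<and>
        ex1_AE (lebesgue_on T) (weak_gradient (interior T) (lifting \<Omega> \<T> k u)))"

text \<open>All integrals in \<open>A_star\<close> converge, those of \<open>Nc_form\<close> with both orders of the arguments.\<close>

definition integrals_exist :: "'a::euclidean_space set \<Rightarrow> 'a set set \<Rightarrow> nat \<Rightarrow>
    ('a \<Rightarrow> real) \<Rightarrow> ('a \<Rightarrow> real) \<Rightarrow> bool" where
  "integrals_exist \<Omega> \<T> k u v \<longleftrightarrow>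
     (\<forall>T\<in>\<T>.
        integrable (lebesgue_on T) (\<lambda>x. grad T u x \<bullet> grad T v x) \<and>
        integrable (lebesgue_on T)
          (\<lambda>x. grad T (lifting \<Omega> \<T> k u) x \<bullet> grad T (lifting \<Omega> \<T> k v) x) \<and>
        (\<forall>F. F facet_of T \<longrightarrow>
           set_integrable (facet_measure T F) (F \<inter> frontier \<Omega>)
             (\<lambda>x. - normal_deriv T F u x * facet_trace T F v x) \<and>
           set_integrable (facet_measure T F) (F \<inter> frontier \<Omega>)
             (\<lambda>x. - normal_deriv T F v x * facet_trace T F u x) \<and>
           set_integrable (facet_measure T F) (F \<inter> frontier \<Omega>)
             (\<lambda>x. facet_trace T F u x * facet_trace T F v x)))"

definition bilinear_form_on ::
    "('a \<Rightarrow> real) set \<Rightarrow> (('a \<Rightarrow> real) \<Rightarrow> ('a \<Rightarrow> real) \<Rightarrow> real) \<Rightarrow> bool" where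
  "bilinear_form_on V B \<longleftrightarrow>
     (\<forall>u\<in>V. \<forall>v\<in>V. \<forall>w\<in>V. \<forall>c.
        B (\<lambda>x. u x + v x) w = B u w + B v w \<and> B (\<lambda>x. c * u x) w = c * B u w \<and>
        B w (\<lambda>x. u x + v x) = B w u + B w v \<and> B w (\<lambda>x. c * u x) = c * B w u)"

definition respects_AE ::
    "'a measure \<Rightarrow> ('a \<Rightarrow> real) set \<Rightarrow> (('a \<Rightarrow> real) \<Rightarrow> ('a \<Rightarrow> real) \<Rightarrow> real) \<Rightarrow> bool" where
  "respects_AE M V B \<longleftrightarrow>
     (\<forall>u\<in>V. \<forall>v\<in>V. \<forall>u'\<in>V. \<forall>v'\<in>V.
        (AE x in M. u x = u' x) \<longrightarrow> (AE x in M. v x = v' x) \<longrightarrow> B u v = B u' v')"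

end

theory Submission
  imports Defs
begin

text \<open>Coercivity is elementary once the lifting is available. On an element \<open>T\<close> a function of the
  finite element space is a polynomial, which after subtraction of its mean is an admissible test
  function for its own lifting \<open>L\<close>. This replaces the consistency term, which has no sign, by
  \<open>a (L, u)\<close>, and \<open>a (u, u) + 2 a (L, u) + 2 a (L, L)\<close> exceeds half of \<open>a (u, u)\<close> by a square
  (\<open>A_elem_coercive\<close>).

  The bulk of the work is the well-definedness of the form: the weak gradient and the traces of a
  function and of its gradient are unique, they exist for \<open>H\<^sup>2\<close> functions and for piecewise polynomials, and
  they are linear. All of this is local to an element, a compact convex set with interior
  points whose facets are its intersections with supporting hyperplanes.

  Smooth functions are dense in \<open>H\<^sup>1\<close> of a convex body (\<open>smooth_dense_in_H1\<close>): the function is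
  composed with a contraction towards an interior point and convolved with a kernel whose radius is
  proportional to the contraction. The support of the kernel then stays in the interior, and the
  approximation is smooth up to the boundary. The same mollification shows that weak
  derivatives are unique (\<open>weak_partial_unique\<close>).

  The trace inequality (\<open>trace_inequality\<close>) compares integrals by homotheties and translations. For a nonnegative function the
  integral over \<open>T\<close> minus the integral over the copy of \<open>T\<close> shrunk towards an interior point
  bounds the integral over a thin slab below the slightly shrunk facet (\<open>facet_le_layer\<close>). The quotient by the
  thickness tends to the derivative of the integral over the shrunk copy, a volume integral of the
  function and its gradient (\<open>facet_integral_le\<close>), while the thin slab measures the facet. The trace
  inequality makes the restrictions of smooth approximants to the facet a Cauchy sequence, whose limit is
  the trace (\<open>is_trace_exists\<close>), and shows that the limit is unique (\<open>is_trace_unique\<close>).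

  The local lifting exists by a Riesz representation on the finite-dimensional space of
  polynomials (\<open>riesz_finite\<close>): the energy form is only semidefinite there, but it degenerates on
  constants, whose normal derivative vanishes. It is unique because a polynomial with vanishing energy
  is constant (\<open>polys_a_elem_0_imp_const\<close>) and the mean is prescribed.\<close>


section \<open>Smooth functions\<close>

lemma C_k_SucI:
  assumes "\<And>x. (f has_derivative f' x) (at x)"
    and "\<And>b. b \<in> Basis \<Longrightarrow> C_k m (\<lambda>x. f' x b)"
  shows "C_k (Suc m) f"
proof -
  have "frechet_derivative f (at x) = f' x" for x
    using assms(1) frechet_derivative_at by metis
  then show ?thesis
    using assms by (auto simp: differentiable_def)
qed

lemma C_k_has_derivative:
  assumes "C_k (Suc m) f"
  shows "(f has_derivative frechet_derivative f (at x)) (at x)"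
  using assms frechet_derivative_works by auto

lemma C_k_Suc_imp: "C_k (Suc m) f \<Longrightarrow> C_k m f"
proof (induction m arbitrary: f)
  case 0
  then show ?case
    by (auto simp: continuous_on_eq_continuous_at differentiable_imp_continuous_within)
next
  case (Suc m)
  have "C_k (Suc m) (partial_deriv f b)" if "b \<in> Basis" for b
    using Suc.prems that by (subst (asm) C_k.simps(2)) blast
  then show ?case
    using Suc by (subst C_k.simps(2)) (auto simp del: C_k.simps(2) dest: C_k.simps(2)[THEN iffD1])
qed

lemma C_k_const: "C_k m (\<lambda>x. c)"
proof (induction m arbitrary: c)
  case (Suc m)
  show ?case
    by (rule C_k_SucI[where f' = "\<lambda>x h. 0"]) (auto intro: Suc)
qed auto

lemma C_k_add: "C_k m f \<Longrightarrow> C_k m g \<Longrightarrow> C_k m (\<lambda>x. f x + g x)"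
proof (induction m arbitrary: f g)
  case (Suc m)
  show ?case
    by (rule C_k_SucI, rule has_derivative_add; (rule C_k_has_derivative)?)
      (use Suc in auto)
qed (auto intro: continuous_intros)

lemma C_k_mult: "C_k m f \<Longrightarrow> C_k m g \<Longrightarrow> C_k m (\<lambda>x. f x * g x)"
proof (induction m arbitrary: f g)
  case (Suc m)
  show ?case
  proof (rule C_k_SucI)
    show "((\<lambda>x. f x * g x) has_derivative
        (\<lambda>h. f x * frechet_derivative g (at x) h + frechet_derivative f (at x) h * g x)) (at x)" for x
      by (intro has_derivative_mult C_k_has_derivative) (use Suc.prems in auto)
    show "C_k m (\<lambda>x. f x * frechet_derivative g (at x) b + frechet_derivative f (at x) b * g x)"
      if "b \<in> Basis" for b
      using Suc.prems that by (intro C_k_add Suc.IH) (auto intro: C_k_Suc_imp simp del: C_k.simps dest: C_k.simps(2)[THEN iffD1])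
  qed
qed (auto intro: continuous_intros)

lemma C_k_inner: "C_k m (\<lambda>x. x \<bullet> v)"
proof (cases m)
  case (Suc n)
  show ?thesis
    unfolding Suc by (rule C_k_SucI, rule has_derivative_inner_left, rule has_derivative_ident) (rule C_k_const)
qed (auto intro: continuous_intros)

lemma C_k_affine: "C_k m f \<Longrightarrow> C_k m (\<lambda>x. f (l *\<^sub>R x + z))"
proof (induction m arbitrary: f)
  case 0
  then show ?case
    by (auto intro!: continuous_on_compose2[of UNIV f] continuous_intros)
next
  case (Suc m)
  show ?case
  proof (rule C_k_SucI)
    fix x
    have "((\<lambda>x. l *\<^sub>R x + z) has_derivative (\<lambda>h. l *\<^sub>R h)) (at x)"
      by (auto intro!: derivative_eq_intros)
    from has_derivative_compose[OF this C_k_has_derivative[OF Suc.prems]]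
    show "((\<lambda>x. f (l *\<^sub>R x + z)) has_derivative
        (\<lambda>h. frechet_derivative f (at (l *\<^sub>R x + z)) (l *\<^sub>R h))) (at x)" .
  next
    fix b :: 'a assume b: "b \<in> Basis"
    have "linear (frechet_derivative f (at y))" for y
      using C_k_has_derivative[OF Suc.prems] has_derivative_linear by blast
    then have "frechet_derivative f (at (l *\<^sub>R x + z)) (l *\<^sub>R b) = l * partial_deriv f b (l *\<^sub>R x + z)" for x
      by (simp add: linear_cmul)
    moreover have "C_k m (partial_deriv f b)"
      using Suc.prems b by auto
    ultimately show "C_k m (\<lambda>x. frechet_derivative f (at (l *\<^sub>R x + z)) (l *\<^sub>R b))"
      using C_k_mult[OF C_k_const Suc.IH] by auto
  qed
qed

text \<open>The closure properties of \<open>C_k\<close> are proved order by order, because the induction for products and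
  compositions needs the statement for all functions of the lower order; \<open>smooth\<close> inherits them.\<close>

lemma smooth_const: "smooth (\<lambda>x. c)"
  and smooth_inner: "smooth (\<lambda>x. x \<bullet> v)"
  and smooth_add: "smooth f \<Longrightarrow> smooth g \<Longrightarrow> smooth (\<lambda>x. f x + g x)"
  and smooth_mult: "smooth f \<Longrightarrow> smooth g \<Longrightarrow> smooth (\<lambda>x. f x * g x)"
  and smooth_affine: "smooth f \<Longrightarrow> smooth (\<lambda>x. f (l *\<^sub>R x + z))"
  unfolding smooth_def using C_k_const C_k_inner C_k_add C_k_mult C_k_affine by blast+

lemma smooth_cmult: "smooth f \<Longrightarrow> smooth (\<lambda>x. c * f x)"
  by (intro smooth_mult smooth_const)

lemma smooth_diff: "smooth f \<Longrightarrow> smooth g \<Longrightarrow> smooth (\<lambda>x. f x - g x)"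
  using smooth_add[of f "\<lambda>x. (-1) * g x"] smooth_cmult[of g "-1"] by simp

lemma smooth_sum:
  assumes "\<And>i. i \<in> I \<Longrightarrow> smooth (f i)"
  shows "smooth (\<lambda>x. \<Sum>i\<in>I. f i x)"
  using assms by (induction I rule: infinite_finite_induct) (auto intro: smooth_const smooth_add)

lemma smooth_prod:
  assumes "\<And>i. i \<in> I \<Longrightarrow> smooth (f i)"
  shows "smooth (\<lambda>x. \<Prod>i\<in>I. f i x)"
  using assms by (induction I rule: infinite_finite_induct) (auto intro: smooth_const smooth_mult)

lemma smooth_power: "smooth f \<Longrightarrow> smooth (\<lambda>x. f x ^ n)"
  by (induction n) (auto intro: smooth_const smooth_mult)

lemma smooth_has_derivative:
  "smooth f \<Longrightarrow> (f has_derivative frechet_derivative f (at x)) (at x)"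
  unfolding smooth_def using C_k_has_derivative by blast

lemma smooth_partial: "smooth f \<Longrightarrow> b \<in> Basis \<Longrightarrow> smooth (partial_deriv f b)"
  unfolding smooth_def by (metis C_k.simps(2))

lemma smooth_continuous: "smooth f \<Longrightarrow> continuous_on S f"
  unfolding smooth_def by (metis C_k.simps(1) continuous_on_subset subset_UNIV)

lemma smooth_continuous_partial:
  "smooth f \<Longrightarrow> b \<in> Basis \<Longrightarrow> continuous_on S (partial_deriv f b)"
  by (intro smooth_continuous smooth_partial)

lemma partial_deriv_eq:
  "(f has_derivative f') (at x) \<Longrightarrow> partial_deriv f b x = f' b"
  using frechet_derivative_at by metis

lemma smooth_partial_add:
  "smooth f \<Longrightarrow> smooth g \<Longrightarrow> partial_deriv (\<lambda>x. f x + g x) b x = partial_deriv f b x + partial_deriv g b x"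
  by (rule partial_deriv_eq) (auto intro!: has_derivative_add smooth_has_derivative)

lemma smooth_partial_diff:
  "smooth f \<Longrightarrow> smooth g \<Longrightarrow> partial_deriv (\<lambda>x. f x - g x) b x = partial_deriv f b x - partial_deriv g b x"
  by (rule partial_deriv_eq) (auto intro!: has_derivative_diff smooth_has_derivative)

lemma smooth_partial_mult:
  "smooth f \<Longrightarrow> smooth g \<Longrightarrow>
    partial_deriv (\<lambda>x. f x * g x) b x = f x * partial_deriv g b x + partial_deriv f b x * g x"
  by (rule partial_deriv_eq) (auto intro!: has_derivative_mult smooth_has_derivative)

lemma smooth_partial_cmult:
  "smooth f \<Longrightarrow> partial_deriv (\<lambda>x. c * f x) b x = c * partial_deriv f b x"
  by (rule partial_deriv_eq) (auto intro!: has_derivative_mult_right smooth_has_derivative)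

lemma smooth_partial_affine:
  assumes "smooth f"
  shows "partial_deriv (\<lambda>x. f (l *\<^sub>R x + z)) b x = l * partial_deriv f b (l *\<^sub>R x + z)"
proof -
  have "((\<lambda>x. l *\<^sub>R x + z) has_derivative (\<lambda>h. l *\<^sub>R h)) (at x)"
    by (auto intro!: derivative_eq_intros)
  from has_derivative_compose[OF this smooth_has_derivative[OF assms]]
  have "partial_deriv (\<lambda>x. f (l *\<^sub>R x + z)) b x = frechet_derivative f (at (l *\<^sub>R x + z)) (l *\<^sub>R b)"
    by (rule partial_deriv_eq)
  moreover have "linear (frechet_derivative f (at (l *\<^sub>R x + z)))"
    using smooth_has_derivative[OF assms] has_derivative_linear by blast
  ultimately show ?thesis
    by (simp add: linear_cmul)
qed

lemma frechet_derivative_partials: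
  assumes "smooth f"
  shows "frechet_derivative f (at x) v = (\<Sum>b\<in>Basis. (v \<bullet> b) * partial_deriv f b x)"
proof -
  have lin: "linear (frechet_derivative f (at x))"
    using smooth_has_derivative[OF assms] has_derivative_linear by blast
  have "frechet_derivative f (at x) v = frechet_derivative f (at x) (\<Sum>b\<in>Basis. (v \<bullet> b) *\<^sub>R b)"
    by (simp add: euclidean_representation)
  then show ?thesis
    using lin by (simp add: linear_sum linear_cmul)
qed

text \<open>The flat functions \<open>t\<^sup>-\<^sup>n exp (-1/t)\<close>: each derivative is a linear combination of functions of
  the same family, which makes the bump function smooth by one induction over all \<open>n\<close> at once.\<close>

definition flat_fun :: "nat \<Rightarrow> real \<Rightarrow> real" where
  "flat_fun n t = (if t > 0 then (1 / t) ^ n * exp (- (1 / t)) else 0)"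

lemma flat_fun_tendsto_0: "(flat_fun n \<longlongrightarrow> 0) (at 0)"
proof -
  have "((\<lambda>t::real. inverse t ^ n / exp (inverse t)) \<longlongrightarrow> 0) (at_right 0)"
    by (rule filterlim_compose[OF tendsto_power_div_exp_0 filterlim_inverse_at_top_right])
  then have "(flat_fun n \<longlongrightarrow> 0) (at_right 0)"
    by (rule Lim_transform_eventually)
      (auto simp: eventually_at_filter flat_fun_def exp_minus divide_simps intro!: always_eventually)
  moreover have "(flat_fun n \<longlongrightarrow> 0) (at_left 0)"
    by (rule tendsto_eventually) (auto simp: eventually_at_filter flat_fun_def)
  ultimately show ?thesis
    by (simp add: filterlim_at_split)
qed

lemma flat_fun_has_derivative:
  "(flat_fun n has_real_derivative (flat_fun (n + 2) t - n * flat_fun (n + 1) t)) (at t)"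
proof -
  consider "t > 0" | "t < 0" | "t = 0" by linarith
  then show ?thesis
  proof cases
    case 1
    have "((\<lambda>t. (1 / t) ^ n * exp (- (1 / t))) has_real_derivative
        (flat_fun (n + 2) t - n * flat_fun (n + 1) t)) (at t)"
    proof -
      have *: "real n * (1 / t) ^ (n - Suc 0) * (1 / t\<^sup>2) = real n * (1 / t) ^ (n + 1)" if "t > 0"
        by (cases n) (auto simp: power2_eq_square field_simps)
      show ?thesis
        using 1 * by (auto intro!: derivative_eq_intros simp: flat_fun_def power2_eq_square algebra_simps)
    qed
    then show ?thesis
      by (rule DERIV_cong_ev[THEN iffD1, rotated -1])
        (use 1 in \<open>auto simp: flat_fun_def eventually_nhds intro!: exI[of _ "{0<..}"]\<close>)
  next
    case 2
    have "((\<lambda>t. 0) has_real_derivative (flat_fun (n + 2) t - n * flat_fun (n + 1) t)) (at t)"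
      using 2 by (auto simp: flat_fun_def)
    then show ?thesis
      by (rule DERIV_cong_ev[THEN iffD1, rotated -1])
        (use 2 in \<open>auto simp: flat_fun_def eventually_nhds intro!: exI[of _ "{..<0}"]\<close>)
  next
    case 3
    have "flat_fun n h / h = flat_fun (n + 1) h" for h
      by (auto simp: flat_fun_def)
    then show ?thesis
      using flat_fun_tendsto_0[of "n + 1"] 3 unfolding DERIV_def by (simp add: flat_fun_def[of _ 0])
  qed
qed

lemma continuous_flat_fun: "continuous_on UNIV (flat_fun n)"
  using flat_fun_has_derivative[of n]
  by (auto simp: continuous_on_eq_continuous_at intro: DERIV_isCont)

lemma flat_fun_radial_has_derivative:
  fixes x :: "'a::euclidean_space"
  shows "((\<lambda>x. flat_fun n (1 - x \<bullet> x)) has_derivative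
    (\<lambda>h. (flat_fun (n + 2) (1 - x \<bullet> x) + (- real n) * flat_fun (n + 1) (1 - x \<bullet> x)) * (- 2 * (x \<bullet> h)))) (at x)"
proof -
  have 1: "((\<lambda>x::'a. 1 - x \<bullet> x) has_derivative (\<lambda>h. - 2 * (x \<bullet> h))) (at x)"
    by (auto intro!: derivative_eq_intros simp: inner_commute)
  have 2: "(flat_fun n has_derivative
      (\<lambda>s. (flat_fun (n + 2) (1 - x \<bullet> x) + (- real n) * flat_fun (n + 1) (1 - x \<bullet> x)) * s)) (at (1 - x \<bullet> x))"
    using flat_fun_has_derivative[of n "1 - x \<bullet> x"] unfolding has_field_derivative_def by simp
  show ?thesis
    by (rule has_derivative_compose[OF 1 2])
qed

lemma C_k_flat_fun_radial: "C_k m (\<lambda>x::'a::euclidean_space. flat_fun n (1 - x \<bullet> x))"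
proof (induction m arbitrary: n)
  case 0
  have "continuous_on UNIV (\<lambda>x::'a. flat_fun n (1 - x \<bullet> x))"
    by (rule continuous_on_compose2[OF continuous_flat_fun]) (auto intro!: continuous_intros)
  then show ?case
    by simp
next
  case (Suc m)
  have "C_k m (\<lambda>x::'a. (flat_fun (n + 2) (1 - x \<bullet> x) + (- real n) * flat_fun (n + 1) (1 - x \<bullet> x)) * (- 2 * (x \<bullet> b)))" for b
    by (intro C_k_mult C_k_add C_k_const C_k_inner Suc)
  then show ?case
    using flat_fun_radial_has_derivative by (rule C_k_SucI[rotated])
qed

definition bump :: "'a::euclidean_space \<Rightarrow> real" where
  "bump x = flat_fun 0 (1 - x \<bullet> x)"

lemma smooth_bump: "smooth bump"
  unfolding smooth_def bump_def by (rule allI, rule C_k_flat_fun_radial)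

lemma bump_nonneg: "bump x \<ge> 0"
  by (simp add: bump_def flat_fun_def)

lemma bump_pos_iff: "bump x \<noteq> 0 \<longleftrightarrow> norm x < 1"
proof -
  have "x \<bullet> x < 1 \<longleftrightarrow> norm x < 1"
    by (metis norm_lt_square abs_square_less_1 dot_square_norm norm_ge_zero abs_of_nonneg)
  then show ?thesis
    by (simp add: bump_def flat_fun_def)
qed

section \<open>Square integrable functions\<close>

lemma square_integrable_cong:
  assumes "\<And>x. x \<in> space M \<Longrightarrow> f x = g x"
  shows "square_integrable M f \<longleftrightarrow> square_integrable M g"
proof -
  have "f \<in> borel_measurable M \<longleftrightarrow> g \<in> borel_measurable M"
    using assms by (rule measurable_cong)
  moreover have "integrable M (\<lambda>x. (f x)\<^sup>2) \<longleftrightarrow> integrable M (\<lambda>x. (g x)\<^sup>2)"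
    using assms by (intro Bochner_Integration.integrable_cong) auto
  ultimately show ?thesis
    by (simp add: square_integrable_def)
qed

lemma square_integrable_mult:
  assumes "square_integrable M f" "square_integrable M g"
  shows "integrable M (\<lambda>x. f x * g x)"
proof (rule Bochner_Integration.integrable_bound)
  show "integrable M (\<lambda>x. (f x)\<^sup>2 + (g x)\<^sup>2)"
    using assms by (auto simp: square_integrable_def)
  show "(\<lambda>x. f x * g x) \<in> borel_measurable M"
    using assms by (auto simp: square_integrable_def)
  have "\<bar>a * b\<bar> \<le> a\<^sup>2 + b\<^sup>2" for a b :: real
  proof -
    have "2 * (\<bar>a\<bar> * \<bar>b\<bar>) \<le> a\<^sup>2 + b\<^sup>2"
      using sum_squares_bound[of "\<bar>a\<bar>" "\<bar>b\<bar>"] by (simp add: mult.assoc)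
    moreover have "0 \<le> \<bar>a\<bar> * \<bar>b\<bar>" by simp
    ultimately show ?thesis unfolding abs_mult by linarith
  qed
  then show "AE x in M. norm (f x * g x) \<le> norm ((f x)\<^sup>2 + (g x)\<^sup>2)"
    by simp
qed

lemma square_integrable_cmult:
  "square_integrable M f \<Longrightarrow> square_integrable M (\<lambda>x. c * f x)"
  by (auto simp: square_integrable_def power_mult_distrib)

lemma square_integrable_add:
  assumes "square_integrable M f" "square_integrable M g"
  shows "square_integrable M (\<lambda>x. f x + g x)"
proof -
  have "integrable M (\<lambda>x. (f x)\<^sup>2 + (g x)\<^sup>2 + 2 * (f x * g x))"
    using assms square_integrable_mult[OF assms] by (auto simp: square_integrable_def)
  also have "(\<lambda>x. (f x)\<^sup>2 + (g x)\<^sup>2 + 2 * (f x * g x)) = (\<lambda>x. (f x + g x)\<^sup>2)"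
    by (simp add: power2_sum mult.assoc)
  finally show ?thesis
    using assms by (auto simp: square_integrable_def)
qed

lemma square_integrable_diff:
  "square_integrable M f \<Longrightarrow> square_integrable M g \<Longrightarrow> square_integrable M (\<lambda>x. f x - g x)"
  using square_integrable_add[of M f "\<lambda>x. (-1) * g x"] square_integrable_cmult[of M g "-1"] by simp

lemma square_integrable_zero: "square_integrable M (\<lambda>x. 0)"
  by (simp add: square_integrable_def)

lemma square_integrable_sum:
  assumes "\<And>i. i \<in> I \<Longrightarrow> square_integrable M (f i)"
  shows "square_integrable M (\<lambda>x. \<Sum>i\<in>I. f i x)"
  using assms
  by (induction I rule: infinite_finite_induct) (auto intro: square_integrable_zero square_integrable_add)

lemma square_integrable_bounded:
  fixes f :: "_ \<Rightarrow> real"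
  assumes "finite_measure M" "f \<in> borel_measurable M" "\<And>x. x \<in> space M \<Longrightarrow> \<bar>f x\<bar> \<le> B"
  shows "square_integrable M f"
proof -
  interpret finite_measure M by fact
  have "\<bar>f x\<bar>\<^sup>2 \<le> B\<^sup>2" if "x \<in> space M" for x
    using assms(3)[OF that] by (intro power_mono) auto
  then have "integrable M (\<lambda>x. (f x)\<^sup>2)"
    using assms(2) by (intro integrable_const_bound[of _ "B\<^sup>2"]) auto
  then show ?thesis
    using assms(2) by (simp add: square_integrable_def)
qed

lemma square_integrable_imp_integrable':
  assumes "finite_measure M" "square_integrable M f"
  shows "integrable M f"
proof -
  interpret finite_measure M by fact
  have "square_integrable M (\<lambda>x. 1)"
    by (rule square_integrable_bounded[OF assms(1), of _ 1]) auto
  from square_integrable_mult[OF assms(2) this] show ?thesis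
    by simp
qed

lemma L2_norm_add_le:
  assumes "square_integrable M f" "square_integrable M g"
  shows "(LINT x|M. (f x + g x)\<^sup>2) \<le> 2 * (LINT x|M. (f x)\<^sup>2) + 2 * (LINT x|M. (g x)\<^sup>2)"
proof -
  have "(LINT x|M. (f x + g x)\<^sup>2) \<le> (LINT x|M. 2 * (f x)\<^sup>2 + 2 * (g x)\<^sup>2)"
  proof (rule integral_mono)
    show "integrable M (\<lambda>x. (f x + g x)\<^sup>2)"
      using square_integrable_add[OF assms] by (simp add: square_integrable_def)
    show "integrable M (\<lambda>x. 2 * (f x)\<^sup>2 + 2 * (g x)\<^sup>2)"
      using assms by (auto simp: square_integrable_def)
    show "(f x + g x)\<^sup>2 \<le> 2 * (f x)\<^sup>2 + 2 * (g x)\<^sup>2" for x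
      using sum_squares_bound[of "f x" "g x"] by (simp add: power2_sum)
  qed
  also have "\<dots> = 2 * (LINT x|M. (f x)\<^sup>2) + 2 * (LINT x|M. (g x)\<^sup>2)"
    using assms by (subst Bochner_Integration.integral_add) (auto simp: square_integrable_def)
  finally show ?thesis .
qed

lemma L2_norm_eq_0_imp_AE:
  assumes "square_integrable M f" "(LINT x|M. (f x)\<^sup>2) = 0"
  shows "AE x in M. f x = 0"
proof -
  have "AE x in M. (f x)\<^sup>2 = 0"
    using assms integral_nonneg_eq_0_iff_AE[of M "\<lambda>x. (f x)\<^sup>2"] by (auto simp: square_integrable_def)
  then show ?thesis by auto
qed

lemma L2_tendsto_diff:
  assumes "\<And>m. square_integrable M (\<phi> m)" "\<And>m. square_integrable M (\<psi> m)"
    and "square_integrable M f" "square_integrable M g"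
    and "(\<lambda>m. LINT x|M. (\<phi> m x - f x)\<^sup>2) \<longlonglongrightarrow> 0" "(\<lambda>m. LINT x|M. (\<psi> m x - g x)\<^sup>2) \<longlonglongrightarrow> 0"
  shows "(\<lambda>m. LINT x|M. ((\<phi> m x - \<psi> m x) - (f x - g x))\<^sup>2) \<longlonglongrightarrow> 0"
proof (rule tendsto_sandwich[OF _ _ tendsto_const])
  show "\<forall>\<^sub>F m in sequentially. (LINT x|M. ((\<phi> m x - \<psi> m x) - (f x - g x))\<^sup>2)
      \<le> 2 * (LINT x|M. (\<phi> m x - f x)\<^sup>2) + 2 * (LINT x|M. (\<psi> m x - g x)\<^sup>2)"
  proof (intro always_eventually allI)
    fix m
    have "(LINT x|M. ((\<phi> m x - \<psi> m x) - (f x - g x))\<^sup>2)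
        = (LINT x|M. ((\<phi> m x - f x) + (g x - \<psi> m x))\<^sup>2)"
      by (simp add: algebra_simps)
    also have "\<dots> \<le> 2 * (LINT x|M. (\<phi> m x - f x)\<^sup>2) + 2 * (LINT x|M. (g x - \<psi> m x)\<^sup>2)"
      using assms by (intro L2_norm_add_le square_integrable_diff)
    finally show "(LINT x|M. ((\<phi> m x - \<psi> m x) - (f x - g x))\<^sup>2)
      \<le> 2 * (LINT x|M. (\<phi> m x - f x)\<^sup>2) + 2 * (LINT x|M. (\<psi> m x - g x)\<^sup>2)"
      by (simp add: power2_commute)
  qed
  show "(\<lambda>m. 2 * (LINT x|M. (\<phi> m x - f x)\<^sup>2) + 2 * (LINT x|M. (\<psi> m x - g x)\<^sup>2)) \<longlonglongrightarrow> 0"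
    using tendsto_add[OF tendsto_mult_left[OF assms(5), of 2] tendsto_mult_left[OF assms(6), of 2]] by simp
qed (simp add: integral_nonneg)

lemma L2_tendsto_cmult:
  assumes "(\<lambda>m. LINT x|M. (\<phi> m x - f x)\<^sup>2) \<longlonglongrightarrow> 0"
  shows "(\<lambda>m. LINT x|M. (c * \<phi> m x - c * f x)\<^sup>2) \<longlonglongrightarrow> (0::real)"
  using tendsto_mult_left[OF assms, of "c\<^sup>2"]
  by (simp add: right_diff_distrib[symmetric] power_mult_distrib)

lemma L2_tendsto_add:
  assumes "\<And>m. square_integrable M (\<phi> m)" "\<And>m. square_integrable M (\<psi> m)"
    and "square_integrable M f" "square_integrable M g"
    and "(\<lambda>m. LINT x|M. (\<phi> m x - f x)\<^sup>2) \<longlonglongrightarrow> 0" "(\<lambda>m. LINT x|M. (\<psi> m x - g x)\<^sup>2) \<longlonglongrightarrow> 0"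
  shows "(\<lambda>m. LINT x|M. ((\<phi> m x + \<psi> m x) - (f x + g x))\<^sup>2) \<longlonglongrightarrow> 0"
proof -
  have "(\<lambda>m. LINT x|M. (\<phi> m x - (- 1) * \<psi> m x - (f x - (- 1) * g x))\<^sup>2) \<longlonglongrightarrow> 0"
    by (rule L2_tendsto_diff[OF assms(1) square_integrable_cmult[OF assms(2)] assms(3)
          square_integrable_cmult[OF assms(4)] assms(5) L2_tendsto_cmult[OF assms(6)]])
  then show ?thesis
    by simp
qed

lemma L2_tendsto_unique:
  assumes "\<And>m. square_integrable M (\<phi> m)" "square_integrable M f" "square_integrable M g"
    and "(\<lambda>m. LINT x|M. (\<phi> m x - f x)\<^sup>2) \<longlonglongrightarrow> 0" "(\<lambda>m. LINT x|M. (\<phi> m x - g x)\<^sup>2) \<longlonglongrightarrow> 0"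
  shows "AE x in M. f x = g x"
proof -
  have "(\<lambda>m. LINT x|M. ((\<phi> m x - \<phi> m x) - (f x - g x))\<^sup>2) \<longlonglongrightarrow> 0"
    using assms by (intro L2_tendsto_diff) auto
  then have "(LINT x|M. (f x - g x)\<^sup>2) = 0"
    by (simp add: LIMSEQ_const_iff power2_commute)
  then show ?thesis
    using L2_norm_eq_0_imp_AE[OF square_integrable_diff[OF assms(2,3)]] by simp
qed

lemma square_integrable_continuous:
  fixes f :: "'a::euclidean_space \<Rightarrow> real"
  assumes "compact T" "continuous_on T f"
  shows "square_integrable (lebesgue_on T) f"
proof -
  obtain B where "\<And>x. x \<in> T \<Longrightarrow> \<bar>f x\<bar> \<le> B"
    using compact_imp_bounded[OF compact_continuous_image[OF assms(2,1)]]
    by (auto simp: bounded_iff)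
  moreover have "f \<in> borel_measurable (lebesgue_on T)"
    using assms by (intro continuous_imp_measurable_on_sets_lebesgue) (auto simp: lmeasurable_compact fmeasurableD)
  moreover have "finite_measure (lebesgue_on T)"
    using assms by (intro finite_measure_lebesgue_on lmeasurable_compact)
  ultimately show ?thesis
    by (intro square_integrable_bounded) auto
qed

subsection \<open>Removing a null set\<close>

text \<open>The forms integrate over the closed elements while weak derivatives live on their interiors.
  The boundary of a convex set is a null set, and for the complete Lebesgue measure a null set
  changes neither measurability nor integrals.\<close>

lemma restrict_indicator_AE:
  assumes "S \<subseteq> T" "negligible (T - S)"
  shows "AE x in lebesgue. (indicator S x :: real) *\<^sub>R f x = indicator T x *\<^sub>R f x"
proof (rule AE_I')
  show "T - S \<in> null_sets lebesgue"
    using assms(2) negligible_iff_null_sets by blast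
  show "{x \<in> space lebesgue. (indicator S x :: real) *\<^sub>R f x \<noteq> indicator T x *\<^sub>R f x} \<subseteq> T - S"
    using assms(1) by (auto simp: indicator_def split: if_splits)
qed

lemma lebesgue_on_null_diff:
  fixes f :: "'a::euclidean_space \<Rightarrow> real"
  assumes ST: "S \<subseteq> T" "negligible (T - S)" and meas: "S \<in> sets lebesgue" "T \<in> sets lebesgue"
  shows measurable_null_diff: "f \<in> borel_measurable (lebesgue_on S) \<longleftrightarrow> f \<in> borel_measurable (lebesgue_on T)"
    and integral_null_diff: "integral\<^sup>L (lebesgue_on S) f = integral\<^sup>L (lebesgue_on T) f"
    and integrable_null_diff: "integrable (lebesgue_on S) f \<longleftrightarrow> integrable (lebesgue_on T) f"
    and AE_null_diff: "(AE x in lebesgue_on S. P x) \<longleftrightarrow> (AE x in lebesgue_on T. P x)"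
proof -
  have mS: "S \<inter> space lebesgue \<in> sets lebesgue" and mT: "T \<inter> space lebesgue \<in> sets lebesgue"
    using meas by auto
  define fS fT where fS_def: "fS x = (indicator S x :: real) *\<^sub>R f x"
    and fT_def: "fT x = (indicator T x :: real) *\<^sub>R f x" for x
  have ae: "AE x in lebesgue. fS x = fT x"
    unfolding fS_def fT_def by (rule restrict_indicator_AE[OF ST])
  then have ae': "AE x in lebesgue. fT x = fS x"
    by (auto simp: eq_commute)
  have *: "fS \<in> borel_measurable lebesgue \<longleftrightarrow> fT \<in> borel_measurable lebesgue"
    by (rule iffI, erule borel_measurable_AE[OF _ ae], erule borel_measurable_AE[OF _ ae'])
  have mfS: "f \<in> borel_measurable (lebesgue_on S) \<longleftrightarrow> fS \<in> borel_measurable lebesgue"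
    unfolding fS_def[abs_def] by (rule borel_measurable_restrict_space_iff[OF mS])
  have mfT: "f \<in> borel_measurable (lebesgue_on T) \<longleftrightarrow> fT \<in> borel_measurable lebesgue"
    unfolding fT_def[abs_def] by (rule borel_measurable_restrict_space_iff[OF mT])
  show mf: "f \<in> borel_measurable (lebesgue_on S) \<longleftrightarrow> f \<in> borel_measurable (lebesgue_on T)"
    unfolding mfS mfT by (rule *)
  have "integrable lebesgue fS \<longleftrightarrow> integrable lebesgue fT"
    using * ae ae' by (metis borel_measurable_integrable integrable_cong_AE_imp)
  then show "integrable (lebesgue_on S) f \<longleftrightarrow> integrable (lebesgue_on T) f"
    unfolding integrable_restrict_space[OF mS] integrable_restrict_space[OF mT] fS_def[abs_def] fT_def[abs_def] .
  have "integral\<^sup>L lebesgue fS = integral\<^sup>L lebesgue fT"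
  proof (cases "fS \<in> borel_measurable lebesgue")
    case True
    with * ae show ?thesis
      by (intro integral_cong_AE) auto
  next
    case False
    with * show ?thesis
      by (metis borel_measurable_integrable not_integrable_integral_eq)
  qed
  then show "integral\<^sup>L (lebesgue_on S) f = integral\<^sup>L (lebesgue_on T) f"
    unfolding integral_restrict_space[OF mS] integral_restrict_space[OF mT] fS_def[abs_def] fT_def[abs_def] .
  have "AE x in lebesgue. x \<notin> T - S"
    using ST(2) negligible_iff_null_sets AE_not_in by blast
  then show "(AE x in lebesgue_on S. P x) \<longleftrightarrow> (AE x in lebesgue_on T. P x)"
    unfolding AE_restrict_space_iff[OF mS] AE_restrict_space_iff[OF mT]
    using ST(1) by (auto elim!: eventually_elim2)
qed

definition convex_body :: "'a::euclidean_space set \<Rightarrow> bool" where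
  "convex_body T \<longleftrightarrow> compact T \<and> convex T \<and> interior T \<noteq> {}"

lemma convex_body_lmeasurable:
  assumes "convex_body T"
  shows "T \<in> lmeasurable" "interior T \<in> lmeasurable" "T \<in> sets lebesgue" "interior T \<in> sets lebesgue"
    and "negligible (T - interior T)"
proof -
  show T: "T \<in> lmeasurable" "interior T \<in> lmeasurable"
    using assms by (auto simp: convex_body_def lmeasurable_compact lmeasurable_interior compact_imp_bounded)
  then show "T \<in> sets lebesgue" "interior T \<in> sets lebesgue"
    by (auto simp: fmeasurableD)
  have "T - interior T = frontier T"
    using assms by (simp add: convex_body_def frontier_def compact_imp_closed)
  then show "negligible (T - interior T)"
    using assms by (simp add: convex_body_def negligible_convex_frontier)
qed

lemma convex_body_finite_measure: "convex_body T \<Longrightarrow> finite_measure (lebesgue_on T)"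
  by (rule finite_measure_lebesgue_on[OF convex_body_lmeasurable(1)])

lemma
  fixes f :: "'a::euclidean_space \<Rightarrow> real"
  assumes "convex_body T"
  shows convex_body_integral: "integral\<^sup>L (lebesgue_on (interior T)) f = integral\<^sup>L (lebesgue_on T) f"
    and convex_body_AE: "(AE x in lebesgue_on (interior T). P x) \<longleftrightarrow> (AE x in lebesgue_on T. P x)"
    and convex_body_square_integrable:
      "square_integrable (lebesgue_on (interior T)) f \<longleftrightarrow> square_integrable (lebesgue_on T) f"
proof -
  note T = interior_subset convex_body_lmeasurable(5,4,3)[OF assms]
  show "integral\<^sup>L (lebesgue_on (interior T)) f = integral\<^sup>L (lebesgue_on T) f"
    by (rule integral_null_diff[OF T])
  show "(AE x in lebesgue_on (interior T). P x) \<longleftrightarrow> (AE x in lebesgue_on T. P x)"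
    by (rule AE_null_diff[OF T])
  show "square_integrable (lebesgue_on (interior T)) f \<longleftrightarrow> square_integrable (lebesgue_on T) f"
    unfolding square_integrable_def measurable_null_diff[OF T] integrable_null_diff[OF T] ..
qed

subsection \<open>Density of the continuous functions\<close>

definition L2_approximable :: "'a::euclidean_space set \<Rightarrow> ('a \<Rightarrow> real) \<Rightarrow> bool" where
  "L2_approximable T f \<longleftrightarrow> square_integrable (lebesgue_on T) f \<and>
     (\<forall>e>0. \<exists>g. continuous_on UNIV g \<and> square_integrable (lebesgue_on T) g \<and>
        (LINT x|lebesgue_on T. (f x - g x)\<^sup>2) < e)"

lemma L2_approximable_cong:
  assumes "\<And>x. x \<in> T \<Longrightarrow> f x = f' x"
  shows "L2_approximable T f \<longleftrightarrow> L2_approximable T f'"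
proof -
  have "square_integrable (lebesgue_on T) f \<longleftrightarrow> square_integrable (lebesgue_on T) f'"
    using assms by (intro square_integrable_cong) simp
  moreover have "(LINT x|lebesgue_on T. (f x - g x)\<^sup>2) = (LINT x|lebesgue_on T. (f' x - g x)\<^sup>2)" for g
    using assms by (intro Bochner_Integration.integral_cong) auto
  ultimately show ?thesis
    by (simp add: L2_approximable_def)
qed

lemma L2_approximable_cmult:
  assumes "L2_approximable T f"
  shows "L2_approximable T (\<lambda>x. c * f x)"
proof (cases "c = 0")
  case True
  have "L2_approximable T (\<lambda>x. 0)"
    unfolding L2_approximable_def by (auto intro!: square_integrable_zero exI[of _ "\<lambda>x. 0"])
  then show ?thesis using True by simp
next
  case False
  show ?thesis
    unfolding L2_approximable_def
  proof (intro conjI allI impI)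
    show "square_integrable (lebesgue_on T) (\<lambda>x. c * f x)"
      using assms by (simp add: L2_approximable_def square_integrable_cmult)
    fix e :: real assume "e > 0"
    then have "e / c\<^sup>2 > 0" using False by simp
    then obtain g where g: "continuous_on UNIV g" "square_integrable (lebesgue_on T) g"
        "(LINT x|lebesgue_on T. (f x - g x)\<^sup>2) < e / c\<^sup>2"
      using assms unfolding L2_approximable_def by blast
    have "(LINT x|lebesgue_on T. (c * f x - c * g x)\<^sup>2) < e"
    proof -
      have "(LINT x|lebesgue_on T. (c * f x - c * g x)\<^sup>2) = c\<^sup>2 * (LINT x|lebesgue_on T. (f x - g x)\<^sup>2)"
        by (simp add: right_diff_distrib[symmetric] power_mult_distrib)
      then show ?thesis
        using g(3) False by (simp add: pos_less_divide_eq mult.commute)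
    qed
    then show "\<exists>g. continuous_on UNIV g \<and> square_integrable (lebesgue_on T) g \<and>
        (LINT x|lebesgue_on T. (c * f x - g x)\<^sup>2) < e"
      using g by (intro exI[of _ "\<lambda>x. c * g x"]) (auto intro: continuous_intros square_integrable_cmult)
  qed
qed

lemma L2_approximable_add:
  assumes "L2_approximable T f" "L2_approximable T f'"
  shows "L2_approximable T (\<lambda>x. f x + f' x)"
  unfolding L2_approximable_def
proof (intro conjI allI impI)
  show "square_integrable (lebesgue_on T) (\<lambda>x. f x + f' x)"
    using assms by (simp add: L2_approximable_def square_integrable_add)
  fix e :: real assume "e > 0"
  then have "e / 4 > 0" by simp
  then obtain g g' where g: "continuous_on UNIV g" "square_integrable (lebesgue_on T) g"
      "(LINT x|lebesgue_on T. (f x - g x)\<^sup>2) < e / 4"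
    and g': "continuous_on UNIV g'" "square_integrable (lebesgue_on T) g'"
      "(LINT x|lebesgue_on T. (f' x - g' x)\<^sup>2) < e / 4"
    using assms unfolding L2_approximable_def by meson
  have "(LINT x|lebesgue_on T. ((f x - g x) + (f' x - g' x))\<^sup>2)
      \<le> 2 * (LINT x|lebesgue_on T. (f x - g x)\<^sup>2) + 2 * (LINT x|lebesgue_on T. (f' x - g' x)\<^sup>2)"
    using assms g g' by (intro L2_norm_add_le square_integrable_diff) (auto simp: L2_approximable_def)
  also have "\<dots> < e"
    using g g' by simp
  finally have "(LINT x|lebesgue_on T. ((f x + f' x) - (g x + g' x))\<^sup>2) < e"
    by (simp add: algebra_simps)
  then show "\<exists>g. continuous_on UNIV g \<and> square_integrable (lebesgue_on T) g \<and>
      (LINT x|lebesgue_on T. (f x + f' x - g x)\<^sup>2) < e"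
    using g g' by (intro exI[of _ "\<lambda>x. g x + g' x"]) (auto intro: continuous_intros square_integrable_add)
qed

text \<open>By regularity of the Lebesgue measure a measurable set lies between a closed and an open set whose
  difference has small measure; a Urysohn function of this pair differs from the indicator only
  there, and by at most 1.\<close>

lemma L2_approximable_indicator:
  assumes T: "T \<in> lmeasurable" and A: "A \<in> sets lebesgue"
  shows "L2_approximable T (indicator A)"
  unfolding L2_approximable_def
proof (intro conjI allI impI)
  have fm: "finite_measure (lebesgue_on T)"
    using T by (rule finite_measure_lebesgue_on)
  have meas: "f \<in> borel_measurable lebesgue \<Longrightarrow> f \<in> borel_measurable (lebesgue_on T)" for f :: "'a \<Rightarrow> real"
    by (rule measurable_restrict_space1)
  show sA: "square_integrable (lebesgue_on T) (indicator A)"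
    using A by (intro square_integrable_bounded[OF fm, of _ 1] meas) (auto simp: indicator_def)
  fix e :: real assume "e > 0"
  then have e2: "e / 2 > 0" by simp
  obtain U where U: "open U" "A \<subseteq> U" "(U - A) \<in> lmeasurable" "emeasure lebesgue (U - A) < ennreal (e / 2)"
    using sets_lebesgue_outer_open[OF A e2] by blast
  obtain C where C: "closed C" "C \<subseteq> A" "(A - C) \<in> lmeasurable" "emeasure lebesgue (A - C) < ennreal (e / 2)"
    using sets_lebesgue_inner_closed[OF A e2] by blast
  have "C \<inter> (- U) = {}" using U C by auto
  then obtain g where g: "continuous_on UNIV g" "\<And>x::'a. g x \<in> closed_segment (1::real) 0"
      "\<And>x. x \<in> C \<Longrightarrow> g x = 1" "\<And>x. x \<in> - U \<Longrightarrow> g x = 0"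
    using Urysohn[of C "- U" "1::real" 0] U(1) C(1) by (metis closed_Compl)
  have g01: "0 \<le> g x" "g x \<le> 1" for x
    using g(2)[of x] by (auto simp: closed_segment_eq_real_ivl)
  have sg: "square_integrable (lebesgue_on T) g"
    using g(1) g01 by (intro square_integrable_bounded[OF fm, of _ 1] meas)
      (auto intro: continuous_imp_measurable_on_sets_lebesgue[of UNIV, unfolded lebesgue_on_UNIV_eq])
  define D where "D = (U - A) \<union> (A - C)"
  have D: "D \<in> lmeasurable"
    unfolding D_def by (rule fmeasurable.Un[OF U(3) C(3)])
  have "measure lebesgue (U - A) < e / 2" "measure lebesgue (A - C) < e / 2"
    using U(4) C(4) unfolding emeasure_eq_measure2[OF U(3)] emeasure_eq_measure2[OF C(3)]
      ennreal_less_iff[OF measure_nonneg] by auto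
  then have mD: "measure lebesgue D < e"
    using measure_Un_le[of "U - A" lebesgue "A - C"] U(3) C(3) by (simp add: D_def fmeasurableD)
  have "(LINT x|lebesgue_on T. (indicator A x - g x)\<^sup>2) \<le> (LINT x|lebesgue_on T. indicator D x)"
  proof (rule integral_mono)
    show "integrable (lebesgue_on T) (\<lambda>x. (indicator A x - g x)\<^sup>2)"
      using square_integrable_diff[OF sA sg] by (simp add: square_integrable_def)
    show "integrable (lebesgue_on T) (indicator D :: 'a \<Rightarrow> real)"
      using D by (intro square_integrable_imp_integrable'[OF fm] square_integrable_bounded[OF fm, of _ 1] meas)
        (auto simp: indicator_def fmeasurableD)
    fix x
    show "(indicator A x - g x)\<^sup>2 \<le> (indicator D x :: real)"
    proof -
      have "(g x)\<^sup>2 \<le> 1" "(1 - g x)\<^sup>2 \<le> 1"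
        using g01[of x] by (auto intro: power_le_one)
      then show ?thesis
        using g(3,4)[of x] C(2) U(2) by (auto simp: indicator_def D_def)
    qed
  qed
  also have "\<dots> = measure lebesgue (D \<inter> T)"
  proof -
    have "(LINT x|lebesgue_on T. indicator D x) = measure (lebesgue_on T) (D \<inter> T)"
      using Bochner_Integration.integral_indicator[of "lebesgue_on T" D] by simp
    also have "\<dots> = measure lebesgue (D \<inter> T)"
      using T by (intro measure_restrict_space) (auto simp: fmeasurableD)
    finally show ?thesis .
  qed
  also have "\<dots> \<le> measure lebesgue D"
    using T D by (intro measure_mono_fmeasurable Int_lower1 sets.Int fmeasurableD)
  finally show "\<exists>g. continuous_on UNIV g \<and> square_integrable (lebesgue_on T) g \<and>
      (LINT x|lebesgue_on T. (indicator A x - g x)\<^sup>2) < e"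
    using g(1) sg mD by (intro exI[of _ g]) auto
qed

lemma L2_approximable_simple:
  assumes T: "T \<in> lmeasurable" and s: "simple_function (lebesgue_on T) s"
  shows "L2_approximable T s"
proof -
  have fin: "finite (s ` T)"
    using s by (auto simp: simple_function_def)
  have A: "s -` {y} \<inter> T \<in> sets lebesgue" for y
  proof -
    have "s -` {y} \<inter> T \<in> sets (lebesgue_on T)"
      using simple_functionD(2)[OF s, of "{y}"] by simp
    moreover have "T \<inter> space lebesgue \<in> sets lebesgue"
      using T by (simp add: fmeasurableD)
    ultimately show ?thesis
      by (subst (asm) sets_restrict_space_iff) auto
  qed
  have "L2_approximable T (\<lambda>x. \<Sum>y\<in>Y. y * indicator (s -` {y} \<inter> T) x)" if "finite Y" for Y
    using that
  proof (induction Y)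
    case empty
    show ?case
      using L2_approximable_cmult[OF L2_approximable_indicator[OF T A, of undefined], of 0] by simp
  next
    case (insert y Y)
    then show ?case
      using L2_approximable_add[OF L2_approximable_cmult[OF L2_approximable_indicator[OF T A], of y y]]
      by (simp only: sum.insert not_False_eq_True)
  qed
  from this[OF fin] have "L2_approximable T (\<lambda>x. \<Sum>y\<in>s ` T. y * indicator (s -` {y} \<inter> T) x)" .
  moreover have "(\<Sum>y\<in>s ` T. y * indicator (s -` {y} \<inter> T) x) = s x" if "x \<in> T" for x
  proof -
    have "(\<Sum>y\<in>s ` T. y * indicator (s -` {y} \<inter> T) x) = (\<Sum>y\<in>s ` T. if y = s x then s x else 0)"
      using that by (intro sum.cong) (auto simp: indicator_def)
    then show ?thesis
      using fin that by simp
  qed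
  ultimately show ?thesis
    by (subst (asm) L2_approximable_cong) simp_all
qed

text \<open>A measurable function is the pointwise limit of simple functions dominated by \<open>2 |f|\<close>, so
  dominated convergence reduces the density of the continuous functions to finite sums of
  indicators.\<close>

lemma square_integrable_approximable:
  assumes T: "T \<in> lmeasurable" and f: "square_integrable (lebesgue_on T) f"
  shows "L2_approximable T f"
  unfolding L2_approximable_def
proof (intro conjI allI impI)
  show "square_integrable (lebesgue_on T) f" by fact
  fix e :: real assume "e > 0"
  have fm: "f \<in> borel_measurable (lebesgue_on T)" using f by (simp add: square_integrable_def)
  obtain F where F: "\<And>i. simple_function (lebesgue_on T) (F i)"
      "\<And>x. x \<in> space (lebesgue_on T) \<Longrightarrow> (\<lambda>i. F i x) \<longlonglongrightarrow> f x"
      "\<And>i x. x \<in> space (lebesgue_on T) \<Longrightarrow> dist (F i x) 0 \<le> 2 * dist (f x) 0"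
    using borel_measurable_implies_sequence_metric[OF fm, of 0] by blast
  have sF: "square_integrable (lebesgue_on T) (F i)" for i
    using L2_approximable_simple[OF T F(1)] by (simp add: L2_approximable_def)
  have "(\<lambda>i. LINT x|lebesgue_on T. (f x - F i x)\<^sup>2) \<longlonglongrightarrow> (LINT x|lebesgue_on T. 0)"
  proof (rule integral_dominated_convergence)
    show "integrable (lebesgue_on T) (\<lambda>x. 9 * (f x)\<^sup>2)"
      using f by (simp add: square_integrable_def)
    show "AE x in lebesgue_on T. (\<lambda>i. (f x - F i x)\<^sup>2) \<longlonglongrightarrow> 0"
    proof (rule AE_I2)
      fix x assume "x \<in> space (lebesgue_on T)"
      from tendsto_power[OF tendsto_diff[OF tendsto_const F(2)[OF this]], of "f x" 2]
      show "(\<lambda>i. (f x - F i x)\<^sup>2) \<longlonglongrightarrow> 0" by simp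
    qed
    show "AE x in lebesgue_on T. norm ((f x - F i x)\<^sup>2) \<le> 9 * (f x)\<^sup>2" for i
    proof (rule AE_I2)
      fix x assume "x \<in> space (lebesgue_on T)"
      then have "\<bar>f x - F i x\<bar> \<le> 3 * \<bar>f x\<bar>"
        using F(3)[of x i] by simp
      from power_mono[OF this, of 2] show "norm ((f x - F i x)\<^sup>2) \<le> 9 * (f x)\<^sup>2"
        by (simp add: power_mult_distrib)
    qed
    show "(\<lambda>x. (f x - F i x)\<^sup>2) \<in> borel_measurable (lebesgue_on T)" for i
      using square_integrable_diff[OF f sF] by (auto simp: square_integrable_def)
  qed simp
  then have "(\<lambda>i. LINT x|lebesgue_on T. (f x - F i x)\<^sup>2) \<longlonglongrightarrow> 0"
    by simp
  then have "\<forall>\<^sub>F i in sequentially. (LINT x|lebesgue_on T. (f x - F i x)\<^sup>2) < e / 4"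
    by (rule order_tendstoD) (use \<open>e > 0\<close> in simp)
  then obtain i where i: "(LINT x|lebesgue_on T. (f x - F i x)\<^sup>2) < e / 4"
    by (meson eventually_sequentially order_refl)
  have "e / 4 > 0" using \<open>e > 0\<close> by simp
  then obtain g where g: "continuous_on UNIV g" "square_integrable (lebesgue_on T) g"
      "(LINT x|lebesgue_on T. (F i x - g x)\<^sup>2) < e / 4"
    using L2_approximable_simple[OF T F(1), of i] unfolding L2_approximable_def by blast
  have "(LINT x|lebesgue_on T. ((f x - F i x) + (F i x - g x))\<^sup>2)
      \<le> 2 * (LINT x|lebesgue_on T. (f x - F i x)\<^sup>2) + 2 * (LINT x|lebesgue_on T. (F i x - g x)\<^sup>2)"
    using f sF g by (intro L2_norm_add_le square_integrable_diff)
  also have "\<dots> < e"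
    using i g by simp
  finally show "\<exists>g. continuous_on UNIV g \<and> square_integrable (lebesgue_on T) g \<and>
      (LINT x|lebesgue_on T. (f x - g x)\<^sup>2) < e"
    using g by (intro exI[of _ g]) simp
qed

section \<open>Integration by parts\<close>

lemma compact_continuous_bound:
  fixes f :: "'a::euclidean_space \<Rightarrow> real"
  assumes "compact K" "continuous_on K f"
  obtains B where "B \<ge> 0" "\<And>x. x \<in> K \<Longrightarrow> \<bar>f x\<bar> \<le> B"
proof -
  have "bounded (f ` K)"
    using assms by (intro compact_imp_bounded compact_continuous_image)
  then obtain B where "B > 0" "\<forall>y\<in>f ` K. norm y \<le> B"
    using bounded_pos by metis
  then show ?thesis
    using that[of B] by auto
qed

lemma integral_lebesgue_on_eq_lborel:
  fixes f :: "'a::euclidean_space \<Rightarrow> real"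
  assumes "S \<in> sets lebesgue" "f \<in> borel_measurable borel" "\<And>x. x \<notin> S \<Longrightarrow> f x = 0"
  shows "integral\<^sup>L (lebesgue_on S) f = integral\<^sup>L lborel f"
proof -
  have S: "S \<inter> space lebesgue \<in> sets lebesgue"
    using assms(1) by simp
  have "integral\<^sup>L (lebesgue_on S) f = (LINT x|lebesgue. indicator S x *\<^sub>R f x)"
    by (rule integral_restrict_space[OF S])
  also have "(\<lambda>x. indicator S x *\<^sub>R f x) = f"
    using assms(3) by (auto simp: indicator_def fun_eq_iff)
  also have "integral\<^sup>L lebesgue f = integral\<^sup>L lborel f"
    using assms(2) by (intro integral_completion) simp
  finally show ?thesis .
qed

lemma integrable_compact_support:
  fixes f :: "'a::euclidean_space \<Rightarrow> real"
  assumes "continuous_on UNIV f" "compact K" "\<And>x. x \<notin> K \<Longrightarrow> f x = 0"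
  shows "integrable lborel f"
proof -
  have "integrable lborel (\<lambda>x. indicator K x *\<^sub>R f x)"
    using assms by (intro borel_integrable_compact) (auto intro: continuous_on_subset)
  also have "(\<lambda>x. indicator K x *\<^sub>R f x) = f"
    using assms(3) by (auto simp: indicator_def fun_eq_iff)
  finally show ?thesis .
qed

lemma integral_lborel_translate:
  fixes f :: "'a::euclidean_space \<Rightarrow> real"
  assumes "f \<in> borel_measurable borel"
  shows "(LINT x|lborel. f (t + x)) = integral\<^sup>L lborel f"
  using integral_distr[of "(+) t" lborel borel f] assms by (simp add: lborel_distr_plus)

lemma partial_deriv_eq_0:
  assumes "x \<notin> closure {x. f x \<noteq> 0}"
  shows "partial_deriv f b x = 0"
proof (rule partial_deriv_eq)
  show "(f has_derivative (\<lambda>h. 0)) (at x)"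
  proof (rule has_derivative_transform_within_open)
    show "((\<lambda>x. 0) has_derivative (\<lambda>h. 0)) (at x)" by simp
    show "open (- closure {x. f x \<noteq> 0})" by (simp add: open_Compl)
    show "0 = f y" if "y \<in> - closure {x. f x \<noteq> 0}" for y
      using that closure_subset[of "{x. f x \<noteq> 0}"] by auto
  qed (use assms in simp)
qed

lemma smooth_line_deriv:
  assumes "smooth f"
  shows "((\<lambda>s. f (x + s *\<^sub>R b)) has_real_derivative partial_deriv f b (x + s *\<^sub>R b)) (at s)"
proof -
  have "((\<lambda>s. x + s *\<^sub>R b) has_derivative (\<lambda>h. h *\<^sub>R b)) (at s)"
    by (auto intro!: derivative_eq_intros)
  from has_derivative_compose[OF this smooth_has_derivative[OF assms]]
  have "((\<lambda>s. f (x + s *\<^sub>R b)) has_derivative (\<lambda>h. frechet_derivative f (at (x + s *\<^sub>R b)) (h *\<^sub>R b))) (at s)" .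
  moreover have "frechet_derivative f (at (x + s *\<^sub>R b)) (h *\<^sub>R b) = partial_deriv f b (x + s *\<^sub>R b) * h" for h
    using linear_cmul[OF has_derivative_linear[OF smooth_has_derivative[OF assms]]] by (simp add: mult.commute)
  ultimately show ?thesis
    by (simp add: has_field_derivative_def)
qed

text \<open>The integral of a compactly supported function is invariant under translation, so the integral
  of its difference quotients vanishes; the partial derivative is their dominated limit.\<close>

lemma integral_partial_deriv_0:
  fixes f :: "'a::euclidean_space \<Rightarrow> real"
  assumes f: "smooth f" and K: "compact (closure {x. f x \<noteq> 0})" and b: "b \<in> Basis"
  shows "(LINT x|lborel. partial_deriv f b x) = 0"
proof -
  let ?K = "closure {x. f x \<noteq> 0}"
  obtain R where R: "?K \<subseteq> cball 0 R"
    using compact_imp_bounded[OF K] unfolding bounded_iff by (meson mem_cball_0 subsetI)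
  have fK: "f x = 0" if "x \<notin> ?K" for x
    using that closure_subset[of "{x. f x \<noteq> 0}"] by auto
  have contp: "continuous_on UNIV (partial_deriv f b)" and contf: "continuous_on UNIV f"
    by (rule smooth_continuous_partial[OF f b], rule smooth_continuous[OF f])
  obtain M where M: "M \<ge> 0" "\<And>x. x \<in> ?K \<Longrightarrow> \<bar>partial_deriv f b x\<bar> \<le> M"
    using compact_continuous_bound[OF K continuous_on_subset[OF contp subset_UNIV]] by blast
  have M': "\<bar>partial_deriv f b x\<bar> \<le> M" for x
  proof (cases "x \<in> ?K")
    case False
    then show ?thesis
      using partial_deriv_eq_0[of x f b] M(1) by simp
  qed (rule M(2))
  define q where "q n x = (f (inverse (Suc n) *\<^sub>R b + x) - f x) / inverse (Suc n)" for n :: nat and x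
  have mf: "f \<in> borel_measurable borel" and mp: "partial_deriv f b \<in> borel_measurable borel"
    by (rule borel_measurable_continuous_onI[OF contf], rule borel_measurable_continuous_onI[OF contp])
  have intf: "integrable lborel f"
    using contf K fK by (rule integrable_compact_support)
  have intf': "integrable lborel (\<lambda>x. f (t + x))" for t
  proof -
    have "integrable (distr lborel borel ((+) t)) f"
      using intf by (simp add: lborel_distr_plus)
    then show ?thesis
      by (subst (asm) integrable_distr_eq) (use mf in auto)
  qed
  have q0: "(LINT x|lborel. q n x) = 0" for n
  proof -
    have "(LINT x|lborel. f (inverse (Suc n) *\<^sub>R b + x) - f x) = 0"
      using intf intf' by (simp add: integral_lborel_translate[OF mf])
    then show ?thesis
      unfolding q_def by simp
  qed
  have lim: "(\<lambda>n. q n x) \<longlonglongrightarrow> partial_deriv f b x" for x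
  proof -
    have "((\<lambda>h. (f (x + h *\<^sub>R b) - f x) / h) \<longlongrightarrow> partial_deriv f b x) (at 0)"
      using smooth_line_deriv[OF f, of x b 0] by (simp add: DERIV_def)
    moreover have "filterlim (\<lambda>n. inverse (real (Suc n))) (at 0) sequentially"
      using LIMSEQ_inverse_real_of_nat by (auto simp: filterlim_at)
    ultimately have "(\<lambda>n. (f (x + inverse (real (Suc n)) *\<^sub>R b) - f x) / inverse (real (Suc n)))
        \<longlonglongrightarrow> partial_deriv f b x"
      by (rule filterlim_compose)
    then show ?thesis
      by (simp add: q_def add.commute)
  qed
  have bound: "norm (q n x) \<le> indicator (cball 0 (R + 1)) x *\<^sub>R M" for n x
  proof -
    define t where "t = inverse (real (Suc n))"
    have t: "0 < t" "t \<le> 1" by (auto simp: t_def divide_simps)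
    have qt: "q n x = (f (x + t *\<^sub>R b) - f x) / t"
      by (simp add: q_def t_def add.commute)
    have "\<exists>\<xi>. 0 < \<xi> \<and> \<xi> < t \<and> f (x + t *\<^sub>R b) - f (x + 0 *\<^sub>R b) = (t - 0) * partial_deriv f b (x + \<xi> *\<^sub>R b)"
      using t by (intro MVT2 smooth_line_deriv[OF f])
    then obtain \<xi> where \<xi>: "f (x + t *\<^sub>R b) - f x = t * partial_deriv f b (x + \<xi> *\<^sub>R b)"
      by auto
    then have q: "q n x = partial_deriv f b (x + \<xi> *\<^sub>R b)"
      using t by (simp add: qt)
    show ?thesis
    proof (cases "x \<in> cball 0 (R + 1)")
      case True
      then show ?thesis
        using M' q by simp
    next
      case False
      then have x: "norm x > R + 1" by simp
      then have "x \<notin> ?K" using R by auto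
      then have fx: "f x = 0" by (rule fK)
      have "norm (t *\<^sub>R b) \<le> 1"
        using t b by simp
      then have "norm (t *\<^sub>R b + x) > R"
        using x norm_triangle_ineq4[of "t *\<^sub>R b + x" "t *\<^sub>R b"] by simp
      then have "t *\<^sub>R b + x \<notin> ?K" using R by auto
      then have "f (t *\<^sub>R b + x) = 0" by (rule fK)
      with fx have "q n x = 0"
        by (simp add: qt add.commute)
      then show ?thesis using M(1) by simp
    qed
  qed
  have "(\<lambda>n. LINT x|lborel. q n x) \<longlonglongrightarrow> (LINT x|lborel. partial_deriv f b x)"
  proof (rule integral_dominated_convergence)
    show "integrable lborel (\<lambda>x::'a. indicator (cball 0 (R + 1)) x *\<^sub>R M)"
      by (intro borel_integrable_compact) auto
    show "q n \<in> borel_measurable lborel" for n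
      unfolding q_def using mf
      by (intro borel_measurable_divide borel_measurable_diff measurable_compose[OF _ mf]) auto
  qed (use mp lim bound in auto)
  then show ?thesis
    by (simp add: q0 LIMSEQ_const_iff)
qed

text \<open>The product of the function with a test function has compact support, so the integral of its
  derivative vanishes; the product rule then is the integration by parts.\<close>

lemma smooth_weak_partial:
  fixes f :: "'a::euclidean_space \<Rightarrow> real"
  assumes f: "smooth f" and T: "convex_body T" and b: "b \<in> Basis"
  shows "weak_partial (interior T) b f (partial_deriv f b)"
  unfolding weak_partial_def
proof (intro conjI allI impI)
  show "square_integrable (lebesgue_on (interior T)) f"
    and "square_integrable (lebesgue_on (interior T)) (partial_deriv f b)"
    unfolding convex_body_square_integrable[OF T]
    using T smooth_continuous[OF f] smooth_continuous_partial[OF f b]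
    by (auto intro!: square_integrable_continuous simp: convex_body_def)
  fix \<phi> assume "test_function (interior T) \<phi>"
  then have \<phi>: "smooth \<phi>" "compact (closure {x. \<phi> x \<noteq> 0})" "closure {x. \<phi> x \<noteq> 0} \<subseteq> interior T"
    by (auto simp: test_function_def)
  let ?K = "closure {x. \<phi> x \<noteq> 0}"
  have \<phi>0: "\<phi> x = 0" if "x \<notin> ?K" for x
    using that closure_subset[of "{x. \<phi> x \<noteq> 0}"] by auto
  have c: "continuous_on UNIV (\<lambda>x. f x * partial_deriv \<phi> b x)" "continuous_on UNIV (\<lambda>x. partial_deriv f b x * \<phi> x)"
    by (intro continuous_on_mult smooth_continuous smooth_continuous_partial f \<phi>(1) b)+
  have int: "integrable lborel (\<lambda>x. f x * partial_deriv \<phi> b x)" "integrable lborel (\<lambda>x. partial_deriv f b x * \<phi> x)"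
  proof -
    show "integrable lborel (\<lambda>x. f x * partial_deriv \<phi> b x)"
      by (rule integrable_compact_support[OF c(1) \<phi>(2)]) (simp only: partial_deriv_eq_0 mult_zero_right not_False_eq_True)
    show "integrable lborel (\<lambda>x. partial_deriv f b x * \<phi> x)"
      by (rule integrable_compact_support[OF c(2) \<phi>(2)]) (simp only: \<phi>0 mult_zero_right not_False_eq_True)
  qed
  have "closure {x. f x * \<phi> x \<noteq> 0} \<subseteq> ?K"
    by (intro closure_mono) auto
  then have "?K \<inter> closure {x. f x * \<phi> x \<noteq> 0} = closure {x. f x * \<phi> x \<noteq> 0}"
    by blast
  moreover have "compact (?K \<inter> closure {x. f x * \<phi> x \<noteq> 0})"
    by (intro compact_Int_closed \<phi>(2) closed_closure)
  ultimately have "compact (closure {x. f x * \<phi> x \<noteq> 0})"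
    by (simp only:)
  then have "(LINT x|lborel. partial_deriv (\<lambda>x. f x * \<phi> x) b x) = 0"
    using f \<phi>(1) b by (intro integral_partial_deriv_0 smooth_mult)
  then have "(LINT x|lborel. f x * partial_deriv \<phi> b x) = - (LINT x|lborel. partial_deriv f b x * \<phi> x)"
    using int by (simp add: smooth_partial_mult[OF f \<phi>(1)])
  moreover have "(LINT x|lebesgue_on (interior T). f x * partial_deriv \<phi> b x) = (LINT x|lborel. f x * partial_deriv \<phi> b x)"
  proof (intro integral_lebesgue_on_eq_lborel borel_measurable_continuous_onI c convex_body_lmeasurable(4)[OF T])
    fix x assume "x \<notin> interior T"
    with \<phi>(3) have "x \<notin> ?K" by blast
    then show "f x * partial_deriv \<phi> b x = 0"
      by (simp only: partial_deriv_eq_0 mult_zero_right not_False_eq_True)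
  qed
  moreover have "(LINT x|lebesgue_on (interior T). partial_deriv f b x * \<phi> x) = (LINT x|lborel. partial_deriv f b x * \<phi> x)"
  proof (intro integral_lebesgue_on_eq_lborel borel_measurable_continuous_onI c convex_body_lmeasurable(4)[OF T])
    fix x assume "x \<notin> interior T"
    with \<phi>(3) have "x \<notin> ?K" by blast
    then show "partial_deriv f b x * \<phi> x = 0"
      by (simp only: \<phi>0 mult_zero_right not_False_eq_True)
  qed
  ultimately show "(LINT x|lebesgue_on (interior T). f x * partial_deriv \<phi> b x) =
      - (LINT x|lebesgue_on (interior T). partial_deriv f b x * \<phi> x)"
    by simp
qed

text \<open>The classical gradient, in contrast to the elementwise \<open>grad\<close>, which is only some representative
  of the weak gradient.\<close>

definition cgrad :: "('a::euclidean_space \<Rightarrow> real) \<Rightarrow> 'a \<Rightarrow> 'a" where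
  "cgrad f x = (\<Sum>b\<in>Basis. partial_deriv f b x *\<^sub>R b)"

lemma cgrad_inner [simp]: "b \<in> Basis \<Longrightarrow> cgrad f x \<bullet> b = partial_deriv f b x"
  by (simp add: cgrad_def inner_sum_left inner_Basis if_distrib cong: if_cong)

lemma frechet_derivative_cgrad:
  "smooth f \<Longrightarrow> frechet_derivative f (at x) v = v \<bullet> cgrad f x"
  by (simp add: frechet_derivative_partials cgrad_def inner_sum_right mult.commute)

lemma continuous_cgrad: "smooth f \<Longrightarrow> continuous_on S (cgrad f)"
  unfolding cgrad_def by (auto intro!: continuous_intros smooth_continuous_partial)

lemma smooth_weak_gradient:
  "smooth f \<Longrightarrow> convex_body T \<Longrightarrow> weak_gradient (interior T) f (cgrad f)"
  unfolding weak_gradient_def by (simp add: smooth_weak_partial cong: if_cong)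

section \<open>Mollification\<close>

lemma integrable_mult_bounded:
  fixes w k :: "'a::euclidean_space \<Rightarrow> real"
  assumes "S \<in> lmeasurable" "bounded S" "integrable (lebesgue_on S) w" "continuous_on UNIV k"
  shows "integrable (lebesgue_on S) (\<lambda>y. w y * k y)"
proof -
  have "compact (closure S)" using assms(2) by (simp add: compact_closure)
  then obtain B where B: "B \<ge> 0" "\<And>x. x \<in> closure S \<Longrightarrow> \<bar>k x\<bar> \<le> B"
    using compact_continuous_bound[OF _ continuous_on_subset[OF assms(4) subset_UNIV]] by blast
  show ?thesis
  proof (rule Bochner_Integration.integrable_bound)
    show "integrable (lebesgue_on S) (\<lambda>y. B * w y)"
      using assms(3) by simp
    have "k \<in> borel_measurable (lebesgue_on S)"
      using assms by (intro continuous_imp_measurable_on_sets_lebesgue)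
        (auto intro: continuous_on_subset simp: fmeasurableD)
    then show "(\<lambda>y. w y * k y) \<in> borel_measurable (lebesgue_on S)"
      using borel_measurable_integrable[OF assms(3)] by (intro borel_measurable_times)
    show "AE y in lebesgue_on S. norm (w y * k y) \<le> norm (B * w y)"
    proof (rule AE_I2)
      fix y assume "y \<in> space (lebesgue_on S)"
      then have "\<bar>k y\<bar> \<le> \<bar>B\<bar>" using B(1) B(2)[of y] closure_subset[of S] by auto
      then show "norm (w y * k y) \<le> norm (B * w y)"
        using mult_left_mono[of "\<bar>k y\<bar>" "\<bar>B\<bar>" "\<bar>w y\<bar>"] by (simp add: abs_mult mult.commute)
    qed
  qed
qed

text \<open>The gradient of the kernel is uniformly continuous on bounded sets, hence the kernel is
  differentiable uniformly in the variable of integration.\<close>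

lemma convolution_has_derivative:
  fixes w K :: "'a::euclidean_space \<Rightarrow> real"
  assumes S: "S \<in> lmeasurable" "bounded S" and w: "integrable (lebesgue_on S) w" and K: "smooth K"
  shows "((\<lambda>x. LINT y|lebesgue_on S. w y * K (x - y)) has_derivative
    (\<lambda>h. \<Sum>b\<in>Basis. (h \<bullet> b) * (LINT y|lebesgue_on S. w y * partial_deriv K b (x - y)))) (at x)"
  unfolding has_derivative_at_alt
proof (intro conjI allI impI)
  show "bounded_linear (\<lambda>h. \<Sum>b\<in>Basis. (h \<bullet> b) * (LINT y|lebesgue_on S. w y * partial_deriv K b (x - y)))"
    by (intro bounded_linear_sum bounded_linear_mult_const bounded_linear_inner_left)
  have int: "integrable (lebesgue_on S) (\<lambda>y. w y * k (z - y))" if "continuous_on UNIV k" for k z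
    by (rule integrable_mult_bounded[OF S w]) (auto intro!: continuous_on_compose2[OF that] continuous_intros)
  fix e :: real assume "e > 0"
  \<comment> \<open>the summand 1 keeps the quotient defined when w vanishes\<close>
  define \<eta> where "\<eta> = e / ((LINT y|lebesgue_on S. \<bar>w y\<bar>) + 1)"
  have W: "(LINT y|lebesgue_on S. \<bar>w y\<bar>) \<ge> 0" by simp
  have \<eta>: "\<eta> > 0" "(LINT y|lebesgue_on S. \<bar>w y\<bar>) * \<eta> \<le> e"
  proof -
    show "\<eta> > 0"
      using \<open>e > 0\<close> W unfolding \<eta>_def by (intro divide_pos_pos) linarith+
    have "a * (e / (a + 1)) \<le> e" if "a \<ge> 0" for a :: real
      using that \<open>e > 0\<close> by (simp add: divide_simps)
    from this[OF W] show "(LINT y|lebesgue_on S. \<bar>w y\<bar>) * \<eta> \<le> e"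
      by (simp add: \<eta>_def)
  qed
  obtain R where R: "\<And>y. y \<in> S \<Longrightarrow> norm y \<le> R"
    using S(2) by (auto simp: bounded_iff)
  have "uniformly_continuous_on (cball 0 (norm x + R + 1)) (cgrad K)"
    using K by (intro compact_uniformly_continuous continuous_cgrad) auto
  then obtain d where d: "d > 0"
      "\<And>\<xi> z. \<xi> \<in> cball 0 (norm x + R + 1) \<Longrightarrow> z \<in> cball 0 (norm x + R + 1) \<Longrightarrow> dist \<xi> z < d
        \<Longrightarrow> dist (cgrad K \<xi>) (cgrad K z) < \<eta>"
    using \<eta>(1) unfolding uniformly_continuous_on_def by blast
  show "\<exists>d>0. \<forall>x'. norm (x' - x) < d \<longrightarrow>
      norm ((LINT y|lebesgue_on S. w y * K (x' - y)) - (LINT y|lebesgue_on S. w y * K (x - y))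
        - (\<Sum>b\<in>Basis. ((x' - x) \<bullet> b) * (LINT y|lebesgue_on S. w y * partial_deriv K b (x - y))))
      \<le> e * norm (x' - x)"
  proof (intro exI[of _ "min d 1"] conjI allI impI)
    fix x' assume x': "norm (x' - x) < min d 1"
    have pt: "\<bar>K (x' - y) - K (x - y) - (x' - x) \<bullet> cgrad K (x - y)\<bar> \<le> \<eta> * norm (x' - x)" if y: "y \<in> S" for y
    proof -
      have "norm (K (x' - y) - K (x - y) - frechet_derivative K (at (x - y)) ((x' - y) - (x - y)))
          \<le> norm ((x' - y) - (x - y)) * \<eta>"
      proof (rule differentiable_bound_linearization[where S = "closed_segment (x - y) (x' - y)"])
        show "(x - y) + t *\<^sub>R ((x' - y) - (x - y)) \<in> closed_segment (x - y) (x' - y)" if "t \<in> {0..1}" for t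
          using that by (auto simp: closed_segment_def algebra_simps intro!: exI[of _ t])
        show "(K has_derivative frechet_derivative K (at z)) (at z within closed_segment (x - y) (x' - y))" for z
          using smooth_has_derivative[OF K] by (rule has_derivative_at_withinI)
        fix z assume z: "z \<in> closed_segment (x - y) (x' - y)"
        have "dist z (x - y) \<le> norm (x' - x)"
          using segment_bound(1)[OF z] by (simp add: dist_norm)
        moreover have "norm (x - y) \<le> norm x + R"
          using R[OF y] norm_triangle_ineq4[of x y] by simp
        ultimately have "dist (cgrad K z) (cgrad K (x - y)) < \<eta>"
        proof (intro d(2))
          assume zx: "dist z (x - y) \<le> norm (x' - x)" and xy: "norm (x - y) \<le> norm x + R"
          show "x - y \<in> cball 0 (norm x + R + 1)"
            unfolding mem_cball_0 using xy by simp
          have "norm z \<le> norm (x - y) + norm (z - (x - y))"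
            by (rule norm_triangle_sub)
          then show "z \<in> cball 0 (norm x + R + 1)"
            unfolding mem_cball_0 using xy zx x' by (simp add: dist_norm)
          show "dist z (x - y) < d"
            using zx x' by simp
        qed
        then have "\<bar>h \<bullet> (cgrad K z - cgrad K (x - y))\<bar> \<le> \<eta> * norm h" for h
          using order_trans[OF Cauchy_Schwarz_ineq2[of h "cgrad K z - cgrad K (x - y)"]
            mult_left_mono[of "norm (cgrad K z - cgrad K (x - y))" \<eta> "norm h"]]
          by (simp add: dist_norm mult.commute[of \<eta>])
        then show "onorm (frechet_derivative K (at z) - frechet_derivative K (at (x - y))) \<le> \<eta>"
          by (intro onorm_le) (simp add: frechet_derivative_cgrad[OF K] inner_diff_right)
      qed auto
      then show ?thesis
        by (simp add: frechet_derivative_cgrad[OF K] mult.commute)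
    qed
    have c: "continuous_on UNIV K" "\<And>b. b \<in> Basis \<Longrightarrow> continuous_on UNIV (partial_deriv K b)"
      using K by (auto intro: smooth_continuous smooth_continuous_partial)
    have i1: "integrable (lebesgue_on S) (\<lambda>y. w y * ((x' - x) \<bullet> cgrad K (x - y)))"
      by (intro int[where k = "\<lambda>z. (x' - x) \<bullet> cgrad K z"] continuous_intros continuous_cgrad K)
    have i2: "integrable (lebesgue_on S) (\<lambda>y. w y * K (x' - y) - w y * K (x - y) - w y * ((x' - x) \<bullet> cgrad K (x - y)))"
      by (rule Bochner_Integration.integrable_diff[OF Bochner_Integration.integrable_diff[OF int[OF c(1)] int[OF c(1)]] i1])
    have i3: "integrable (lebesgue_on S) (\<lambda>y. \<bar>w y\<bar> * (\<eta> * norm (x' - x)))"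
      using w by (intro integrable_mult_left integrable_abs)
    have "(\<Sum>b\<in>Basis. ((x' - x) \<bullet> b) * (LINT y|lebesgue_on S. w y * partial_deriv K b (x - y)))
        = (\<Sum>b\<in>Basis. (LINT y|lebesgue_on S. ((x' - x) \<bullet> b) * (w y * partial_deriv K b (x - y))))"
      by simp
    also have "\<dots> = (LINT y|lebesgue_on S. (\<Sum>b\<in>Basis. ((x' - x) \<bullet> b) * (w y * partial_deriv K b (x - y))))"
      by (rule Bochner_Integration.integral_sum[symmetric]) (auto intro!: int c)
    also have "\<dots> = (LINT y|lebesgue_on S. w y * ((x' - x) \<bullet> cgrad K (x - y)))"
      by (simp add: cgrad_def inner_sum_right sum_distrib_left mult.left_commute mult.commute)
    finally have eq: "(LINT y|lebesgue_on S. w y * K (x' - y)) - (LINT y|lebesgue_on S. w y * K (x - y))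
        - (\<Sum>b\<in>Basis. ((x' - x) \<bullet> b) * (LINT y|lebesgue_on S. w y * partial_deriv K b (x - y)))
      = (LINT y|lebesgue_on S. w y * K (x' - y) - w y * K (x - y) - w y * ((x' - x) \<bullet> cgrad K (x - y)))"
      using int[OF c(1)] i1 by simp
    have "norm (LINT y|lebesgue_on S. w y * K (x' - y) - w y * K (x - y) - w y * ((x' - x) \<bullet> cgrad K (x - y))) \<le> (LINT y|lebesgue_on S. norm (w y * K (x' - y) - w y * K (x - y) - w y * ((x' - x) \<bullet> cgrad K (x - y))))"
      by (rule integral_norm_bound)
    also have "\<dots> \<le> (LINT y|lebesgue_on S. \<bar>w y\<bar> * (\<eta> * norm (x' - x)))"
    proof (rule integral_mono[OF integrable_norm[OF i2] i3])
      fix y assume "y \<in> space (lebesgue_on S)"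
      then have "y \<in> S" by simp
      then have "\<bar>w y\<bar> * \<bar>K (x' - y) - K (x - y) - (x' - x) \<bullet> cgrad K (x - y)\<bar> \<le> \<bar>w y\<bar> * (\<eta> * norm (x' - x))"
        by (rule mult_left_mono[OF pt abs_ge_zero])
      then show "norm (w y * K (x' - y) - w y * K (x - y) - w y * ((x' - x) \<bullet> cgrad K (x - y))) \<le> \<bar>w y\<bar> * (\<eta> * norm (x' - x))"
        unfolding real_norm_def abs_mult[symmetric] right_diff_distrib by simp
    qed
    also have "\<dots> = (LINT y|lebesgue_on S. \<bar>w y\<bar>) * \<eta> * norm (x' - x)"
      by simp
    also have "\<dots> \<le> e * norm (x' - x)"
      using \<eta>(2) by (intro mult_right_mono) auto
    finally show "norm ((LINT y|lebesgue_on S. w y * K (x' - y)) - (LINT y|lebesgue_on S. w y * K (x - y))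
        - (\<Sum>b\<in>Basis. ((x' - x) \<bullet> b) * (LINT y|lebesgue_on S. w y * partial_deriv K b (x - y))))
      \<le> e * norm (x' - x)"
      by (simp only: eq)
  qed (use d in simp)
qed

lemma convolution_partial_deriv:
  assumes "S \<in> lmeasurable" "bounded S" "integrable (lebesgue_on S) w" "smooth K" "b \<in> Basis"
  shows "partial_deriv (\<lambda>x. LINT y|lebesgue_on S. w y * K (x - y)) b x
    = (LINT y|lebesgue_on S. w y * partial_deriv K b (x - y))"
  using partial_deriv_eq[OF convolution_has_derivative[OF assms(1-4)], of x b] assms(5)
  by (simp add: inner_Basis if_distrib if_distribR cong: if_cong)

lemma smooth_convolution:
  fixes w K :: "'a::euclidean_space \<Rightarrow> real"
  assumes S: "S \<in> lmeasurable" "bounded S" and w: "integrable (lebesgue_on S) w" and K: "smooth K"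
  shows "smooth (\<lambda>x. LINT y|lebesgue_on S. w y * K (x - y))"
proof -
  have "C_k m (\<lambda>x. LINT y|lebesgue_on S. w y * K (x - y))" for m
    using K
  proof (induction m arbitrary: K)
    case 0
    then show ?case
      using convolution_has_derivative[OF S w]
      by (auto simp: continuous_on_eq_continuous_at intro: has_derivative_continuous)
  next
    case (Suc m)
    show ?case
    proof (rule C_k_SucI)
      show "((\<lambda>x. LINT y|lebesgue_on S. w y * K (x - y)) has_derivative
        (\<lambda>h. \<Sum>b\<in>Basis. (h \<bullet> b) * (LINT y|lebesgue_on S. w y * partial_deriv K b (x - y)))) (at x)" for x
        by (rule convolution_has_derivative[OF S w Suc.prems])
      fix b :: 'a assume b: "b \<in> Basis"
      have "(\<Sum>b'\<in>Basis. (b \<bullet> b') * (LINT y|lebesgue_on S. w y * partial_deriv K b' (x - y)))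
          = (LINT y|lebesgue_on S. w y * partial_deriv K b (x - y))" for x
        using b by (simp add: inner_Basis if_distrib if_distribR cong: if_cong)
      then show "C_k m (\<lambda>x. \<Sum>b'\<in>Basis. (b \<bullet> b') * (LINT y|lebesgue_on S. w y * partial_deriv K b' (x - y)))"
        using Suc.IH[OF smooth_partial[OF Suc.prems b]] by simp
    qed
  qed
  then show ?thesis
    by (simp add: smooth_def)
qed

lemma nn_integral_lborel_affine:
  fixes f :: "'a::euclidean_space \<Rightarrow> ennreal"
  assumes [measurable]: "f \<in> borel_measurable borel" and "l \<noteq> 0"
  shows "integral\<^sup>N lborel f = ennreal (\<bar>l\<bar> ^ DIM('a)) * (\<integral>\<^sup>+x. f (t + l *\<^sub>R x) \<partial>lborel)"
proof -
  have "integral\<^sup>N lborel f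
      = integral\<^sup>N (density (distr lborel borel (\<lambda>x. t + l *\<^sub>R x)) (\<lambda>_. \<bar>l\<bar>^DIM('a))) f"
    using lborel_affine[OF \<open>l \<noteq> 0\<close>, of t] by simp
  also have "\<dots> = ennreal (\<bar>l\<bar> ^ DIM('a)) * (\<integral>\<^sup>+x. f (t + l *\<^sub>R x) \<partial>lborel)"
    by (simp add: nn_integral_density nn_integral_cmult nn_integral_distr)
  finally show ?thesis .
qed

lemma integral_lborel_reflect:
  fixes f :: "'a::euclidean_space \<Rightarrow> real"
  assumes [measurable]: "f \<in> borel_measurable borel"
  shows "(LINT y|lborel. f (x - y)) = integral\<^sup>L lborel f"
proof -
  have "integral\<^sup>L lborel f
      = integral\<^sup>L (density (distr lborel borel (\<lambda>y. x + (-1) *\<^sub>R y)) (\<lambda>_. ennreal (\<bar>-1\<bar>^DIM('a)))) f"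
    using lborel_affine[of "-1::real" x] by simp
  also have "\<dots> = (LINT y|lborel. f (x - y))"
    by (subst integral_density) (simp_all add: integral_distr)
  finally show ?thesis ..
qed

subsection \<open>The mollification kernel\<close>

definition scaled_bump :: "real \<Rightarrow> 'a::euclidean_space \<Rightarrow> real" where
  "scaled_bump \<delta> z = bump ((1 / \<delta>) *\<^sub>R z + 0)"

definition kern :: "real \<Rightarrow> 'a::euclidean_space \<Rightarrow> real" where
  "kern \<delta> z = 1 / (LINT z|lborel. scaled_bump \<delta> (z::'a)) * scaled_bump \<delta> z"

lemma smooth_scaled_bump: "smooth (scaled_bump \<delta>)"
  unfolding scaled_bump_def[abs_def] by (rule smooth_affine[OF smooth_bump])

lemma scaled_bump_neq_0:
  fixes z :: "'a::euclidean_space"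
  assumes "\<delta> > 0"
  shows "scaled_bump \<delta> z \<noteq> 0 \<longleftrightarrow> norm z < \<delta>"
  using assms by (simp add: scaled_bump_def bump_pos_iff pos_divide_less_eq)

lemma integrable_scaled_bump:
  assumes "\<delta> > 0"
  shows "integrable lborel (scaled_bump \<delta> :: 'a::euclidean_space \<Rightarrow> real)"
proof (rule integrable_compact_support[of _ "cball 0 \<delta>"])
  show "continuous_on UNIV (scaled_bump \<delta> :: 'a \<Rightarrow> real)"
    by (rule smooth_continuous[OF smooth_scaled_bump])
  show "scaled_bump \<delta> x = 0" if "x \<notin> cball 0 \<delta>" for x :: 'a
    using that scaled_bump_neq_0[OF assms, of x] by auto
qed simp

lemma integral_scaled_bump_pos:
  assumes "\<delta> > 0"
  shows "(LINT z|lborel. scaled_bump \<delta> (z::'a::euclidean_space)) > 0"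
proof -
  have nn: "scaled_bump \<delta> z \<ge> 0" for z :: 'a
    by (simp add: scaled_bump_def bump_nonneg)
  have "(LINT z|lborel. scaled_bump \<delta> (z::'a)) \<noteq> 0"
  proof
    assume "(LINT z|lborel. scaled_bump \<delta> (z::'a)) = 0"
    then have "AE z in lborel. scaled_bump \<delta> (z::'a) = 0"
      using integral_nonneg_eq_0_iff_AE[OF integrable_scaled_bump[OF assms] AE_I2[OF nn]] by blast
    then have "AE z in lebesgue. scaled_bump \<delta> (z::'a) = 0"
      by (rule AE_completion)
    then have "AE z in lebesgue. z \<notin> ball (0::'a) \<delta>"
      by (rule eventually_mono) (use scaled_bump_neq_0[OF assms] in auto)
    then have "ball (0::'a) \<delta> \<in> null_sets lebesgue"
      by (subst AE_iff_null_sets) auto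
    then show False
      using open_not_negligible[of "ball (0::'a) \<delta>"] assms by (auto simp: negligible_iff_null_sets)
  qed
  moreover have "(LINT z|lborel. scaled_bump \<delta> (z::'a)) \<ge> 0"
    using nn by simp
  ultimately show ?thesis by simp
qed

lemma smooth_kern: "smooth (kern \<delta>)"
  unfolding kern_def[abs_def] by (rule smooth_cmult[OF smooth_scaled_bump])

lemma continuous_kern: "continuous_on S (kern \<delta>)"
  by (rule smooth_continuous[OF smooth_kern])

lemma kern_measurable [measurable]: "kern \<delta> \<in> borel_measurable borel"
  by (rule borel_measurable_continuous_onI[OF continuous_kern])

lemma kern_nonneg: "kern \<delta> z \<ge> 0"
  by (simp add: kern_def scaled_bump_def bump_nonneg)

lemma kern_eq_0:
  assumes "\<delta> > 0" "\<delta> \<le> norm z"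
  shows "kern \<delta> z = 0"
proof -
  have "scaled_bump \<delta> z = 0"
    using assms scaled_bump_neq_0[OF assms(1), of z] by linarith
  then show ?thesis by (simp add: kern_def)
qed

lemma integrable_kern: "\<delta> > 0 \<Longrightarrow> integrable lborel (kern \<delta> :: 'a::euclidean_space \<Rightarrow> real)"
  unfolding kern_def[abs_def] by (intro integrable_mult_right integrable_scaled_bump)

lemma integral_kern:
  assumes "\<delta> > 0"
  shows "(LINT z|lborel. kern \<delta> (z::'a::euclidean_space)) = 1"
  unfolding kern_def[abs_def] using integral_scaled_bump_pos[OF assms, where 'a = 'a] by simp

lemma integral_kern_reflect:
  assumes "\<delta> > 0"
  shows "(LINT y|lborel. kern \<delta> (x - y :: 'a::euclidean_space)) = 1"
  using integral_lborel_reflect[of "kern \<delta>" x] integral_kern[OF assms, where 'a = 'a] by simp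

lemma integrable_kern_reflect:
  assumes "\<delta> > 0"
  shows "integrable lborel (\<lambda>y. kern \<delta> (x - y :: 'a::euclidean_space))"
proof (rule ccontr)
  assume "\<not> integrable lborel (\<lambda>y. kern \<delta> (x - y))"
  then have "(LINT y|lborel. kern \<delta> (x - y)) = 0"
    by (rule not_integrable_integral_eq)
  then show False using integral_kern_reflect[OF assms, of x] by simp
qed

lemma nn_integral_kern:
  assumes "\<delta> > 0"
  shows "(\<integral>\<^sup>+z. ennreal (kern \<delta> (z::'a::euclidean_space)) \<partial>lborel) = 1"
  using nn_integral_eq_integral[OF integrable_kern[OF assms, where 'a = 'a]] integral_kern[OF assms, where 'a = 'a]
  by (simp add: kern_nonneg)

definition moll :: "'a::euclidean_space set \<Rightarrow> real \<Rightarrow> ('a \<Rightarrow> real) \<Rightarrow> 'a \<Rightarrow> real" where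
  "moll S \<delta> w x = (LINT y|lebesgue_on S. w y * kern \<delta> (x - y))"

lemma integrable_moll:
  assumes "S \<in> lmeasurable" "bounded S" "integrable (lebesgue_on S) w"
  shows "integrable (lebesgue_on S) (\<lambda>y. w y * kern \<delta> (x - y))"
  by (rule integrable_mult_bounded[OF assms])
    (rule continuous_on_compose2[OF continuous_kern[of UNIV]], auto intro!: continuous_intros)

lemma smooth_moll:
  assumes "S \<in> lmeasurable" "bounded S" "integrable (lebesgue_on S) w"
  shows "smooth (moll S \<delta> w)"
  unfolding moll_def[abs_def] by (rule smooth_convolution[OF assms smooth_kern])

lemma integral_kern_le_1:
  assumes "\<delta> > 0" "S \<in> sets lebesgue"
  shows "(LINT y|lebesgue_on S. kern \<delta> (x - y)) \<le> 1"
proof -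
  have S: "S \<inter> space lebesgue \<in> sets lebesgue" using assms(2) by simp
  have i: "integrable lebesgue (\<lambda>y. kern \<delta> (x - y))"
    using integrable_kern_reflect[OF assms(1), of x] by (subst integrable_completion) auto
  have "(LINT y|lebesgue_on S. kern \<delta> (x - y)) = (LINT y|lebesgue. indicator S y *\<^sub>R kern \<delta> (x - y))"
    by (rule integral_restrict_space[OF S])
  also have "\<dots> \<le> (LINT y|lebesgue. kern \<delta> (x - y))"
  proof (rule integral_mono[OF _ i])
    show "integrable lebesgue (\<lambda>y. indicator S y *\<^sub>R kern \<delta> (x - y))"
      by (rule integrable_mult_indicator[OF assms(2) i])
    show "indicator S y *\<^sub>R kern \<delta> (x - y) \<le> kern \<delta> (x - y)" for y
      using kern_nonneg[of \<delta> "x - y"] by (auto simp: indicator_def)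
  qed
  also have "\<dots> = (LINT y|lborel. kern \<delta> (x - y))"
    by (rule integral_completion) simp
  also have "\<dots> = 1"
    by (rule integral_kern_reflect[OF assms(1)])
  finally show ?thesis .
qed

text \<open>Jensen's inequality, from the variance with respect to the weight \<open>kern \<delta> (x - y)\<close> being
  nonnegative. The weight has mass at most 1 on \<open>S\<close>; it has less where the ball around \<open>x\<close> leaves \<open>S\<close>.\<close>

lemma moll_square_le:
  fixes w :: "'a::euclidean_space \<Rightarrow> real"
  assumes S: "S \<in> lmeasurable" "bounded S" and w: "square_integrable (lebesgue_on S) w" and "\<delta> > 0"
  shows "(moll S \<delta> w x)\<^sup>2 \<le> (LINT y|lebesgue_on S. (w y)\<^sup>2 * kern \<delta> (x - y))"
proof -
  have fm: "finite_measure (lebesgue_on S)"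
    by (rule finite_measure_lebesgue_on[OF S(1)])
  have i2: "integrable (lebesgue_on S) (\<lambda>y. (w y)\<^sup>2 * kern \<delta> (x - y))"
    using w by (intro integrable_moll S) (simp add: square_integrable_def)
  have i1: "integrable (lebesgue_on S) (\<lambda>y. w y * kern \<delta> (x - y))"
    using square_integrable_imp_integrable'[OF fm w] by (intro integrable_moll S)
  have "integrable (lebesgue_on S) (\<lambda>y. 1 * kern \<delta> (x - y))"
    using fm by (intro integrable_moll S) (simp add: finite_measure.integrable_const)
  then have i0: "integrable (lebesgue_on S) (\<lambda>y. kern \<delta> (x - y))" by simp
  define m where "m = moll S \<delta> w x"
  have "0 \<le> (LINT y|lebesgue_on S. kern \<delta> (x - y) * (w y - m)\<^sup>2)"
    by (intro integral_nonneg_AE AE_I2 mult_nonneg_nonneg kern_nonneg zero_le_power2)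
  also have "(\<lambda>y. kern \<delta> (x - y) * (w y - m)\<^sup>2)
      = (\<lambda>y. (w y)\<^sup>2 * kern \<delta> (x - y) - 2 * m * (w y * kern \<delta> (x - y)) + m\<^sup>2 * kern \<delta> (x - y))"
    by (simp add: fun_eq_iff power2_diff algebra_simps)
  also have "(LINT y|lebesgue_on S. (w y)\<^sup>2 * kern \<delta> (x - y) - 2 * m * (w y * kern \<delta> (x - y)) + m\<^sup>2 * kern \<delta> (x - y))
      = (LINT y|lebesgue_on S. (w y)\<^sup>2 * kern \<delta> (x - y)) - 2 * m * (LINT y|lebesgue_on S. w y * kern \<delta> (x - y))
        + m\<^sup>2 * (LINT y|lebesgue_on S. kern \<delta> (x - y))"
    using i0 i1 i2 by simp
  also have "(LINT y|lebesgue_on S. w y * kern \<delta> (x - y)) = m"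
    by (simp add: m_def moll_def)
  also have "(LINT y|lebesgue_on S. (w y)\<^sup>2 * kern \<delta> (x - y)) - 2 * m * m
        + m\<^sup>2 * (LINT y|lebesgue_on S. kern \<delta> (x - y))
      \<le> (LINT y|lebesgue_on S. (w y)\<^sup>2 * kern \<delta> (x - y)) - 2 * m * m + m\<^sup>2 * 1"
    using integral_kern_le_1[OF \<open>\<delta> > 0\<close>, of S x] S(1)
    by (intro add_left_mono mult_left_mono) (auto simp: fmeasurableD)
  finally show ?thesis
    by (simp add: m_def power2_eq_square)
qed

text \<open>Young's inequality: Tonelli's theorem applied to \<open>moll_square_le\<close>.\<close>

lemma moll_bound:
  fixes w :: "'a::euclidean_space \<Rightarrow> real"
  assumes S: "S \<in> lmeasurable" "bounded S" and w: "square_integrable (lebesgue_on S) w"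
    and \<delta>: "\<delta> > 0" and l: "l > 0" and T: "T \<in> sets lebesgue"
  shows "l ^ DIM('a) * (LINT x|lebesgue_on T. (moll S \<delta> w (t + l *\<^sub>R x))\<^sup>2) \<le> (LINT y|lebesgue_on S. (w y)\<^sup>2)"
proof -
  have S': "S \<inter> space lebesgue \<in> sets lebesgue" and T': "T \<inter> space lebesgue \<in> sets lebesgue"
    using S T by (auto simp: fmeasurableD)
  have iw: "integrable (lebesgue_on S) (\<lambda>y. (w y)\<^sup>2)"
    using w by (simp add: square_integrable_def)
  have "(\<lambda>y. indicator S y *\<^sub>R (w y)\<^sup>2) \<in> borel_measurable lebesgue"
    using borel_measurable_restrict_space_iff[OF S', of "\<lambda>y. (w y)\<^sup>2"] borel_measurable_integrable[OF iw] by blast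
  then obtain v where v [measurable]: "v \<in> borel_measurable lborel"
      and "AE y in lborel. indicator S y *\<^sub>R (w y)\<^sup>2 = v y"
    using completion_ex_borel_measurable_real by blast
  then have v_ae: "AE y in lebesgue. indicator S y *\<^sub>R (w y)\<^sup>2 = v y"
    by (intro AE_completion)
  have nn_v: "(\<integral>\<^sup>+y. ennreal (v y) * ennreal (k y) \<partial>lborel) = (\<integral>\<^sup>+y. ennreal ((w y)\<^sup>2 * k y) \<partial>lebesgue_on S)"
    if "\<And>y. k y \<ge> 0" for k
  proof -
    have "(\<integral>\<^sup>+y. ennreal (v y) * ennreal (k y) \<partial>lborel) = (\<integral>\<^sup>+y. ennreal (v y) * ennreal (k y) \<partial>lebesgue)"
      by (simp only: nn_integral_completion)
    also have "\<dots> = (\<integral>\<^sup>+y. ennreal ((w y)\<^sup>2 * k y) * indicator S y \<partial>lebesgue)"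
    proof (rule nn_integral_cong_AE)
      show "AE y in lebesgue. ennreal (v y) * ennreal (k y) = ennreal ((w y)\<^sup>2 * k y) * indicator S y"
        using v_ae
      proof (rule eventually_mono)
        fix y assume "indicator S y *\<^sub>R (w y)\<^sup>2 = v y"
        then have "v y = indicator S y *\<^sub>R (w y)\<^sup>2" by simp
        then show "ennreal (v y) * ennreal (k y) = ennreal ((w y)\<^sup>2 * k y) * indicator S y"
          by (cases "y \<in> S") (simp_all add: ennreal_mult')
      qed
    qed
    also have "\<dots> = (\<integral>\<^sup>+y. ennreal ((w y)\<^sup>2 * k y) \<partial>lebesgue_on S)"
      by (rule nn_integral_restrict_space[OF S', symmetric])
    finally show ?thesis .
  qed
  define \<Phi> where "\<Phi> x = moll S \<delta> w (t + l *\<^sub>R x)" for x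
  have c\<Phi>: "continuous_on UNIV \<Phi>"
  proof -
    have "continuous_on UNIV (moll S \<delta> w)"
      using square_integrable_imp_integrable'[OF finite_measure_lebesgue_on[OF S(1)] w]
      by (intro smooth_continuous smooth_moll S)
    then show ?thesis
      unfolding \<Phi>_def by (rule continuous_on_compose2) (auto intro!: continuous_intros)
  qed
  have [measurable]: "\<Phi> \<in> borel_measurable borel"
    by (rule borel_measurable_continuous_onI[OF c\<Phi>])
  have pw: "ennreal ((\<Phi> x)\<^sup>2) \<le> (\<integral>\<^sup>+y. ennreal (v y) * ennreal (kern \<delta> (t + l *\<^sub>R x - y)) \<partial>lborel)" for x
  proof -
    have "ennreal ((\<Phi> x)\<^sup>2) \<le> ennreal (LINT y|lebesgue_on S. (w y)\<^sup>2 * kern \<delta> (t + l *\<^sub>R x - y))"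
      unfolding \<Phi>_def by (intro ennreal_leI moll_square_le S w \<delta>)
    also have "\<dots> = (\<integral>\<^sup>+y. ennreal ((w y)\<^sup>2 * kern \<delta> (t + l *\<^sub>R x - y)) \<partial>lebesgue_on S)"
      by (intro nn_integral_eq_integral[symmetric] integrable_moll S iw AE_I2 mult_nonneg_nonneg
          kern_nonneg zero_le_power2)
    also have "\<dots> = (\<integral>\<^sup>+y. ennreal (v y) * ennreal (kern \<delta> (t + l *\<^sub>R x - y)) \<partial>lborel)"
      by (rule nn_v[symmetric]) (rule kern_nonneg)
    finally show ?thesis .
  qed
  have inner: "ennreal (l ^ DIM('a)) * (\<integral>\<^sup>+x. ennreal (kern \<delta> (t + l *\<^sub>R x - y)) \<partial>lborel) = 1" for y
  proof -
    have "(\<integral>\<^sup>+z. ennreal (kern \<delta> (z::'a)) \<partial>lborel) = ennreal (\<bar>l\<bar> ^ DIM('a)) * (\<integral>\<^sup>+x. ennreal (kern \<delta> ((t - y) + l *\<^sub>R x)) \<partial>lborel)"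
      by (rule nn_integral_lborel_affine) (use l in auto)
    then show ?thesis
      using l nn_integral_kern[OF \<delta>, where 'a = 'a] by (simp add: algebra_simps)
  qed
  have "(LINT x|lebesgue_on T. (\<Phi> x)\<^sup>2) = enn2real (\<integral>\<^sup>+x. ennreal ((\<Phi> x)\<^sup>2) \<partial>lebesgue_on T)"
  proof (rule integral_eq_nn_integral)
    show "(\<lambda>x. (\<Phi> x)\<^sup>2) \<in> borel_measurable (lebesgue_on T)"
      by (intro measurable_restrict_space1 measurable_completion) simp
  qed simp
  then have e1: "ennreal (LINT x|lebesgue_on T. (\<Phi> x)\<^sup>2) \<le> (\<integral>\<^sup>+x. ennreal ((\<Phi> x)\<^sup>2) \<partial>lebesgue_on T)"
    by (simp add: ennreal_enn2real_if)
  have "(\<integral>\<^sup>+x. ennreal ((\<Phi> x)\<^sup>2) \<partial>lebesgue_on T) = (\<integral>\<^sup>+x. ennreal ((\<Phi> x)\<^sup>2) * indicator T x \<partial>lebesgue)"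
    by (rule nn_integral_restrict_space[OF T'])
  also have "\<dots> \<le> (\<integral>\<^sup>+x. ennreal ((\<Phi> x)\<^sup>2) \<partial>lebesgue)"
    by (intro nn_integral_mono) (auto simp: indicator_def)
  also have "\<dots> = (\<integral>\<^sup>+x. ennreal ((\<Phi> x)\<^sup>2) \<partial>lborel)"
    by (simp only: nn_integral_completion)
  also have "\<dots> \<le> (\<integral>\<^sup>+x. (\<integral>\<^sup>+y. ennreal (v y) * ennreal (kern \<delta> (t + l *\<^sub>R x - y)) \<partial>lborel) \<partial>lborel)"
    by (intro nn_integral_mono pw)
  also have "\<dots> = (\<integral>\<^sup>+y. (\<integral>\<^sup>+x. ennreal (v y) * ennreal (kern \<delta> (t + l *\<^sub>R x - y)) \<partial>lborel) \<partial>lborel)"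
    by (rule lborel_pair.Fubini') measurable
  also have "\<dots> = (\<integral>\<^sup>+y. ennreal (v y) * (\<integral>\<^sup>+x. ennreal (kern \<delta> (t + l *\<^sub>R x - y)) \<partial>lborel) \<partial>lborel)"
    by (intro nn_integral_cong nn_integral_cmult) measurable
  finally have e2: "ennreal (LINT x|lebesgue_on T. (\<Phi> x)\<^sup>2)
      \<le> (\<integral>\<^sup>+y. ennreal (v y) * (\<integral>\<^sup>+x. ennreal (kern \<delta> (t + l *\<^sub>R x - y)) \<partial>lborel) \<partial>lborel)"
    using e1 by (rule order_trans[rotated])
  have "ennreal (l ^ DIM('a)) * ennreal (LINT x|lebesgue_on T. (\<Phi> x)\<^sup>2)
      \<le> ennreal (l ^ DIM('a)) * (\<integral>\<^sup>+y. ennreal (v y) * (\<integral>\<^sup>+x. ennreal (kern \<delta> (t + l *\<^sub>R x - y)) \<partial>lborel) \<partial>lborel)"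
    using e2 by (intro mult_left_mono) auto
  also have "\<dots> = (\<integral>\<^sup>+y. ennreal (l ^ DIM('a)) * (ennreal (v y) * (\<integral>\<^sup>+x. ennreal (kern \<delta> (t + l *\<^sub>R x - y)) \<partial>lborel)) \<partial>lborel)"
    by (rule nn_integral_cmult[symmetric]) measurable
  also have "\<dots> = (\<integral>\<^sup>+y. ennreal (v y) * ennreal 1 \<partial>lborel)"
    using inner by (intro nn_integral_cong) (simp add: mult.left_commute)
  also have "\<dots> = (\<integral>\<^sup>+y. ennreal ((w y)\<^sup>2 * 1) \<partial>lebesgue_on S)"
    by (rule nn_v) simp
  also have "\<dots> = ennreal (LINT y|lebesgue_on S. (w y)\<^sup>2)"
    using nn_integral_eq_integral[OF iw] by simp
  finally have "ennreal (l ^ DIM('a) * (LINT x|lebesgue_on T. (\<Phi> x)\<^sup>2)) \<le> ennreal (LINT y|lebesgue_on S. (w y)\<^sup>2)"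
    using l by (simp add: ennreal_mult'')
  then show ?thesis
    by (subst (asm) ennreal_le_iff) (simp_all add: \<Phi>_def)
qed

subsection \<open>Mollification along a contraction\<close>

text \<open>The argument is first contracted towards an interior point \<open>x0\<close>, which keeps the support of the
  kernel inside the body also for points at the boundary.\<close>

definition ratio :: "nat \<Rightarrow> real" where
  "ratio n = 1 / (n + 2)"

definition contract :: "'a::euclidean_space \<Rightarrow> nat \<Rightarrow> 'a \<Rightarrow> 'a" where
  "contract x0 n x = ratio n *\<^sub>R x0 + (1 - ratio n) *\<^sub>R x"

definition mollify :: "'a::euclidean_space set \<Rightarrow> 'a \<Rightarrow> real \<Rightarrow> nat \<Rightarrow> ('a \<Rightarrow> real) \<Rightarrow> 'a \<Rightarrow> real" where
  "mollify T x0 r n w x = moll (interior T) (ratio n * r / 2) w (contract x0 n x)"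

lemma ratio_bounds: "0 < ratio n" "ratio n \<le> 1 / 2" "ratio n < 1"
  by (auto simp: ratio_def divide_simps)

lemma ratio_tendsto: "ratio \<longlonglongrightarrow> 0"
proof -
  have "(\<lambda>n. 1 / real (n + 2)) \<longlonglongrightarrow> 0"
    using LIMSEQ_ignore_initial_segment[OF lim_1_over_n[where 'a = real], of 2] .
  then show ?thesis
    by (simp add: ratio_def[abs_def] add.commute)
qed

lemma convex_body_bounded: "convex_body T \<Longrightarrow> bounded (interior T)"
  using bounded_subset[OF compact_imp_bounded interior_subset] by (auto simp: convex_body_def)

text \<open>A perturbation of the contracted point \<open>x + \<epsilon> (x0 - x)\<close> by less than \<open>\<epsilon> r\<close> is a contraction of \<open>x\<close>
  towards a point of the ball around \<open>x0\<close> instead of \<open>x0\<close>. This is why the radius of the kernel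
  is proportional to the contraction ratio.\<close>

lemma contract_in_interior:
  assumes T: "convex_body T" and r: "r > 0" "cball x0 r \<subseteq> T" and x: "x \<in> T"
    and y: "norm (contract x0 n x - y) \<le> ratio n * r / 2"
  shows "y \<in> interior T"
proof -
  define c where "c = x0 + (1 / ratio n) *\<^sub>R (y - contract x0 n x)"
  have e: "ratio n > 0" "ratio n \<le> 1" using ratio_bounds[of n] by auto
  have "norm (c - x0) = norm (contract x0 n x - y) / ratio n"
    using e by (simp add: c_def norm_minus_commute)
  also have "\<dots> \<le> (ratio n * r / 2) / ratio n"
    using e y by (intro divide_right_mono) auto
  also have "\<dots> < r"
    using e r by simp
  finally have "c \<in> ball x0 r"
    by (simp add: dist_norm norm_minus_commute)
  moreover have "ball x0 r \<subseteq> interior T"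
    using r(2) ball_subset_cball by (intro interior_maximal) auto
  ultimately have "c \<in> interior T" by blast
  then have "x - ratio n *\<^sub>R (x - c) \<in> interior T"
    using T x e by (intro mem_interior_convex_shrink) (auto simp: convex_body_def)
  also have "x - ratio n *\<^sub>R (x - c) = y"
    using e by (simp add: c_def contract_def algebra_simps)
  finally show ?thesis .
qed

lemma contract_dist:
  assumes T: "x0 \<in> T" "x \<in> T" and D: "\<And>a b. a \<in> T \<Longrightarrow> b \<in> T \<Longrightarrow> norm (a - b) \<le> D"
  shows "norm (contract x0 n x - x) \<le> ratio n * D"
proof -
  have "contract x0 n x - x = ratio n *\<^sub>R (x0 - x)"
    by (simp add: contract_def algebra_simps)
  then show ?thesis
    using D[OF T] ratio_bounds[of n] by simp
qed

lemma smooth_mollify: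
  assumes T: "convex_body T" and w: "square_integrable (lebesgue_on (interior T)) w"
  shows "smooth (mollify T x0 r n w)"
proof -
  have "smooth (moll (interior T) (ratio n * r / 2) w)"
    using square_integrable_imp_integrable'[OF finite_measure_lebesgue_on w] convex_body_lmeasurable[OF T]
    by (intro smooth_moll convex_body_bounded T) auto
  from smooth_affine[OF this, of "1 - ratio n" "ratio n *\<^sub>R x0"] show ?thesis
    by (simp add: mollify_def[abs_def] contract_def add.commute)
qed

lemma mollify_diff:
  assumes T: "convex_body T" and w: "square_integrable (lebesgue_on (interior T)) w"
    "square_integrable (lebesgue_on (interior T)) w'"
  shows "mollify T x0 r n (\<lambda>x. w x - w' x) x = mollify T x0 r n w x - mollify T x0 r n w' x"
proof -
  have S: "interior T \<in> lmeasurable" "bounded (interior T)"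
    using T convex_body_lmeasurable convex_body_bounded by auto
  have i: "integrable (lebesgue_on (interior T)) (\<lambda>y. w y * kern \<delta> (z - y))"
      "integrable (lebesgue_on (interior T)) (\<lambda>y. w' y * kern \<delta> (z - y))" for z \<delta>
    using square_integrable_imp_integrable'[OF finite_measure_lebesgue_on[OF S(1)]] w
    by (auto intro!: integrable_moll S)
  show ?thesis
    unfolding mollify_def moll_def left_diff_distrib by (rule Bochner_Integration.integral_diff[OF i])
qed

text \<open>The contraction has ratio at least \<open>1/2\<close> (\<open>ratio_bounds\<close>), which gives a bound of the operator norm that is
  uniform in \<open>n\<close>.\<close>

lemma mollify_bound:
  fixes w :: "'a::euclidean_space \<Rightarrow> real"
  assumes T: "convex_body T" and r: "r > 0" and w: "square_integrable (lebesgue_on T) w"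
  shows "(LINT x|lebesgue_on T. (mollify T x0 r n w x)\<^sup>2) \<le> 2 ^ DIM('a) * (LINT x|lebesgue_on T. (w x)\<^sup>2)"
proof -
  let ?I = "LINT x|lebesgue_on T. (mollify T x0 r n w x)\<^sup>2"
  have w': "square_integrable (lebesgue_on (interior T)) w"
    using w convex_body_square_integrable[OF T] by blast
  have "(1 - ratio n) ^ DIM('a) * ?I \<le> (LINT x|lebesgue_on (interior T). (w x)\<^sup>2)"
    unfolding mollify_def contract_def
    using ratio_bounds[of n] r convex_body_lmeasurable[OF T]
    by (intro moll_bound w' convex_body_bounded T) auto
  also have "\<dots> = (LINT x|lebesgue_on T. (w x)\<^sup>2)"
    by (rule convex_body_integral[OF T])
  finally have 1: "(1 - ratio n) ^ DIM('a) * ?I \<le> (LINT x|lebesgue_on T. (w x)\<^sup>2)" .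
  have "1 \<le> (2 * (1 - ratio n)) ^ DIM('a)"
    using ratio_bounds(2)[of n] by (intro one_le_power) simp
  then have "?I \<le> (2 * (1 - ratio n)) ^ DIM('a) * ?I"
    using mult_right_mono[of 1 "(2 * (1 - ratio n)) ^ DIM('a)" ?I] by simp
  also have "\<dots> = 2 ^ DIM('a) * ((1 - ratio n) ^ DIM('a) * ?I)"
    by (simp only: power_mult_distrib mult.assoc)
  also have "\<dots> \<le> 2 ^ DIM('a) * (LINT x|lebesgue_on T. (w x)\<^sup>2)"
    using 1 by (intro mult_left_mono) auto
  finally show ?thesis .
qed

lemma integral_kern_interior:
  assumes T: "convex_body T" and r: "r > 0" "cball x0 r \<subseteq> T" and x: "x \<in> T"
  shows "(LINT y|lebesgue_on (interior T). kern (ratio n * r / 2) (contract x0 n x - y)) = 1"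
proof -
  have \<delta>: "ratio n * r / 2 > 0" using ratio_bounds[of n] r by simp
  have "(LINT y|lebesgue_on (interior T). kern (ratio n * r / 2) (contract x0 n x - y))
      = (LINT y|lborel. kern (ratio n * r / 2) (contract x0 n x - y))"
  proof (rule integral_lebesgue_on_eq_lborel)
    show "interior T \<in> sets lebesgue" by (rule convex_body_lmeasurable(4)[OF T])
    show "kern (ratio n * r / 2) (contract x0 n x - y) = 0" if "y \<notin> interior T" for y
      using that contract_in_interior[OF T r x, of n y] by (intro kern_eq_0 \<delta>) linarith
  qed measurable
  then show ?thesis
    using integral_kern_reflect[OF \<delta>] by simp
qed

lemma mollify_continuous_close:
  fixes g :: "'a::euclidean_space \<Rightarrow> real"
  assumes T: "convex_body T" and r: "r > 0" "cball x0 r \<subseteq> T" and g: "continuous_on UNIV g" and e: "e > 0"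
  shows "\<forall>\<^sub>F n in sequentially. \<forall>x\<in>T. \<bar>mollify T x0 r n g x - g x\<bar> \<le> e"
proof -
  have cT: "compact T" using T by (simp add: convex_body_def)
  have x0: "x0 \<in> T" using r by (auto simp: subset_iff)
  obtain D where D: "\<And>a b. a \<in> T \<Longrightarrow> b \<in> T \<Longrightarrow> norm (a - b) \<le> D"
    using diameter_bounded_bound[OF compact_imp_bounded[OF cT]] unfolding dist_norm by blast
  have "uniformly_continuous_on T g"
    by (intro compact_uniformly_continuous continuous_on_subset[OF g] cT) simp
  then obtain d where d: "d > 0" "\<And>x y. x \<in> T \<Longrightarrow> y \<in> T \<Longrightarrow> dist y x < d \<Longrightarrow> dist (g y) (g x) < e"
    using e unfolding uniformly_continuous_on_def by blast
  have "(\<lambda>n. ratio n * (D + r)) \<longlonglongrightarrow> 0 * (D + r)"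
    by (intro tendsto_mult ratio_tendsto tendsto_const)
  then have "\<forall>\<^sub>F n in sequentially. ratio n * (D + r) < d"
    using d(1) by (intro order_tendstoD(2)) auto
  then show ?thesis
  proof (rule eventually_mono, intro ballI)
    fix n x assume n: "ratio n * (D + r) < d" and x: "x \<in> T"
    let ?S = "interior T" and ?k = "\<lambda>y. kern (ratio n * r / 2) (contract x0 n x - y)"
    have S: "?S \<in> lmeasurable" "bounded ?S"
      using T convex_body_lmeasurable convex_body_bounded by auto
    have \<delta>: "ratio n * r / 2 > 0" using ratio_bounds[of n] r by simp
    have sg: "square_integrable (lebesgue_on ?S) g"
      unfolding convex_body_square_integrable[OF T]
      by (rule square_integrable_continuous[OF cT continuous_on_subset[OF g]]) simp
    have ig: "integrable (lebesgue_on ?S) (\<lambda>y. g y * ?k y)"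
      by (intro integrable_moll S square_integrable_imp_integrable'[OF finite_measure_lebesgue_on[OF S(1)] sg])
    have ic: "integrable (lebesgue_on ?S) (\<lambda>y. c * ?k y)" for c
      using finite_measure_lebesgue_on[OF S(1)] by (intro integrable_moll S finite_measure.integrable_const)
    have "mollify T x0 r n g x - g x = (LINT y|lebesgue_on ?S. g y * ?k y) - g x * (LINT y|lebesgue_on ?S. ?k y)"
      by (simp only: integral_kern_interior[OF T r x] mollify_def moll_def mult_1_right)
    also have "\<dots> = (LINT y|lebesgue_on ?S. g y * ?k y - g x * ?k y)"
      using ig ic by simp
    finally have eq: "mollify T x0 r n g x - g x = (LINT y|lebesgue_on ?S. g y * ?k y - g x * ?k y)" .
    have "\<bar>LINT y|lebesgue_on ?S. g y * ?k y - g x * ?k y\<bar> \<le> (LINT y|lebesgue_on ?S. \<bar>g y * ?k y - g x * ?k y\<bar>)"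
      by (rule integral_abs_bound)
    also have "\<dots> \<le> (LINT y|lebesgue_on ?S. e * ?k y)"
    proof (rule integral_mono[OF integrable_abs[OF Bochner_Integration.integrable_diff[OF ig ic]] ic])
      fix y assume "y \<in> space (lebesgue_on ?S)"
      then have y: "y \<in> T" using interior_subset by auto
      show "\<bar>g y * ?k y - g x * ?k y\<bar> \<le> e * ?k y"
      proof (cases "norm (contract x0 n x - y) < ratio n * r / 2")
        case True
        have "norm (y - x) \<le> norm (contract x0 n x - x) + norm (contract x0 n x - y)"
          using norm_triangle_ineq4[of "contract x0 n x - x" "contract x0 n x - y"] by simp
        also have "\<dots> \<le> ratio n * D + ratio n * r"
          using contract_dist[OF x0 x D, of n] True \<delta> by simp
        also have "\<dots> < d" using n by (simp add: distrib_left)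
        finally have "\<bar>g y - g x\<bar> \<le> e"
          using d(2)[OF x y] by (simp add: dist_norm)
        then have "\<bar>g y - g x\<bar> * ?k y \<le> e * ?k y"
          using kern_nonneg by (rule mult_right_mono)
        then show ?thesis
          by (simp only: left_diff_distrib[symmetric] abs_mult abs_of_nonneg[OF kern_nonneg])
      next
        case False
        then have "?k y = 0" by (intro kern_eq_0 \<delta>) linarith
        then show ?thesis by simp
      qed
    qed
    also have "\<dots> = e"
      using integral_kern_interior[OF T r x, of n] by simp
    finally show "\<bar>mollify T x0 r n g x - g x\<bar> \<le> e"
      by (simp only: eq)
  qed
qed

text \<open>The mollifications are uniformly bounded operators on \<open>L\<^sup>2\<close> and converge uniformly on continuous
  functions, which are dense.\<close>

lemma mollify_tendsto:
  fixes w :: "'a::euclidean_space \<Rightarrow> real"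
  assumes T: "convex_body T" and r: "r > 0" "cball x0 r \<subseteq> T" and w: "square_integrable (lebesgue_on T) w"
  shows "(\<lambda>n. LINT x|lebesgue_on T. (mollify T x0 r n w x - w x)\<^sup>2) \<longlonglongrightarrow> 0"
proof (rule tendstoI)
  fix e :: real assume e: "e > 0"
  have cT: "compact T" and lT: "T \<in> lmeasurable" and fm: "finite_measure (lebesgue_on T)"
    using T convex_body_lmeasurable(1)[OF T] finite_measure_lebesgue_on[OF convex_body_lmeasurable(1)[OF T]]
    by (simp_all add: convex_body_def)
  \<comment> \<open>the factors that two uses of (s + t)^2 <= 2 s^2 + 2 t^2 put in front of the error of g\<close>
  define C where "C = 2 * 2 ^ DIM('a) + (4::real)"
  have C: "C > 0" by (simp add: C_def add_pos_pos)
  then have "e / (2 * C) > 0" using e by simp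
  then obtain g where g: "continuous_on UNIV g" "square_integrable (lebesgue_on T) g"
      "(LINT x|lebesgue_on T. (w x - g x)\<^sup>2) < e / (2 * C)"
    using square_integrable_approximable[OF lT w] unfolding L2_approximable_def by blast
  define m where "m = measure lebesgue T"
  have m: "m \<ge> 0" by (simp add: m_def)
  define \<eta> where "\<eta> = sqrt (e / (16 * (m + 1)))"
  have \<eta>: "\<eta> > 0" "\<eta>\<^sup>2 = e / (16 * (m + 1))"
    using e m by (auto simp: \<eta>_def)
  have "\<forall>\<^sub>F n in sequentially. \<forall>x\<in>T. \<bar>mollify T x0 r n g x - g x\<bar> \<le> \<eta>"
    by (rule mollify_continuous_close[OF T r g(1) \<eta>(1)])
  then show "\<forall>\<^sub>F n in sequentially. dist (LINT x|lebesgue_on T. (mollify T x0 r n w x - w x)\<^sup>2) 0 < e"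
  proof (rule eventually_mono)
    fix n assume n: "\<forall>x\<in>T. \<bar>mollify T x0 r n g x - g x\<bar> \<le> \<eta>"
    let ?M = "mollify T x0 r n"
    have sM: "square_integrable (lebesgue_on T) (?M u)" if "square_integrable (lebesgue_on T) u" for u
    proof -
      have "square_integrable (lebesgue_on (interior T)) u"
        using that convex_body_square_integrable[OF T] by blast
      then show ?thesis
        by (rule square_integrable_continuous[OF cT smooth_continuous[OF smooth_mollify[OF T]]])
    qed
    have wg: "square_integrable (lebesgue_on T) (\<lambda>x. w x - g x)"
      by (rule square_integrable_diff[OF w g(2)])
    have d1: "?M w x - ?M g x = ?M (\<lambda>x. w x - g x) x" for x
      using w g(2) convex_body_square_integrable[OF T] by (intro mollify_diff[symmetric] T) blast+
    have "(LINT x|lebesgue_on T. (?M w x - w x)\<^sup>2)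
        = (LINT x|lebesgue_on T. (?M (\<lambda>x. w x - g x) x + ((?M g x - g x) + (g x - w x)))\<^sup>2)"
      by (simp add: d1[symmetric])
    also have "\<dots> \<le> 2 * (LINT x|lebesgue_on T. (?M (\<lambda>x. w x - g x) x)\<^sup>2)
        + 2 * (LINT x|lebesgue_on T. ((?M g x - g x) + (g x - w x))\<^sup>2)"
      by (intro L2_norm_add_le sM wg square_integrable_add square_integrable_diff w g(2))
    also have "\<dots> \<le> 2 * (LINT x|lebesgue_on T. (?M (\<lambda>x. w x - g x) x)\<^sup>2)
        + 2 * (2 * (LINT x|lebesgue_on T. (?M g x - g x)\<^sup>2) + 2 * (LINT x|lebesgue_on T. (g x - w x)\<^sup>2))"
      by (intro add_left_mono mult_left_mono L2_norm_add_le sM square_integrable_diff w g(2)) simp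
    also have "(LINT x|lebesgue_on T. (g x - w x)\<^sup>2) = (LINT x|lebesgue_on T. (w x - g x)\<^sup>2)"
      by (simp add: power2_commute)
    finally have 1: "(LINT x|lebesgue_on T. (?M w x - w x)\<^sup>2)
        \<le> 2 * (LINT x|lebesgue_on T. (?M (\<lambda>x. w x - g x) x)\<^sup>2)
        + 2 * (2 * (LINT x|lebesgue_on T. (?M g x - g x)\<^sup>2) + 2 * (LINT x|lebesgue_on T. (w x - g x)\<^sup>2))" .
    have 2: "(LINT x|lebesgue_on T. (?M (\<lambda>x. w x - g x) x)\<^sup>2) \<le> 2 ^ DIM('a) * (LINT x|lebesgue_on T. (w x - g x)\<^sup>2)"
      by (rule mollify_bound[OF T r(1) wg])
    have "(LINT x|lebesgue_on T. (?M g x - g x)\<^sup>2) \<le> (LINT x|lebesgue_on T. \<eta>\<^sup>2)"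
    proof (rule integral_mono)
      show "integrable (lebesgue_on T) (\<lambda>x. (?M g x - g x)\<^sup>2)"
        using square_integrable_diff[OF sM[OF g(2)] g(2)] by (simp add: square_integrable_def)
      show "integrable (lebesgue_on T) (\<lambda>x. \<eta>\<^sup>2)"
        by (rule finite_measure.integrable_const[OF fm])
      fix x assume "x \<in> space (lebesgue_on T)"
      then have "\<bar>?M g x - g x\<bar>\<^sup>2 \<le> \<eta>\<^sup>2"
        using n by (intro power_mono) auto
      then show "(?M g x - g x)\<^sup>2 \<le> \<eta>\<^sup>2" by simp
    qed
    also have "\<dots> = m * \<eta>\<^sup>2"
      using lT by (simp add: m_def measure_restrict_space fmeasurableD)
    also have "\<dots> \<le> e / 16"
      unfolding \<eta>(2) using m e by (simp add: divide_simps)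
    finally have 3: "(LINT x|lebesgue_on T. (?M g x - g x)\<^sup>2) \<le> e / 16" .
    have "(LINT x|lebesgue_on T. (?M w x - w x)\<^sup>2) \<le> C * (LINT x|lebesgue_on T. (w x - g x)\<^sup>2) + e / 4"
      using 1 2 3 by (simp add: C_def algebra_simps)
    also have "\<dots> < C * (e / (2 * C)) + e / 2"
      using g(3) C e by (intro add_strict_mono mult_strict_left_mono) auto
    also have "\<dots> = e" using C by simp
    finally show "dist (LINT x|lebesgue_on T. (?M w x - w x)\<^sup>2) 0 < e"
      by (simp add: dist_norm)
  qed
qed

text \<open>For a point of the body the kernel is a test function on the interior. Hence everything that weak
  derivatives say about test functions can be evaluated on mollifications.\<close>

lemma test_function_kern:
  assumes T: "convex_body T" and r: "r > 0" "cball x0 r \<subseteq> T" and x: "x \<in> T"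
  shows "test_function (interior T) (\<lambda>y. kern (ratio n * r / 2) (contract x0 n x - y))"
  unfolding test_function_def
proof (intro conjI)
  let ?\<psi> = "\<lambda>y. kern (ratio n * r / 2) (contract x0 n x - y)"
  have \<delta>: "ratio n * r / 2 > 0" using ratio_bounds[of n] r by simp
  show "smooth ?\<psi>"
    using smooth_affine[OF smooth_kern, of "ratio n * r / 2" "-1" "contract x0 n x"] by simp
  have "{y. ?\<psi> y \<noteq> 0} \<subseteq> cball (contract x0 n x) (ratio n * r / 2)"
  proof safe
    fix y assume "?\<psi> y \<noteq> 0"
    then have "norm (contract x0 n x - y) < ratio n * r / 2"
      using kern_eq_0[OF \<delta>, of "contract x0 n x - y"] by linarith
    then show "y \<in> cball (contract x0 n x) (ratio n * r / 2)"
      by (simp add: dist_norm)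
  qed
  then have sub: "closure {y. ?\<psi> y \<noteq> 0} \<subseteq> cball (contract x0 n x) (ratio n * r / 2)"
    by (rule closure_minimal) simp
  then have "bounded (closure {y. ?\<psi> y \<noteq> 0})"
    by (rule bounded_subset[OF bounded_cball])
  then show "compact (closure {y. ?\<psi> y \<noteq> 0})"
    by (simp only: compact_eq_bounded_closed closed_closure simp_thms)
  have "cball (contract x0 n x) (ratio n * r / 2) \<subseteq> interior T"
    using contract_in_interior[OF T r x, of n] by (auto simp: dist_norm)
  with sub show "closure {y. ?\<psi> y \<noteq> 0} \<subseteq> interior T" by (rule order_trans)
qed

text \<open>Mollification commutes with weak derivatives up to the factor that the chain rule produces from
  the contraction. The sign of the derivative with respect to the variable of integration cancels
  the sign of the integration by parts.\<close>

lemma mollify_partial_deriv: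
  assumes T: "convex_body T" and r: "r > 0" "cball x0 r \<subseteq> T" and x: "x \<in> T" and b: "b \<in> Basis"
    and u: "weak_partial (interior T) b u g"
  shows "partial_deriv (mollify T x0 r n u) b x = (1 - ratio n) * mollify T x0 r n g x"
proof -
  let ?S = "interior T" and ?k = "kern (ratio n * r / 2)"
  have S: "?S \<in> lmeasurable" "bounded ?S"
    using T convex_body_lmeasurable convex_body_bounded by auto
  have iu: "integrable (lebesgue_on ?S) u"
    using u square_integrable_imp_integrable'[OF finite_measure_lebesgue_on[OF S(1)]]
    unfolding weak_partial_def by blast
  have sm: "smooth (moll ?S (ratio n * r / 2) u)"
    by (rule smooth_moll[OF S iu])
  have "mollify T x0 r n u = (\<lambda>x. moll ?S (ratio n * r / 2) u ((1 - ratio n) *\<^sub>R x + ratio n *\<^sub>R x0))"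
    by (simp add: mollify_def[abs_def] contract_def add.commute)
  then have "partial_deriv (mollify T x0 r n u) b x
      = (1 - ratio n) * partial_deriv (moll ?S (ratio n * r / 2) u) b (contract x0 n x)"
    using smooth_partial_affine[OF sm, of "1 - ratio n" "ratio n *\<^sub>R x0" x b]
    by (simp add: contract_def add.commute)
  also have "partial_deriv (moll ?S (ratio n * r / 2) u) b (contract x0 n x)
      = (LINT y|lebesgue_on ?S. u y * partial_deriv ?k b (contract x0 n x - y))"
    unfolding moll_def[abs_def] by (rule convolution_partial_deriv[OF S iu smooth_kern b])
  also have "\<dots> = - (LINT y|lebesgue_on ?S. u y * partial_deriv (\<lambda>y. ?k (contract x0 n x - y)) b y)"
    using smooth_partial_affine[OF smooth_kern, of "ratio n * r / 2" "-1" "contract x0 n x" _ b] by simp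
  also have "(LINT y|lebesgue_on ?S. u y * partial_deriv (\<lambda>y. ?k (contract x0 n x - y)) b y)
      = - (LINT y|lebesgue_on ?S. g y * ?k (contract x0 n x - y))"
    using u test_function_kern[OF T r x, of n] unfolding weak_partial_def by blast
  finally show ?thesis
    unfolding mollify_def[of T x0 r n g x] moll_def by (simp only: minus_minus)
qed

section \<open>Weak derivatives on a convex body\<close>

lemma convex_body_ball:
  assumes "convex_body T"
  obtains x0 r where "r > 0" "cball x0 r \<subseteq> T"
  using assms by (auto simp: convex_body_def mem_interior_cball)

text \<open>The fundamental lemma of the calculus of variations: both functions have the same mollifications.\<close>

lemma AE_eq_on_convex_bodyI:
  assumes T: "convex_body T" and g: "square_integrable (lebesgue_on (interior T)) g"
      "square_integrable (lebesgue_on (interior T)) g'"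
    and eq: "\<And>\<phi>. test_function (interior T) \<phi> \<Longrightarrow>
      (LINT x|lebesgue_on (interior T). g x * \<phi> x) = (LINT x|lebesgue_on (interior T). g' x * \<phi> x)"
  shows "AE x in lebesgue_on T. g x = g' x"
proof -
  obtain x0 r where r: "r > 0" "cball x0 r \<subseteq> T"
    using convex_body_ball[OF T] .
  have sg: "square_integrable (lebesgue_on T) g" "square_integrable (lebesgue_on T) g'"
    using g convex_body_square_integrable[OF T] by blast+
  have "mollify T x0 r n g x = mollify T x0 r n g' x" if "x \<in> T" for n x
    unfolding mollify_def moll_def by (rule eq[OF test_function_kern[OF T r that]])
  then have "(LINT x|lebesgue_on T. (mollify T x0 r n g x - g' x)\<^sup>2)
      = (LINT x|lebesgue_on T. (mollify T x0 r n g' x - g' x)\<^sup>2)" for n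
    by (intro Bochner_Integration.integral_cong) auto
  then have "(\<lambda>n. LINT x|lebesgue_on T. (mollify T x0 r n g x - g' x)\<^sup>2) \<longlonglongrightarrow> 0"
    using mollify_tendsto[OF T r sg(2)] by simp
  moreover have "square_integrable (lebesgue_on T) (mollify T x0 r n g)" for n
    using T by (intro square_integrable_continuous smooth_continuous smooth_mollify g) (auto simp: convex_body_def)
  ultimately show ?thesis
    using mollify_tendsto[OF T r sg(1)] sg by (intro L2_tendsto_unique[of _ "\<lambda>n. mollify T x0 r n g"])
qed

lemma weak_partial_unique:
  assumes "convex_body T" "weak_partial (interior T) b u g" "weak_partial (interior T) b u g'"
  shows "AE x in lebesgue_on T. g x = g' x"
proof (rule AE_eq_on_convex_bodyI[OF assms(1)])
  show "square_integrable (lebesgue_on (interior T)) g" "square_integrable (lebesgue_on (interior T)) g'"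
    using assms by (auto simp: weak_partial_def)
  fix \<phi> assume "test_function (interior T) \<phi>"
  then have "- (LINT x|lebesgue_on (interior T). g x * \<phi> x) = - (LINT x|lebesgue_on (interior T). g' x * \<phi> x)"
    using assms(2,3) unfolding weak_partial_def by metis
  then show "(LINT x|lebesgue_on (interior T). g x * \<phi> x) = (LINT x|lebesgue_on (interior T). g' x * \<phi> x)"
    by simp
qed

text \<open>Meyers--Serrin on a convex body, with approximants that are smooth up to the boundary.\<close>

lemma smooth_dense_in_H1:
  fixes u :: "'a::euclidean_space \<Rightarrow> real"
  assumes T: "convex_body T" and u: "weak_gradient (interior T) u G"
  obtains \<phi> where "\<And>m. smooth (\<phi> m)"
    "(\<lambda>m::nat. LINT x|lebesgue_on T. (\<phi> m x - u x)\<^sup>2) \<longlonglongrightarrow> 0"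
    "\<And>b. b \<in> Basis \<Longrightarrow> (\<lambda>m. LINT x|lebesgue_on T. (partial_deriv (\<phi> m) b x - G x \<bullet> b)\<^sup>2) \<longlonglongrightarrow> 0"
proof -
  obtain x0 r where r: "r > 0" "cball x0 r \<subseteq> T"
    using convex_body_ball[OF T] .
  have wp: "weak_partial (interior T) b u (\<lambda>x. G x \<bullet> b)" if "b \<in> Basis" for b
    using u that by (simp add: weak_gradient_def)
  obtain b0 :: 'a where "b0 \<in> Basis" using nonempty_Basis by blast
  then have su: "square_integrable (lebesgue_on (interior T)) u"
    using wp by (auto simp: weak_partial_def)
  define \<phi> where "\<phi> n = mollify T x0 r n u" for n
  show thesis
  proof (rule that[of \<phi>])
    show "smooth (\<phi> m)" for m
      unfolding \<phi>_def by (rule smooth_mollify[OF T su])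
    show "(\<lambda>m. LINT x|lebesgue_on T. (\<phi> m x - u x)\<^sup>2) \<longlonglongrightarrow> 0"
      unfolding \<phi>_def using su convex_body_square_integrable[OF T] by (intro mollify_tendsto T r) blast
    fix b :: 'a assume b: "b \<in> Basis"
    define g where "g x = G x \<bullet> b" for x
    have g: "weak_partial (interior T) b u g"
      using wp[OF b] by (simp add: g_def[abs_def])
    then have sg': "square_integrable (lebesgue_on (interior T)) g"
      by (simp add: weak_partial_def)
    then have sg: "square_integrable (lebesgue_on T) g"
      using convex_body_square_integrable[OF T] by blast
    have sM: "square_integrable (lebesgue_on T) (mollify T x0 r n g)" for n
      using T by (intro square_integrable_continuous smooth_continuous smooth_mollify sg') (auto simp: convex_body_def)
    let ?I = "LINT x|lebesgue_on T. (g x)\<^sup>2"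
    have bnd: "(LINT x|lebesgue_on T. (partial_deriv (\<phi> n) b x - g x)\<^sup>2)
        \<le> 2 * (LINT x|lebesgue_on T. (mollify T x0 r n g x - g x)\<^sup>2) + 2 * (ratio n)\<^sup>2 * (2 ^ DIM('a) * ?I)" for n
    proof -
      have "(LINT x|lebesgue_on T. (partial_deriv (\<phi> n) b x - g x)\<^sup>2)
          = (LINT x|lebesgue_on T. ((mollify T x0 r n g x - g x) + (- ratio n) * mollify T x0 r n g x)\<^sup>2)"
        by (intro Bochner_Integration.integral_cong)
          (auto simp: \<phi>_def mollify_partial_deriv[OF T r _ b g] algebra_simps)
      also have "\<dots> \<le> 2 * (LINT x|lebesgue_on T. (mollify T x0 r n g x - g x)\<^sup>2)
          + 2 * (LINT x|lebesgue_on T. ((- ratio n) * mollify T x0 r n g x)\<^sup>2)"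
        by (intro L2_norm_add_le square_integrable_diff square_integrable_cmult sM sg)
      also have "(LINT x|lebesgue_on T. ((- ratio n) * mollify T x0 r n g x)\<^sup>2)
          = (ratio n)\<^sup>2 * (LINT x|lebesgue_on T. (mollify T x0 r n g x)\<^sup>2)"
        by (simp add: power_mult_distrib)
      also have "\<dots> \<le> (ratio n)\<^sup>2 * (2 ^ DIM('a) * ?I)"
        by (intro mult_left_mono mollify_bound[OF T r(1) sg]) simp
      finally show ?thesis by simp
    qed
    have lim: "(\<lambda>n. 2 * (LINT x|lebesgue_on T. (mollify T x0 r n g x - g x)\<^sup>2) + 2 * (ratio n)\<^sup>2 * (2 ^ DIM('a) * ?I))
        \<longlonglongrightarrow> 2 * 0 + 2 * 0\<^sup>2 * (2 ^ DIM('a) * ?I)"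
      by (intro tendsto_add tendsto_mult tendsto_power tendsto_const ratio_tendsto mollify_tendsto[OF T r sg])
    have "(\<lambda>n. LINT x|lebesgue_on T. (partial_deriv (\<phi> n) b x - g x)\<^sup>2) \<longlonglongrightarrow> 0"
    proof (rule tendsto_sandwich[OF _ _ tendsto_const])
      show "\<forall>\<^sub>F n in sequentially. 0 \<le> (LINT x|lebesgue_on T. (partial_deriv (\<phi> n) b x - g x)\<^sup>2)"
        by simp
      show "\<forall>\<^sub>F n in sequentially. (LINT x|lebesgue_on T. (partial_deriv (\<phi> n) b x - g x)\<^sup>2)
          \<le> 2 * (LINT x|lebesgue_on T. (mollify T x0 r n g x - g x)\<^sup>2) + 2 * (ratio n)\<^sup>2 * (2 ^ DIM('a) * ?I)"
        by (intro always_eventually allI bnd)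
      show "(\<lambda>n. 2 * (LINT x|lebesgue_on T. (mollify T x0 r n g x - g x)\<^sup>2) + 2 * (ratio n)\<^sup>2 * (2 ^ DIM('a) * ?I))
          \<longlonglongrightarrow> 0"
        using lim by simp
    qed
    then show "(\<lambda>m. LINT x|lebesgue_on T. (partial_deriv (\<phi> m) b x - G x \<bullet> b)\<^sup>2) \<longlonglongrightarrow> 0"
      by (simp add: g_def)
  qed
qed

section \<open>Facets and their surface measure\<close>

definition supports :: "'a::euclidean_space \<Rightarrow> real \<Rightarrow> 'a set \<Rightarrow> 'a set \<Rightarrow> bool" where
  "supports n c T F \<longleftrightarrow> norm n = 1 \<and> T \<subseteq> {x. x \<bullet> n \<le> c} \<and> F = T \<inter> {x. x \<bullet> n = c}"

lemma hyperplane_eq_imp_parallel: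
  fixes n n' :: "'a::euclidean_space"
  assumes n: "norm n = 1" "norm n' = 1" and eq: "{x. n \<bullet> x = c} = {x. n' \<bullet> x = c'}"
  shows "n' = n \<or> n' = - n"
proof -
  have nn: "n \<bullet> n = 1" "n' \<bullet> n' = 1" using n by (simp_all add: dot_square_norm)
  define p v where "p = c *\<^sub>R n" and "v = n' - (n' \<bullet> n) *\<^sub>R n"
  have nv: "n \<bullet> v = 0" using nn by (simp add: v_def inner_diff_right inner_commute)
  have "n \<bullet> p = c" "n \<bullet> (p + v) = c"
    using nn nv by (simp_all add: p_def inner_add_right)
  then have "p \<in> {x. n \<bullet> x = c}" "p + v \<in> {x. n \<bullet> x = c}"
    by (simp_all only: mem_Collect_eq)
  then have "n' \<bullet> p = c'" "n' \<bullet> (p + v) = c'"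
    unfolding eq by (simp_all only: mem_Collect_eq)
  then have "n' \<bullet> v = 0" by (simp add: inner_add_right)
  then have "v \<bullet> v = 0"
    using nv by (simp add: v_def inner_diff_left inner_commute[of v n])
  then have n': "n' = (n' \<bullet> n) *\<^sub>R n" by (simp add: v_def)
  then have "\<bar>n' \<bullet> n\<bar> = 1" using n by (metis mult.right_neutral norm_scaleR)
  then have "n' \<bullet> n = 1 \<or> n' \<bullet> n = -1" by linarith
  then show ?thesis using n' by (metis scaleR_minus1_left scaleR_one)
qed

lemma facet_affine_hull:
  fixes T :: "'a::euclidean_space set"
  assumes "supports n c T F" "F facet_of T" "aff_dim T = DIM('a)"
  shows "affine hull F = {x. n \<bullet> x = c}"
proof (rule affine_dim_equal)
  have "n \<noteq> 0" using assms(1) by (auto simp: supports_def)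
  then show "aff_dim (affine hull F) = aff_dim {x. n \<bullet> x = c}"
    using assms by (simp add: facet_of_def aff_dim_hyperplane)
  show "affine hull F \<noteq> {}" using assms(2) by (auto simp: facet_of_def)
  have "F \<subseteq> {x. n \<bullet> x = c}"
    using assms(1) by (auto simp: supports_def inner_commute)
  then show "affine hull F \<subseteq> {x. n \<bullet> x = c}"
    by (intro hull_minimal affine_hyperplane)
qed (auto intro: affine_hyperplane)

text \<open>The description of \<open>outer_normal\<close> determines a vector: a facet spans its supporting hyperplane, so two
  candidates agree up to the sign, and with the wrong sign the whole polytope would lie in the
  facet.\<close>

lemma outer_normal_supports:
  fixes T :: "'a::euclidean_space set"
  assumes T: "polytope T" "interior T \<noteq> {}" and F: "F facet_of T"
  obtains c where "supports (outer_normal T F) c T F"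
proof -
  have cT: "convex T" using T(1) by (rule polytope_imp_convex)
  have dT: "aff_dim T = DIM('a)"
    using T(2) aff_dim_nonempty_interior by blast
  have "F exposed_face_of T"
    using F exposed_face_of_polyhedron[OF polytope_imp_polyhedron[OF T(1)]] facet_of_imp_face_of by blast
  then obtain a b where ab: "T \<subseteq> {x. a \<bullet> x \<le> b}" "F = T \<inter> {x. a \<bullet> x = b}"
    by (auto simp: exposed_face_of_def)
  have Fne: "F \<noteq> {}" and FT: "F \<noteq> T"
    using F by (auto simp: facet_of_def)
  have a: "a \<noteq> 0"
  proof
    assume "a = 0"
    then have "F = T \<or> F = {}" using ab(2) by auto
    then show False using Fne FT by blast
  qed
  define n c where "n = (1 / norm a) *\<^sub>R a" and "c = b / norm a"
  have na: "norm a > 0" using a by simp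
  have "supports n c T F"
  proof -
    have 1: "x \<bullet> n \<le> c \<longleftrightarrow> a \<bullet> x \<le> b" "x \<bullet> n = c \<longleftrightarrow> a \<bullet> x = b" for x
      using na by (simp_all add: n_def c_def inner_commute divide_right_mono field_simps)
    show ?thesis
      unfolding supports_def 1 using ab a by (auto simp: n_def)
  qed
  moreover have "n' = n" if n': "supports n' c' T F" for n' c'
  proof -
    have "affine hull F = {x. n \<bullet> x = c}" "affine hull F = {x. n' \<bullet> x = c'}"
      using facet_affine_hull[OF _ F dT] \<open>supports n c T F\<close> n' by blast+
    then have "n' = n \<or> n' = - n"
      using \<open>supports n c T F\<close> n' by (intro hyperplane_eq_imp_parallel[of n n' c c']) (auto simp: supports_def)
    moreover have "n' \<noteq> - n"
    proof
      assume neg: "n' = - n"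
      obtain y where y: "y \<in> F" using Fne by blast
      have yc: "y \<bullet> n = c" "y \<bullet> n' = c'"
        using y \<open>supports n c T F\<close> n' by (auto simp: supports_def)
      have "x \<in> F" if "x \<in> T" for x
      proof -
        have "x \<bullet> n \<le> c" "x \<bullet> n' \<le> c'"
          using that \<open>supports n c T F\<close> n' by (auto simp: supports_def)
        then have "x \<bullet> n = c" using yc neg by simp
        then show ?thesis using that \<open>supports n c T F\<close> by (auto simp: supports_def)
      qed
      then show False using FT facet_of_imp_subset[OF F] by blast
    qed
    ultimately show ?thesis by blast
  qed
  ultimately have "\<exists>!n. \<exists>c. supports n c T F" by blast
  then have "\<exists>!n. norm n = 1 \<and> (\<exists>c. T \<subseteq> {x. x \<bullet> n \<le> c} \<and> F = T \<inter> {x. x \<bullet> n = c})"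
    by (simp add: supports_def)
  from theI'[OF this] show thesis
    using that by (auto simp: outer_normal_def supports_def)
qed

definition plane_proj :: "'a::euclidean_space \<Rightarrow> real \<Rightarrow> 'a \<Rightarrow> 'a" where
  "plane_proj n c z = z - (z \<bullet> n - c) *\<^sub>R n"

lemma plane_proj_measurable [measurable]: "plane_proj n c \<in> borel_measurable borel"
  unfolding plane_proj_def[abs_def] by measurable

lemma facet_compact: "convex_body T \<Longrightarrow> F facet_of T \<Longrightarrow> compact F"
  using facet_of_imp_face_of face_of_imp_compact by (metis convex_body_def)

lemma space_facet_measure [simp]: "space (facet_measure T F) = F"
  by (simp add: facet_measure_def hyperplane_measure_def space_restrict_space)

lemma sets_facet_measure: "sets (facet_measure T F) = sets (restrict_space borel F)"
  by (simp add: facet_measure_def hyperplane_measure_def sets_restrict_space)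

lemma facet_measurable: "f \<in> borel_measurable borel \<Longrightarrow> f \<in> borel_measurable (facet_measure T F)"
  unfolding measurable_cong_sets[OF sets_facet_measure refl] by (rule measurable_restrict_space1)

text \<open>An integral over a facet is the volume integral over the right prism of height 1 on it, of the
  function made constant in the normal direction.\<close>

lemma facet_nn_integral:
  fixes T :: "'a::euclidean_space set"
  assumes s: "supports (outer_normal T F) c T F" and F: "F \<noteq> {}" "compact F"
    and f [measurable]: "f \<in> borel_measurable borel"
  shows "integral\<^sup>N (facet_measure T F) f =
    (\<integral>\<^sup>+z. f (plane_proj (outer_normal T F) c z) * indicator F (plane_proj (outer_normal T F) c z)
      * indicator {z. c \<le> z \<bullet> outer_normal T F \<and> z \<bullet> outer_normal T F \<le> c + 1} z \<partial>lborel)"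
proof -
  define n p where "n = outer_normal T F" and "p = (SOME p. p \<in> F)"
  have "p \<in> F" unfolding p_def using F(1) by (simp add: some_in_eq)
  then have p: "p \<bullet> n = c" using s by (auto simp: supports_def n_def)
  have [measurable]: "F \<in> sets borel" using F(2) by (simp add: borel_compact)
  define S where "S = {z. c \<le> z \<bullet> n \<and> z \<bullet> n \<le> c + 1}"
  have S [measurable]: "S \<in> sets borel" unfolding S_def by measurable
  have hm: "hyperplane_measure n p = distr (restrict_space lborel S) borel (plane_proj n c)"
  proof -
    have "{y. 0 \<le> (y - p) \<bullet> n \<and> (y - p) \<bullet> n \<le> 1} = S"
      using p by (auto simp: S_def inner_diff_left)
    moreover have "(\<lambda>y. y - ((y - p) \<bullet> n) *\<^sub>R n) = plane_proj n c"
      using p by (simp add: plane_proj_def[abs_def] inner_diff_left)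
    ultimately show ?thesis by (simp only: hyperplane_measure_def)
  qed
  have "integral\<^sup>N (facet_measure T F) f = integral\<^sup>N (restrict_space (hyperplane_measure n p) F) f"
    by (simp add: facet_measure_def n_def p_def)
  also have "\<dots> = (\<integral>\<^sup>+x. f x * indicator F x \<partial>hyperplane_measure n p)"
    by (rule nn_integral_restrict_space) (simp add: hm)
  also have "\<dots> = (\<integral>\<^sup>+z. f (plane_proj n c z) * indicator F (plane_proj n c z) \<partial>restrict_space lborel S)"
    unfolding hm by (rule nn_integral_distr) (auto intro: measurable_restrict_space1)
  also have "\<dots> = (\<integral>\<^sup>+z. f (plane_proj n c z) * indicator F (plane_proj n c z) * indicator S z \<partial>lborel)"
    by (rule nn_integral_restrict_space) simp
  finally show ?thesis
    by (simp add: S_def n_def)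
qed

lemma finite_facet_measure:
  fixes T :: "'a::euclidean_space set"
  assumes s: "supports (outer_normal T F) c T F" and F: "F \<noteq> {}" "compact F"
  shows "finite_measure (facet_measure T F)"
proof
  obtain B where B: "\<And>x. x \<in> F \<Longrightarrow> norm x \<le> B"
    using compact_imp_bounded[OF F(2)] by (auto simp: bounded_iff)
  define n where "n = outer_normal T F"
  have n: "norm n = 1" using s by (simp add: n_def supports_def)
  have "emeasure (facet_measure T F) (space (facet_measure T F)) = integral\<^sup>N (facet_measure T F) (\<lambda>_. 1)"
    by simp
  also have "\<dots> = (\<integral>\<^sup>+z. 1 * indicator F (plane_proj (outer_normal T F) c z)
      * indicator {z. c \<le> z \<bullet> outer_normal T F \<and> z \<bullet> outer_normal T F \<le> c + 1} z \<partial>lborel)"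
    by (rule facet_nn_integral[OF assms]) simp
  also have "\<dots> \<le> (\<integral>\<^sup>+z. indicator (cball (0::'a) (B + 1)) z \<partial>lborel)"
  proof (rule nn_integral_mono)
    fix z :: 'a
    show "1 * indicator F (plane_proj (outer_normal T F) c z) * indicator {z. c \<le> z \<bullet> outer_normal T F \<and> z \<bullet> outer_normal T F \<le> c + 1} z
      \<le> (indicator (cball 0 (B + 1)) z :: ennreal)"
    proof (cases "plane_proj n c z \<in> F \<and> c \<le> z \<bullet> n \<and> z \<bullet> n \<le> c + 1")
      case True
      have "z = plane_proj n c z + (z \<bullet> n - c) *\<^sub>R n" by (simp add: plane_proj_def)
      then have "norm z \<le> norm (plane_proj n c z) + norm ((z \<bullet> n - c) *\<^sub>R n)"
        using norm_triangle_ineq by metis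
      also have "\<dots> \<le> B + 1" using True B n by (intro add_mono) auto
      finally have "z \<in> cball 0 (B + 1)" by simp
      then show ?thesis by (simp add: indicator_def)
    qed (auto simp: n_def indicator_def)
  qed
  also have "\<dots> = emeasure lborel (cball (0::'a) (B + 1))"
    by (rule nn_integral_indicator) simp
  also have "\<dots> < \<infinity>" using emeasure_bounded_finite[of "cball (0::'a) (B + 1)"] by simp
  finally show "emeasure (facet_measure T F) (space (facet_measure T F)) \<noteq> \<infinity>" by simp
qed

lemma square_integrable_facet_continuous:
  fixes T :: "'a::euclidean_space set"
  assumes "finite_measure (facet_measure T F)" "compact F" "continuous_on UNIV f"
  shows "square_integrable (facet_measure T F) f"
proof -
  obtain B where "B \<ge> 0" "\<And>x. x \<in> F \<Longrightarrow> \<bar>f x\<bar> \<le> B"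
    using compact_continuous_bound[OF assms(2) continuous_on_subset[OF assms(3) subset_UNIV]] by blast
  then show ?thesis
    by (intro square_integrable_bounded[OF assms(1) facet_measurable] borel_measurable_continuous_onI assms(3)) auto
qed

section \<open>The trace inequality\<close>

text \<open>A function that is constant in the direction of \<open>n\<close> has the same integral over all slabs of thickness
  \<open>1 / N\<close>, and \<open>N\<close> of them cover the slab of thickness 1. So surface integrals can be
  computed in a thin slab placed anywhere, in particular just below the facet.\<close>

lemma slab_split:
  fixes G :: "'a::euclidean_space \<Rightarrow> ennreal"
  assumes n: "norm n = 1" and G [measurable]: "G \<in> borel_measurable borel" and N: "N > 0"
  shows "(\<integral>\<^sup>+z. G (plane_proj n c z) * indicator {z. c \<le> z \<bullet> n \<and> z \<bullet> n \<le> c + 1} z \<partial>lborel)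
    \<le> of_nat N * (\<integral>\<^sup>+z. G (plane_proj n c z) * indicator {z. c + s \<le> z \<bullet> n \<and> z \<bullet> n \<le> c + s + 1 / N} z \<partial>lborel)"
proof -
  have nn: "n \<bullet> n = 1" using n by (simp add: dot_square_norm)
  define I where "I a z = G (plane_proj n c z) * indicator {z. c + a \<le> z \<bullet> n \<and> z \<bullet> n \<le> c + a + 1 / N} z" for a z
  have [measurable]: "I a \<in> borel_measurable borel" for a
    unfolding I_def[abs_def] by measurable
  have shift: "integral\<^sup>N lborel (I a) = integral\<^sup>N lborel (I s)" for a
  proof -
    have "integral\<^sup>N lborel (I a) = ennreal (\<bar>1\<bar> ^ DIM('a)) * (\<integral>\<^sup>+z. I a ((a - s) *\<^sub>R n + 1 *\<^sub>R z) \<partial>lborel)"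
      by (rule nn_integral_lborel_affine) auto
    also have "(\<lambda>z. I a ((a - s) *\<^sub>R n + 1 *\<^sub>R z)) = I s"
    proof
      fix z
      define w where "w = (a - s) *\<^sub>R n + z"
      have 1: "w \<bullet> n = a - s + z \<bullet> n"
        using nn by (simp add: w_def inner_add_left)
      then have 2: "plane_proj n c w = plane_proj n c z"
        unfolding plane_proj_def 1 by (simp add: w_def algebra_simps)
      have 3: "w \<in> {z. c + a \<le> z \<bullet> n \<and> z \<bullet> n \<le> c + a + 1 / N} \<longleftrightarrow> z \<in> {z. c + s \<le> z \<bullet> n \<and> z \<bullet> n \<le> c + s + 1 / N}"
        unfolding mem_Collect_eq 1 by auto
      have "I a w = I s z"
        unfolding I_def 2 indicator_def 3 ..
      then show "I a ((a - s) *\<^sub>R n + 1 *\<^sub>R z) = I s z"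
        by (simp add: w_def)
    qed
    finally show ?thesis by simp
  qed
  have "(\<integral>\<^sup>+z. G (plane_proj n c z) * indicator {z. c \<le> z \<bullet> n \<and> z \<bullet> n \<le> c + 1} z \<partial>lborel)
      \<le> (\<integral>\<^sup>+z. (\<Sum>k<N. I (real k / N) z) \<partial>lborel)"
  proof (rule nn_integral_mono)
    fix z
    show "G (plane_proj n c z) * indicator {z. c \<le> z \<bullet> n \<and> z \<bullet> n \<le> c + 1} z \<le> (\<Sum>k<N. I (real k / N) z)"
    proof (cases "c \<le> z \<bullet> n \<and> z \<bullet> n \<le> c + 1")
      case True
      define t where "t = z \<bullet> n - c"
      have t: "0 \<le> t" "t \<le> 1" using True by (auto simp: t_def)
      have "\<exists>k<N. real k / N \<le> t \<and> t \<le> real k / N + 1 / N"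
      proof (cases "t = 1")
        case True
        then show ?thesis using N by (intro exI[of _ "N - 1"]) (auto simp: of_nat_diff divide_simps)
      next
        case False
        define k where "k = nat \<lfloor>t * N\<rfloor>"
        have k: "real k \<le> t * N" "t * N < real k + 1"
          using t N by (auto simp: k_def)
        moreover have "t * N < N" using t False N by simp
        ultimately have "k < N" by linarith
        then show ?thesis using k N by (intro exI[of _ k]) (auto simp: divide_simps)
      qed
      then obtain k where k: "k < N" "real k / N \<le> t" "t \<le> real k / N + 1 / N" by blast
      then have "I (real k / N) z = G (plane_proj n c z)"
        by (simp add: I_def t_def indicator_def)
      moreover have "I (real k / N) z \<le> (\<Sum>k<N. I (real k / N) z)"
        using k(1) by (intro member_le_sum) auto
      ultimately show ?thesis using True by simp
    qed simp
  qed
  also have "\<dots> = (\<Sum>k<N. integral\<^sup>N lborel (I (real k / N)))"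
    by (rule nn_integral_sum) simp
  also have "\<dots> = (\<Sum>k<N. integral\<^sup>N lborel (I s))"
    by (intro sum.cong refl shift)
  also have "\<dots> = of_nat N * integral\<^sup>N lborel (I s)" by simp
  finally show ?thesis unfolding I_def .
qed

context
  fixes T F :: "'a::euclidean_space set" and n m :: 'a and c r H D :: real
  assumes T: "convex_body T" and s: "supports n c T F" and r: "r > 0" "cball m r \<subseteq> T"
    and H: "H = c - m \<bullet> n" and D: "\<And>x. x \<in> T \<Longrightarrow> norm (x - m) \<le> D"
begin

lemma height_pos: "H > 0"
proof -
  have "norm n = 1" using s by (simp add: supports_def)
  then have "m + r *\<^sub>R n \<in> cball m r" using r by (simp add: dist_norm)
  then have "(m + r *\<^sub>R n) \<bullet> n \<le> c" using r s by (auto simp: supports_def)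
  then show ?thesis
    using r \<open>norm n = 1\<close> by (simp add: inner_add_left dot_square_norm H)
qed

text \<open>The point \<open>z\<close> is the convex combination with weights \<open>1 - \<delta>\<close> and \<open>\<delta>\<close> of the point \<open>y\<close> of the facet and
  a point of the ball around \<open>m\<close> on the normal line through \<open>m\<close>.\<close>

lemma slab_in_layer:
  assumes \<delta>: "0 < \<delta>" "\<delta> < 1" and y: "y \<in> F"
    and z: "c - \<delta> * (H + r / 2) \<le> z \<bullet> n" "z \<bullet> n \<le> c - \<delta> * (H - r / 2)"
    and pz: "plane_proj n c z = \<delta> *\<^sub>R (m + H *\<^sub>R n) + (1 - \<delta>) *\<^sub>R y"
  shows "z \<in> T" "z \<bullet> n > c - \<delta> * (H + r)" "norm (z - y) \<le> \<delta> * (D + r)"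
proof -
  have n: "norm n = 1" using s by (simp add: supports_def)
  define \<tau> where "\<tau> = H + (z \<bullet> n - c) / \<delta>"
  have 1: "\<delta> * \<tau> = \<delta> * H + (z \<bullet> n - c)" using \<delta> by (simp add: \<tau>_def distrib_left)
  have "\<delta> * \<bar>\<tau>\<bar> \<le> \<delta> * (r / 2)"
  proof -
    have "\<bar>\<delta> * \<tau>\<bar> \<le> \<delta> * (r / 2)"
      unfolding 1
    proof (rule abs_leI)
      show "\<delta> * H + (z \<bullet> n - c) \<le> \<delta> * (r / 2)" "- (\<delta> * H + (z \<bullet> n - c)) \<le> \<delta> * (r / 2)"
        using z by (simp_all add: algebra_simps)
    qed
    then show ?thesis using \<delta> by (simp add: abs_mult)
  qed
  then have \<tau>: "\<bar>\<tau>\<bar> \<le> r / 2" using \<delta> by simp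
  have "z = plane_proj n c z + (z \<bullet> n - c) *\<^sub>R n" by (simp add: plane_proj_def)
  also have "\<dots> = (1 - \<delta>) *\<^sub>R y + (\<delta> *\<^sub>R m + (\<delta> * H + (z \<bullet> n - c)) *\<^sub>R n)"
    unfolding pz by (simp add: algebra_simps)
  also have "\<dots> = (1 - \<delta>) *\<^sub>R y + \<delta> *\<^sub>R (m + \<tau> *\<^sub>R n)"
    unfolding 1[symmetric] by (simp add: algebra_simps)
  finally have z': "z = (1 - \<delta>) *\<^sub>R y + \<delta> *\<^sub>R (m + \<tau> *\<^sub>R n)" .
  have yT: "y \<in> T" using y s by (auto simp: supports_def)
  have "m + \<tau> *\<^sub>R n \<in> cball m r" using \<tau> r n by (simp add: dist_norm)
  then have mT: "m + \<tau> *\<^sub>R n \<in> T" using r by blast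
  show "z \<in> T"
    unfolding z' using T \<delta> yT mT by (intro convexD) (auto simp: convex_body_def)
  have "\<delta> * (r / 2) > 0" using \<delta> r by simp
  then show "z \<bullet> n > c - \<delta> * (H + r)"
    using z(1) by (simp add: algebra_simps)
  have "z - y = \<delta> *\<^sub>R ((m - y) + \<tau> *\<^sub>R n)"
    unfolding z' by (simp add: algebra_simps)
  then have "norm (z - y) = \<delta> * norm ((m - y) + \<tau> *\<^sub>R n)" using \<delta> by simp
  also have "\<dots> \<le> \<delta> * (D + r)"
  proof (intro mult_left_mono)
    have "norm ((m - y) + \<tau> *\<^sub>R n) \<le> norm (m - y) + norm (\<tau> *\<^sub>R n)"
      by (rule norm_triangle_ineq)
    also have "norm (m - y) \<le> D" using D[OF yT] by (simp add: norm_minus_commute)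
    also have "norm (\<tau> *\<^sub>R n) \<le> r" using \<tau> r n by simp
    finally show "norm ((m - y) + \<tau> *\<^sub>R n) \<le> D + r" by simp
  qed (use \<delta> in simp)
  finally show "norm (z - y) \<le> \<delta> * (D + r)" .
qed

text \<open>The facet, contracted by the factor \<open>1 - \<delta>\<close>, carries a slab of thickness \<open>1 / N\<close> that lies
  in the body but outside the homothetic copy with ratio \<open>1 - \<epsilon>\<close>: the choice of \<open>\<epsilon>\<close> puts the top of
  the copy at distance \<open>\<delta> (H + r)\<close> from the hyperplane. The constant \<open>\<omega>\<close> makes up for the oscillation
  of the function between the facet and the slab.\<close>

lemma facet_le_layer:
  fixes \<psi> :: "'a \<Rightarrow> real"
  assumes N: "N > 0" and \<delta>_def: "\<delta> = 1 / (N * r)" and \<epsilon>_def: "\<epsilon> = \<delta> * (H + r) / H"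
    and \<delta>: "\<delta> < 1" and \<epsilon>: "\<epsilon> < 1" and \<omega>: "\<omega> \<ge> 0"
    and \<psi>: "continuous_on UNIV \<psi>" "\<And>x. \<psi> x \<ge> 0"
    and close: "\<And>x y. x \<in> T \<Longrightarrow> y \<in> T \<Longrightarrow> norm (x - y) \<le> \<delta> * (D + r) \<Longrightarrow> \<bar>\<psi> x - \<psi> y\<bar> \<le> \<omega>"
  shows "ennreal ((1 - \<delta>) ^ DIM('a)) * (\<integral>\<^sup>+z. ennreal (\<psi> (plane_proj n c z)) * indicator F (plane_proj n c z)
        * indicator {z. c \<le> z \<bullet> n \<and> z \<bullet> n \<le> c + 1} z \<partial>lborel)
      \<le> ennreal (real N * (LINT x|lebesgue_on T. (\<psi> x + \<omega>) - (1 - \<epsilon>) ^ DIM('a) * (\<psi> (\<epsilon> *\<^sub>R m + (1 - \<epsilon>) *\<^sub>R x) + \<omega>)))"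
    and "(LINT x|lebesgue_on T. (\<psi> x + \<omega>) - (1 - \<epsilon>) ^ DIM('a) * (\<psi> (\<epsilon> *\<^sub>R m + (1 - \<epsilon>) *\<^sub>R x) + \<omega>)) \<ge> 0"
proof -
  have n: "norm n = 1" and Tc: "\<And>x. x \<in> T \<Longrightarrow> x \<bullet> n \<le> c" and FT: "F = T \<inter> {x. x \<bullet> n = c}"
    using s by (auto simp: supports_def)
  have nn: "n \<bullet> n = 1" using n by (simp add: dot_square_norm)
  have Hp: "H > 0" by (rule height_pos)
  have cT: "compact T" "convex T" using T by (auto simp: convex_body_def)
  have cF: "closed F"
    unfolding FT using compact_imp_closed[OF cT(1)] by (intro closed_Int closed_Collect_eq continuous_intros)
  have \<delta>0: "\<delta> > 0" using N r by (simp add: \<delta>_def)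
  have \<epsilon>0: "\<epsilon> > 0" using \<delta>0 Hp r by (simp add: \<epsilon>_def)
  have [measurable]: "F \<in> sets borel" "T \<in> sets borel"
    using cF compact_imp_closed[OF cT(1)] by (auto intro: borel_closed)
  have [measurable]: "\<psi> \<in> borel_measurable borel"
    by (rule borel_measurable_continuous_onI[OF \<psi>(1)])
  \<comment> \<open>the foot of m on the supporting hyperplane; A undoes the contraction of the facet towards it\<close>
  define q where "q = m + H *\<^sub>R n"
  have qn: "q \<bullet> n = c" using nn by (simp add: q_def inner_add_left H)
  define A where "A w = (1 / (1 - \<delta>)) *\<^sub>R (w - \<delta> *\<^sub>R q)" for w
  define g where "g w = ennreal (\<psi> w) * indicator F w" for w
  have [measurable]: "g \<in> borel_measurable borel" unfolding g_def[abs_def] by measurable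
  have [measurable]: "A \<in> borel_measurable borel" unfolding A_def[abs_def] by measurable
  define \<theta> where "\<theta> x = \<psi> x + \<omega>" for x
  have [measurable]: "\<theta> \<in> borel_measurable borel" unfolding \<theta>_def[abs_def] by measurable
  have \<theta>0: "\<theta> x \<ge> 0" for x using \<psi>(2) \<omega> by (simp add: \<theta>_def)
  have c\<theta>: "continuous_on UNIV \<theta>" unfolding \<theta>_def using \<psi>(1) by (intro continuous_intros)
  define L where "L = T \<inter> {z. z \<bullet> n > c - \<delta> * (H + r)}"
  have [measurable]: "L \<in> sets borel" unfolding L_def by measurable
  have "ennreal ((1 - \<delta>) ^ DIM('a)) * (\<integral>\<^sup>+z. g (plane_proj n c z) * indicator {z. c \<le> z \<bullet> n \<and> z \<bullet> n \<le> c + 1} z \<partial>lborel)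
      \<le> (\<integral>\<^sup>+z. g (A (plane_proj n c z)) * indicator {z. c \<le> z \<bullet> n \<and> z \<bullet> n \<le> c + 1} z \<partial>lborel)" (is "_ * integral\<^sup>N lborel ?f1 \<le> integral\<^sup>N lborel ?f2")
  proof -
    have "integral\<^sup>N lborel ?f2 = ennreal (\<bar>1 - \<delta>\<bar> ^ DIM('a)) * (\<integral>\<^sup>+z. ?f2 (\<delta> *\<^sub>R q + (1 - \<delta>) *\<^sub>R z) \<partial>lborel)"
      by (rule nn_integral_lborel_affine) (use \<delta> in auto)
    moreover have "(\<integral>\<^sup>+z. ?f1 z \<partial>lborel) \<le> (\<integral>\<^sup>+z. ?f2 (\<delta> *\<^sub>R q + (1 - \<delta>) *\<^sub>R z) \<partial>lborel)"
    proof (rule nn_integral_mono)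
      fix z
      have h: "(\<delta> *\<^sub>R q + (1 - \<delta>) *\<^sub>R z) \<bullet> n - c = (1 - \<delta>) * (z \<bullet> n - c)"
        using qn by (simp add: inner_add_left algebra_simps)
      have "plane_proj n c (\<delta> *\<^sub>R q + (1 - \<delta>) *\<^sub>R z) = \<delta> *\<^sub>R q + (1 - \<delta>) *\<^sub>R plane_proj n c z"
        unfolding plane_proj_def h by (simp add: scaleR_right_diff_distrib)
      then have A: "A (plane_proj n c (\<delta> *\<^sub>R q + (1 - \<delta>) *\<^sub>R z)) = plane_proj n c z"
        using \<delta> by (simp add: A_def)
      show "?f1 z \<le> ?f2 (\<delta> *\<^sub>R q + (1 - \<delta>) *\<^sub>R z)"
      proof (cases "c \<le> z \<bullet> n \<and> z \<bullet> n \<le> c + 1")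
        case True
        then have "0 \<le> (1 - \<delta>) * (z \<bullet> n - c)" "(1 - \<delta>) * (z \<bullet> n - c) \<le> 1 * 1"
          using \<delta> \<delta>0 mult_mono[of "1 - \<delta>" 1 "z \<bullet> n - c" 1] by auto
        then have "c \<le> (\<delta> *\<^sub>R q + (1 - \<delta>) *\<^sub>R z) \<bullet> n \<and> (\<delta> *\<^sub>R q + (1 - \<delta>) *\<^sub>R z) \<bullet> n \<le> c + 1"
          using h by linarith
        then show ?thesis using True A by simp
      qed simp
    qed
    ultimately show ?thesis
      using \<delta> by (simp add: mult_left_mono)
  qed
  also have "integral\<^sup>N lborel ?f2 \<le> of_nat N * (\<integral>\<^sup>+z. g (A (plane_proj n c z))
      * indicator {z. c + (- \<delta> * (H + r / 2)) \<le> z \<bullet> n \<and> z \<bullet> n \<le> c + (- \<delta> * (H + r / 2)) + 1 / N} z \<partial>lborel)"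
    by (rule slab_split[OF n _ N]) measurable
  also have "(\<integral>\<^sup>+z. g (A (plane_proj n c z))
      * indicator {z. c + (- \<delta> * (H + r / 2)) \<le> z \<bullet> n \<and> z \<bullet> n \<le> c + (- \<delta> * (H + r / 2)) + 1 / N} z \<partial>lborel)
      \<le> (\<integral>\<^sup>+z. ennreal (\<theta> z) * indicator L z \<partial>lborel)"
  proof (rule nn_integral_mono)
    fix z
    define y where "y = A (plane_proj n c z)"
    have \<delta>r: "1 / N = \<delta> * r" using r N by (simp add: \<delta>_def)
    show "g (A (plane_proj n c z)) * indicator {z. c + (- \<delta> * (H + r / 2)) \<le> z \<bullet> n \<and> z \<bullet> n \<le> c + (- \<delta> * (H + r / 2)) + 1 / N} z
        \<le> ennreal (\<theta> z) * indicator L z"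
    proof (cases "y \<in> F \<and> c + (- \<delta> * (H + r / 2)) \<le> z \<bullet> n \<and> z \<bullet> n \<le> c + (- \<delta> * (H + r / 2)) + 1 / N")
      case True
      have "plane_proj n c z = \<delta> *\<^sub>R (m + H *\<^sub>R n) + (1 - \<delta>) *\<^sub>R y"
        using \<delta> by (simp add: y_def A_def q_def)
      moreover have "c - \<delta> * (H + r / 2) \<le> z \<bullet> n" "z \<bullet> n \<le> c - \<delta> * (H - r / 2)"
        using True unfolding \<delta>r by (auto simp: algebra_simps)
      ultimately have z: "z \<in> T" "z \<bullet> n > c - \<delta> * (H + r)" "norm (z - y) \<le> \<delta> * (D + r)"
        using slab_in_layer[OF \<delta>0 \<delta>] True by blast+
      moreover have "y \<in> T" using True FT by blast
      ultimately have "\<bar>\<psi> z - \<psi> y\<bar> \<le> \<omega>" by (intro close)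
      then have "\<psi> y \<le> \<theta> z" by (simp add: \<theta>_def)
      then have "g y \<le> ennreal (\<theta> z)" using True by (simp add: g_def ennreal_leI)
      then show ?thesis using True z by (simp add: y_def[symmetric] L_def)
    next
      case False
      then have "g y * indicator {z. c + (- \<delta> * (H + r / 2)) \<le> z \<bullet> n \<and> z \<bullet> n \<le> c + (- \<delta> * (H + r / 2)) + 1 / N} z = 0"
        by (auto simp: g_def indicator_def)
      then show ?thesis by (simp only: y_def[symmetric]) simp
    qed
  qed
  finally have 1: "ennreal ((1 - \<delta>) ^ DIM('a)) * integral\<^sup>N lborel ?f1
      \<le> of_nat N * (\<integral>\<^sup>+z. ennreal (\<theta> z) * indicator L z \<partial>lborel)"
    by (simp add: mult_left_mono)
  \<comment> \<open>K undoes the homothety with centre m, so K z \<in> T describes the homothetic copy\<close>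
  define K where "K z = (1 / (1 - \<epsilon>)) *\<^sub>R (z - \<epsilon> *\<^sub>R m)" for z
  have [measurable]: "K \<in> borel_measurable borel" unfolding K_def[abs_def] by measurable
  have disj: "indicator L z + indicator T (K z) \<le> (indicator T z :: ennreal)" for z
  proof (cases "K z \<in> T")
    case True
    have z: "z = \<epsilon> *\<^sub>R m + (1 - \<epsilon>) *\<^sub>R K z" using \<epsilon> by (simp add: K_def)
    have "m \<in> T" using r by (auto simp: subset_iff)
    then have "z \<in> T" using z True cT(2) \<epsilon> \<epsilon>0 convexD[OF cT(2), of m "K z" \<epsilon> "1 - \<epsilon>"] by simp
    moreover have "z \<bullet> n = \<epsilon> * (m \<bullet> n) + (1 - \<epsilon>) * (K z \<bullet> n)"
      by (subst z) (simp add: inner_add_left)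
    then have "z \<bullet> n \<le> \<epsilon> * (m \<bullet> n) + (1 - \<epsilon>) * c"
      using Tc[OF True] \<epsilon> by (simp add: mult_left_mono)
    then have "z \<bullet> n \<le> c - \<epsilon> * H" by (simp add: H algebra_simps)
    then have "z \<bullet> n \<le> c - \<delta> * (H + r)" using Hp by (simp add: \<epsilon>_def)
    then have "z \<notin> L" by (simp add: L_def)
    ultimately show ?thesis using True by simp
  next
    case False
    then show ?thesis by (auto simp: indicator_def L_def)
  qed
  have "(\<integral>\<^sup>+z. ennreal (\<theta> z) * indicator L z \<partial>lborel) + (\<integral>\<^sup>+z. ennreal (\<theta> z) * indicator T (K z) \<partial>lborel)
      = (\<integral>\<^sup>+z. ennreal (\<theta> z) * indicator L z + ennreal (\<theta> z) * indicator T (K z) \<partial>lborel)"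
    by (rule nn_integral_add[symmetric]) measurable
  also have "\<dots> \<le> (\<integral>\<^sup>+z. ennreal (\<theta> z) * indicator T z \<partial>lborel)"
    unfolding distrib_left[symmetric] by (intro nn_integral_mono mult_left_mono disj) simp
  finally have 2: "(\<integral>\<^sup>+z. ennreal (\<theta> z) * indicator L z \<partial>lborel) + (\<integral>\<^sup>+z. ennreal (\<theta> z) * indicator T (K z) \<partial>lborel)
      \<le> (\<integral>\<^sup>+z. ennreal (\<theta> z) * indicator T z \<partial>lborel)" .
  have onT: "(\<integral>\<^sup>+z. ennreal (f z) * indicator T z \<partial>lborel) = ennreal (LINT z|lebesgue_on T. f z)"
    and intT: "integrable (lebesgue_on T) f"
    if f: "continuous_on UNIV f" "\<And>z. f z \<ge> 0" for f
  proof -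
    have T': "T \<inter> space lebesgue \<in> sets lebesgue" using convex_body_lmeasurable(3)[OF T] by simp
    show i: "integrable (lebesgue_on T) f"
      using square_integrable_imp_integrable'[OF convex_body_finite_measure[OF T]
        square_integrable_continuous[OF cT(1) continuous_on_subset[OF f(1) subset_UNIV]]] .
    have "(\<integral>\<^sup>+z. ennreal (f z) * indicator T z \<partial>lborel) = (\<integral>\<^sup>+z. ennreal (f z) * indicator T z \<partial>lebesgue)"
      by (simp only: nn_integral_completion)
    also have "\<dots> = (\<integral>\<^sup>+z. ennreal (f z) \<partial>lebesgue_on T)"
      by (rule nn_integral_restrict_space[OF T', symmetric])
    also have "\<dots> = ennreal (LINT z|lebesgue_on T. f z)"
      using f(2) by (intro nn_integral_eq_integral[OF i] AE_I2)
    finally show "(\<integral>\<^sup>+z. ennreal (f z) * indicator T z \<partial>lborel) = ennreal (LINT z|lebesgue_on T. f z)" .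
  qed
  define \<theta>' where "\<theta>' x = \<theta> (\<epsilon> *\<^sub>R m + (1 - \<epsilon>) *\<^sub>R x)" for x
  have c\<theta>': "continuous_on UNIV \<theta>'"
    unfolding \<theta>'_def by (rule continuous_on_compose2[OF c\<theta>]) (auto intro!: continuous_intros)
  have "(\<integral>\<^sup>+z. ennreal (\<theta> z) * indicator T (K z) \<partial>lborel)
      = ennreal (\<bar>1 - \<epsilon>\<bar> ^ DIM('a)) * (\<integral>\<^sup>+z. ennreal (\<theta> (\<epsilon> *\<^sub>R m + (1 - \<epsilon>) *\<^sub>R z)) * indicator T (K (\<epsilon> *\<^sub>R m + (1 - \<epsilon>) *\<^sub>R z)) \<partial>lborel)"
    by (rule nn_integral_lborel_affine) (use \<epsilon> in auto)
  also have "(\<lambda>z. K (\<epsilon> *\<^sub>R m + (1 - \<epsilon>) *\<^sub>R z)) = (\<lambda>z. z)"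
    using \<epsilon> by (simp add: K_def)
  then have "(\<integral>\<^sup>+z. ennreal (\<theta> (\<epsilon> *\<^sub>R m + (1 - \<epsilon>) *\<^sub>R z)) * indicator T (K (\<epsilon> *\<^sub>R m + (1 - \<epsilon>) *\<^sub>R z)) \<partial>lborel)
      = ennreal (LINT z|lebesgue_on T. \<theta>' z)"
    using onT[OF c\<theta>'] \<theta>0 by (simp add: \<theta>'_def fun_eq_iff)
  finally have 3: "(\<integral>\<^sup>+z. ennreal (\<theta> z) * indicator T (K z) \<partial>lborel) = ennreal ((1 - \<epsilon>) ^ DIM('a) * (LINT z|lebesgue_on T. \<theta>' z))"
    using \<epsilon> by (simp add: ennreal_mult')
  have eq: "(LINT z|lebesgue_on T. \<theta> z) - (1 - \<epsilon>) ^ DIM('a) * (LINT z|lebesgue_on T. \<theta>' z)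
      = (LINT z|lebesgue_on T. \<theta> z - (1 - \<epsilon>) ^ DIM('a) * \<theta>' z)"
  proof -
    have "\<theta>' z \<ge> 0" for z using \<theta>0 by (simp add: \<theta>'_def)
    then show ?thesis
      using intT[OF c\<theta> \<theta>0] intT[OF c\<theta>'] by simp
  qed
  have le: "(\<integral>\<^sup>+z. ennreal (\<theta> z) * indicator L z \<partial>lborel) + ennreal ((1 - \<epsilon>) ^ DIM('a) * (LINT z|lebesgue_on T. \<theta>' z))
        \<le> ennreal (LINT z|lebesgue_on T. \<theta> z)"
    using 2 unfolding 3 onT[OF c\<theta> \<theta>0] .
  have "(\<integral>\<^sup>+z. ennreal (\<theta> z) * indicator L z \<partial>lborel) \<le> ennreal ((LINT z|lebesgue_on T. \<theta> z) - (1 - \<epsilon>) ^ DIM('a) * (LINT z|lebesgue_on T. \<theta>' z))"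
  proof -
    have b: "(1 - \<epsilon>) ^ DIM('a) * (LINT z|lebesgue_on T. \<theta>' z) \<ge> 0"
      using \<epsilon> \<theta>0 by (intro mult_nonneg_nonneg integral_nonneg_AE AE_I2) (auto simp: \<theta>'_def)
    have "(\<integral>\<^sup>+z. ennreal (\<theta> z) * indicator L z \<partial>lborel) \<le> ennreal (LINT z|lebesgue_on T. \<theta> z) - ennreal ((1 - \<epsilon>) ^ DIM('a) * (LINT z|lebesgue_on T. \<theta>' z))"
      using ennreal_minus_mono[OF le order_refl] by (metis ennreal_add_diff_cancel_right ennreal_neq_top)
    also have "\<dots> = ennreal ((LINT z|lebesgue_on T. \<theta> z) - (1 - \<epsilon>) ^ DIM('a) * (LINT z|lebesgue_on T. \<theta>' z))"
      using b by (rule ennreal_minus)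
    finally show ?thesis .
  qed
  also have "(LINT z|lebesgue_on T. \<theta> z) - (1 - \<epsilon>) ^ DIM('a) * (LINT z|lebesgue_on T. \<theta>' z)
      = (LINT z|lebesgue_on T. \<theta> z - (1 - \<epsilon>) ^ DIM('a) * \<theta>' z)"
    by (rule eq)
  finally have 4: "of_nat N * (\<integral>\<^sup>+z. ennreal (\<theta> z) * indicator L z \<partial>lborel)
      \<le> of_nat N * ennreal (LINT z|lebesgue_on T. \<theta> z - (1 - \<epsilon>) ^ DIM('a) * \<theta>' z)"
    by (rule mult_left_mono) simp
  have "ennreal ((1 - \<delta>) ^ DIM('a)) * integral\<^sup>N lborel ?f1
      \<le> ennreal (real N * (LINT z|lebesgue_on T. \<theta> z - (1 - \<epsilon>) ^ DIM('a) * \<theta>' z))"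
    using order_trans[OF 1 4] by (simp add: ennreal_mult' ennreal_of_nat_eq_real_of_nat)
  then show "ennreal ((1 - \<delta>) ^ DIM('a)) * (\<integral>\<^sup>+z. ennreal (\<psi> (plane_proj n c z)) * indicator F (plane_proj n c z)
        * indicator {z. c \<le> z \<bullet> n \<and> z \<bullet> n \<le> c + 1} z \<partial>lborel)
      \<le> ennreal (real N * (LINT x|lebesgue_on T. (\<psi> x + \<omega>) - (1 - \<epsilon>) ^ DIM('a) * (\<psi> (\<epsilon> *\<^sub>R m + (1 - \<epsilon>) *\<^sub>R x) + \<omega>)))"
    by (simp only: g_def \<theta>'_def \<theta>_def mult.assoc)
  have "ennreal ((1 - \<epsilon>) ^ DIM('a) * (LINT z|lebesgue_on T. \<theta>' z)) \<le> ennreal (LINT z|lebesgue_on T. \<theta> z)"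
    using le by (rule order_trans[rotated]) simp
  moreover have "(LINT z|lebesgue_on T. \<theta> z) \<ge> 0"
    using \<theta>0 by (intro integral_nonneg_AE AE_I2)
  ultimately have "(LINT z|lebesgue_on T. \<theta> z) - (1 - \<epsilon>) ^ DIM('a) * (LINT z|lebesgue_on T. \<theta>' z) \<ge> 0"
    by (simp add: ennreal_le_iff)
  then show "(LINT x|lebesgue_on T. (\<psi> x + \<omega>) - (1 - \<epsilon>) ^ DIM('a) * (\<psi> (\<epsilon> *\<^sub>R m + (1 - \<epsilon>) *\<^sub>R x) + \<omega>)) \<ge> 0"
    unfolding eq by (simp only: \<theta>'_def \<theta>_def)
qed

end

text \<open>Dividing \<open>facet_le_layer\<close> by the thickness and letting it tend to zero turns the difference
  of the integrals over the body and its homothetic copy into the derivative of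
  \<open>s \<mapsto> \<integral> (1 - s)\<^sup>d \<theta> (m + (1 - s)(x - m)) dx\<close>, which is what the
  divergence theorem for the vector field \<open>\<theta> (x) (x - m)\<close> would give.\<close>

lemma facet_integral_le:
  fixes \<psi> :: "'a::euclidean_space \<Rightarrow> real"
  assumes T: "convex_body T" and s: "supports (outer_normal T F) c T F" and F: "F \<noteq> {}" "compact F"
    and r: "r > 0" "cball m r \<subseteq> T" and H: "H = c - m \<bullet> outer_normal T F"
    and D: "\<And>x. x \<in> T \<Longrightarrow> norm (x - m) \<le> D"
    and \<psi>: "smooth \<psi>" "\<And>x. \<psi> x \<ge> 0" and \<omega>: "\<omega> > 0"
  shows "(LINT x|facet_measure T F. \<psi> x)
    \<le> (H + r) / (r * H) * (LINT x|lebesgue_on T. real DIM('a) * (\<psi> x + \<omega>) + (x - m) \<bullet> cgrad \<psi> x)"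
proof -
  have Hp: "H > 0" by (rule height_pos[OF T s r H D])
  have cT: "compact T" "convex T" using T by (auto simp: convex_body_def)
  have mT: "m \<in> T" using r by (auto simp: subset_iff)
  have D0: "D \<ge> 0" using D[OF mT] by simp
  define I where "I = (LINT x|facet_measure T F. \<psi> x)"
  define C0 where "C0 = (H + r) / (r * H)"
  have C0: "C0 > 0" using Hp r by (simp add: C0_def)
  have c\<psi>: "continuous_on UNIV \<psi>" by (rule smooth_continuous[OF \<psi>(1)])
  have fmF: "finite_measure (facet_measure T F)" by (rule finite_facet_measure[OF s F])
  have iF: "integrable (facet_measure T F) \<psi>"
    by (rule square_integrable_imp_integrable'[OF fmF square_integrable_facet_continuous[OF fmF F(2) c\<psi>]])
  have I0: "I \<ge> 0" unfolding I_def using \<psi>(2) by (intro integral_nonneg_AE AE_I2)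
  have enI: "ennreal I = (\<integral>\<^sup>+z. ennreal (\<psi> (plane_proj (outer_normal T F) c z)) * indicator F (plane_proj (outer_normal T F) c z)
        * indicator {z. c \<le> z \<bullet> outer_normal T F \<and> z \<bullet> outer_normal T F \<le> c + 1} z \<partial>lborel)"
  proof -
    have "ennreal I = (\<integral>\<^sup>+x. ennreal (\<psi> x) \<partial>facet_measure T F)"
      unfolding I_def using \<psi>(2) by (intro nn_integral_eq_integral[symmetric] iF AE_I2)
    also have "\<dots> = (\<integral>\<^sup>+z. ennreal (\<psi> (plane_proj (outer_normal T F) c z)) * indicator F (plane_proj (outer_normal T F) c z)
        * indicator {z. c \<le> z \<bullet> outer_normal T F \<and> z \<bullet> outer_normal T F \<le> c + 1} z \<partial>lborel)"
      using borel_measurable_continuous_onI[OF c\<psi>] by (intro facet_nn_integral[OF s F]) simp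
    finally show ?thesis .
  qed
  define \<delta> where "\<delta> k = 1 / (real (Suc k) * r)" for k
  define \<epsilon> where "\<epsilon> k = C0 / real (Suc k)" for k
  have \<epsilon>\<delta>: "\<epsilon> k = \<delta> k * (H + r) / H" for k
    using Hp r by (simp add: \<epsilon>_def \<delta>_def C0_def field_simps)
  have inv0: "(\<lambda>k. a / real (Suc k)) \<longlonglongrightarrow> 0" for a
    using tendsto_mult[OF tendsto_const LIMSEQ_inverse_real_of_nat, of a] by (simp add: divide_inverse)
  have \<delta>0: "\<delta> \<longlonglongrightarrow> 0"
    using inv0[of "1 / r"] by (simp add: \<delta>_def[abs_def] mult.commute)
  have \<epsilon>0: "\<epsilon> \<longlonglongrightarrow> 0" unfolding \<epsilon>_def[abs_def] by (rule inv0)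
  have \<delta>p: "\<delta> k > 0" and \<epsilon>p: "\<epsilon> k > 0" for k using r C0 by (simp_all add: \<delta>_def \<epsilon>_def)
  have "uniformly_continuous_on T \<psi>"
    by (rule compact_uniformly_continuous[OF continuous_on_subset[OF c\<psi> subset_UNIV] cT(1)])
  then obtain d where d: "d > 0" "\<And>x y. x \<in> T \<Longrightarrow> y \<in> T \<Longrightarrow> dist y x < d \<Longrightarrow> dist (\<psi> y) (\<psi> x) < \<omega>"
    using \<omega> unfolding uniformly_continuous_on_def by blast
  have "(\<lambda>k. \<delta> k * (D + r)) \<longlonglongrightarrow> 0 * (D + r)"
    by (rule tendsto_mult[OF \<delta>0 tendsto_const])
  then have "\<forall>\<^sub>F k in sequentially. \<delta> k * (D + r) < d"
    by (rule order_tendstoD(2)) (use d in simp)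
  moreover have "\<forall>\<^sub>F k in sequentially. \<delta> k < 1" by (rule order_tendstoD(2)[OF \<delta>0]) simp
  moreover have "\<forall>\<^sub>F k in sequentially. \<epsilon> k < 1" by (rule order_tendstoD(2)[OF \<epsilon>0]) simp
  ultimately have "\<forall>\<^sub>F k in sequentially. \<delta> k * (D + r) < d \<and> \<delta> k < 1 \<and> \<epsilon> k < 1"
    by (intro eventually_conj)
  then obtain k0 where k0: "\<And>k. k \<ge> k0 \<Longrightarrow> \<delta> k * (D + r) < d \<and> \<delta> k < 1 \<and> \<epsilon> k < 1"
    unfolding eventually_sequentially by blast
  define \<theta> where "\<theta> x = \<psi> x + \<omega>" for x
  have s\<theta>: "smooth \<theta>" unfolding \<theta>_def[abs_def] by (intro smooth_add \<psi>(1) smooth_const)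
  \<comment> \<open>the integrand of the homothetic copy with ratio 1 - e, transported back to T, and its derivative\<close>
  define h where "h x e = (1 - e) ^ DIM('a) * \<theta> (x + e *\<^sub>R (m - x))" for x and e :: real
  define h' where "h' x e = (1 - e) ^ DIM('a) * ((m - x) \<bullet> cgrad \<theta> (x + e *\<^sub>R (m - x)))
      - real DIM('a) * (1 - e) ^ (DIM('a) - 1) * \<theta> (x + e *\<^sub>R (m - x))" for x and e :: real
  have h_deriv: "(h x has_real_derivative h' x e) (at e)" for x e
  proof -
    have "((\<lambda>e. x + e *\<^sub>R (m - x)) has_derivative (\<lambda>t. t *\<^sub>R (m - x))) (at e)"
      by (auto intro!: derivative_eq_intros)
    from has_derivative_compose[OF this smooth_has_derivative[OF s\<theta>]]
    have "((\<lambda>e. \<theta> (x + e *\<^sub>R (m - x))) has_real_derivative ((m - x) \<bullet> cgrad \<theta> (x + e *\<^sub>R (m - x)))) (at e)"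
      unfolding has_field_derivative_def frechet_derivative_cgrad[OF s\<theta>] by (simp add: mult.commute[of _ "(m - x) \<bullet> _"])
    moreover have "((\<lambda>e::real. (1 - e) ^ DIM('a)) has_real_derivative (- (real DIM('a) * (1 - e) ^ (DIM('a) - 1)))) (at e)"
      by (auto intro!: derivative_eq_intros)
    ultimately show ?thesis
      unfolding h_def[abs_def] h'_def using DERIV_mult' by (fastforce intro!: derivative_eq_intros)
  qed
  obtain B0 where B0: "B0 \<ge> 0" "\<And>x. x \<in> T \<Longrightarrow> \<bar>\<theta> x\<bar> \<le> B0"
    using compact_continuous_bound[OF cT(1) smooth_continuous[OF s\<theta>]] by blast
  obtain B1 where B1: "B1 \<ge> 0" "\<And>x. x \<in> T \<Longrightarrow> \<bar>norm (cgrad \<theta> x)\<bar> \<le> B1"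
    using compact_continuous_bound[OF cT(1) continuous_on_norm[OF continuous_cgrad[OF s\<theta>]]] by blast
  define B where "B = D * B1 + real DIM('a) * B0"
  have h'_bound: "\<bar>h' x e\<bar> \<le> B" if x: "x \<in> T" and e: "0 \<le> e" "e \<le> 1" for x e
  proof -
    have "x + e *\<^sub>R (m - x) = (1 - e) *\<^sub>R x + e *\<^sub>R m" by (simp add: algebra_simps)
    then have p: "x + e *\<^sub>R (m - x) \<in> T" using convexD[OF cT(2) x mT, of "1 - e" e] e by simp
    have pw: "\<bar>(1 - e) ^ j\<bar> \<le> 1" for j using e by (simp add: power_abs power_le_one)
    have "\<bar>(m - x) \<bullet> cgrad \<theta> (x + e *\<^sub>R (m - x))\<bar> \<le> norm (m - x) * norm (cgrad \<theta> (x + e *\<^sub>R (m - x)))"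
      by (rule Cauchy_Schwarz_ineq2)
    also have "\<dots> \<le> D * B1"
      using D[OF x] B1(2)[OF p] D0 by (intro mult_mono) (auto simp: norm_minus_commute)
    finally have 1: "\<bar>(1 - e) ^ DIM('a)\<bar> * \<bar>(m - x) \<bullet> cgrad \<theta> (x + e *\<^sub>R (m - x))\<bar> \<le> 1 * (D * B1)"
      using pw by (intro mult_mono) auto
    have "\<bar>(1 - e) ^ (DIM('a) - 1)\<bar> * \<bar>\<theta> (x + e *\<^sub>R (m - x))\<bar> \<le> 1 * B0"
      using pw B0(2)[OF p] by (intro mult_mono) auto
    then have 2: "real DIM('a) * (\<bar>(1 - e) ^ (DIM('a) - 1)\<bar> * \<bar>\<theta> (x + e *\<^sub>R (m - x))\<bar>) \<le> real DIM('a) * (1 * B0)"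
      by (rule mult_left_mono) simp
    have "\<bar>h' x e\<bar> \<le> \<bar>(1 - e) ^ DIM('a) * ((m - x) \<bullet> cgrad \<theta> (x + e *\<^sub>R (m - x)))\<bar>
        + \<bar>real DIM('a) * (1 - e) ^ (DIM('a) - 1) * \<theta> (x + e *\<^sub>R (m - x))\<bar>"
      unfolding h'_def by (rule abs_triangle_ineq4)
    also have "\<dots> \<le> B"
      using add_mono[OF 1 2] by (simp only: abs_mult B_def mult.assoc abs_of_nat mult_1)
    finally show ?thesis .
  qed
  \<comment> \<open>the real number \<open>Suc k\<close> is \<open>C0 / \<epsilon> k\<close>, so the layer inequality is about difference quotients of h\<close>
  define Q where "Q k x = (h x 0 - h x (\<epsilon> k)) / \<epsilon> k" for k x
  have pt: "(1 - \<delta> k) ^ DIM('a) * I \<le> C0 * (LINT x|lebesgue_on T. Q k x)" if k: "k \<ge> k0" for k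
  proof -
    have kk: "\<delta> k < 1" "\<epsilon> k < 1" "\<delta> k * (D + r) < d" using k0[OF k] by auto
    have QI: "(LINT x|lebesgue_on T. (\<psi> x + \<omega>) - (1 - \<epsilon> k) ^ DIM('a) * (\<psi> (\<epsilon> k *\<^sub>R m + (1 - \<epsilon> k) *\<^sub>R x) + \<omega>))
        = \<epsilon> k * (LINT x|lebesgue_on T. Q k x)"
    proof -
      have "(\<psi> x + \<omega>) - (1 - \<epsilon> k) ^ DIM('a) * (\<psi> (\<epsilon> k *\<^sub>R m + (1 - \<epsilon> k) *\<^sub>R x) + \<omega>) = \<epsilon> k * Q k x" for x
      proof -
        have "\<epsilon> k *\<^sub>R m + (1 - \<epsilon> k) *\<^sub>R x = x + \<epsilon> k *\<^sub>R (m - x)" by (simp add: algebra_simps)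
        then show ?thesis
          using \<epsilon>p[of k] by (simp add: Q_def h_def \<theta>_def)
      qed
      then show ?thesis by simp
    qed
    have close: "\<bar>\<psi> x - \<psi> y\<bar> \<le> \<omega>" if "x \<in> T" "y \<in> T" "norm (x - y) \<le> \<delta> k * (D + r)" for x y
      using d(2)[OF that(2,1)] that(3) kk by (simp add: dist_norm)
    note layer = facet_le_layer[OF T s r H D zero_less_Suc refl \<epsilon>\<delta>[unfolded \<delta>_def] kk(1)[unfolded \<delta>_def] kk(2) less_imp_le[OF \<omega>]
        c\<psi> \<psi>(2) close[unfolded \<delta>_def]]
    have "ennreal ((1 - \<delta> k) ^ DIM('a)) * ennreal I \<le> ennreal (real (Suc k) * (\<epsilon> k * (LINT x|lebesgue_on T. Q k x)))"
      using layer(1) unfolding enI QI \<delta>_def .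
    moreover have "real (Suc k) * (\<epsilon> k * (LINT x|lebesgue_on T. Q k x)) = C0 * (LINT x|lebesgue_on T. Q k x)"
      by (simp add: \<epsilon>_def del: of_nat_Suc)
    ultimately have "ennreal ((1 - \<delta> k) ^ DIM('a) * I) \<le> ennreal (C0 * (LINT x|lebesgue_on T. Q k x))"
      by (simp only: ennreal_mult''[OF I0])
    moreover have "C0 * (LINT x|lebesgue_on T. Q k x) \<ge> 0"
      using layer(2) C0 \<epsilon>p[of k] unfolding QI by (simp add: zero_le_mult_iff)
    ultimately show ?thesis by (simp only: ennreal_le_iff)
  qed
  have Qc: "continuous_on UNIV (Q k)" for k
    unfolding Q_def[abs_def] h_def
    by (intro continuous_intros continuous_on_compose2[OF smooth_continuous[OF s\<theta>, of UNIV]])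
      (use \<epsilon>p[of k] in auto)
  have "(\<lambda>k. LINT x|lebesgue_on T. Q (k + k0) x) \<longlonglongrightarrow> (LINT x|lebesgue_on T. - h' x 0)"
  proof (rule integral_dominated_convergence)
    have sq: "square_integrable (lebesgue_on T) f \<Longrightarrow> f \<in> borel_measurable (lebesgue_on T)" for f
      by (simp add: square_integrable_def)
    show "(\<lambda>x. - h' x 0) \<in> borel_measurable (lebesgue_on T)"
      unfolding h'_def
      by (intro sq square_integrable_continuous cT continuous_intros smooth_continuous s\<theta> continuous_cgrad
          continuous_on_compose2[OF smooth_continuous[OF s\<theta>, of UNIV]] continuous_on_compose2[OF continuous_cgrad[OF s\<theta>, of UNIV]]) auto
    show "Q (k + k0) \<in> borel_measurable (lebesgue_on T)" for k
      by (intro sq square_integrable_continuous cT continuous_on_subset[OF Qc]) simp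
    show "integrable (lebesgue_on T) (\<lambda>x. B)"
      by (rule finite_measure.integrable_const[OF convex_body_finite_measure[OF T]])
    show "AE x in lebesgue_on T. (\<lambda>k. Q (k + k0) x) \<longlonglongrightarrow> - h' x 0"
    proof (rule AE_I2)
      fix x
      have "((\<lambda>e. (h x (0 + e) - h x 0) / e) \<longlongrightarrow> h' x 0) (at 0)"
        using h_deriv[of x 0] by (simp add: DERIV_def)
      moreover have "filterlim (\<lambda>k. \<epsilon> (k + k0)) (at 0) sequentially"
        using LIMSEQ_ignore_initial_segment[OF \<epsilon>0, of k0] \<epsilon>p by (auto simp: filterlim_at less_imp_neq[symmetric])
      ultimately have "(\<lambda>k. (h x (0 + \<epsilon> (k + k0)) - h x 0) / \<epsilon> (k + k0)) \<longlonglongrightarrow> h' x 0"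
        by (rule filterlim_compose)
      from tendsto_minus[OF this] show "(\<lambda>k. Q (k + k0) x) \<longlonglongrightarrow> - h' x 0"
        by (simp add: Q_def minus_divide_left)
    qed
    show "AE x in lebesgue_on T. norm (Q (k + k0) x) \<le> B" for k
    proof (rule AE_I2)
      fix x assume "x \<in> space (lebesgue_on T)"
      then have x: "x \<in> T" by simp
      define e where "e = \<epsilon> (k + k0)"
      have e: "0 < e" "e < 1" using \<epsilon>p k0[of "k + k0"] by (auto simp: e_def)
      have "\<exists>\<xi>. 0 < \<xi> \<and> \<xi> < e \<and> h x e - h x 0 = (e - 0) * h' x \<xi>"
        using e by (intro MVT2 h_deriv) auto
      then obtain \<xi> where \<xi>: "0 < \<xi>" "\<xi> < e" "h x e - h x 0 = e * h' x \<xi>" by auto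
      then have "h x 0 - h x e = e * (- h' x \<xi>)" by simp
      then have "Q (k + k0) x = - h' x \<xi>"
        using e by (simp add: Q_def e_def[symmetric])
      then show "norm (Q (k + k0) x) \<le> B"
        using h'_bound[OF x, of \<xi>] \<xi> e by simp
    qed
  qed
  then have R: "(\<lambda>k. C0 * (LINT x|lebesgue_on T. Q (k + k0) x)) \<longlonglongrightarrow> C0 * (LINT x|lebesgue_on T. - h' x 0)"
    by (rule tendsto_mult_left)
  have "(\<lambda>k. (1 - \<delta> (k + k0)) ^ DIM('a) * I) \<longlonglongrightarrow> (1 - 0) ^ DIM('a) * I"
    by (intro tendsto_mult tendsto_power tendsto_diff tendsto_const LIMSEQ_ignore_initial_segment[OF \<delta>0])
  then have L: "(\<lambda>k. (1 - \<delta> (k + k0)) ^ DIM('a) * I) \<longlonglongrightarrow> I" by simp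
  have "I \<le> C0 * (LINT x|lebesgue_on T. - h' x 0)"
    by (rule LIMSEQ_le[OF L R]) (use pt in auto)
  moreover have "- h' x 0 = real DIM('a) * (\<psi> x + \<omega>) + (x - m) \<bullet> cgrad \<psi> x" for x
  proof -
    have "cgrad \<theta> x = cgrad \<psi> x"
      unfolding cgrad_def \<theta>_def by (intro sum.cong refl) (simp add: smooth_partial_add[OF \<psi>(1) smooth_const])
    then show ?thesis
      by (simp add: h'_def \<theta>_def inner_diff_left)
  qed
  ultimately show ?thesis
    by (simp add: I_def C0_def)
qed

text \<open>The estimate \<open>facet_integral_le\<close> for the square of \<open>\<phi>\<close>; its gradient \<open>2 \<phi> \<nabla>\<phi>\<close> is absorbed by
  \<open>2 |\<phi>| |\<nabla>\<phi>| \<le> \<phi>\<^sup>2 + |\<nabla>\<phi>|\<^sup>2\<close>, and \<open>\<omega>\<close> tends to 0.\<close>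

lemma trace_inequality:
  fixes T :: "'a::euclidean_space set"
  assumes T: "convex_body T" and s: "supports (outer_normal T F) c T F" and F: "F \<noteq> {}" "compact F"
  obtains C where "C \<ge> 0" "\<And>\<phi>. smooth \<phi> \<Longrightarrow> (LINT x|facet_measure T F. (\<phi> x)\<^sup>2)
    \<le> C * ((LINT x|lebesgue_on T. (\<phi> x)\<^sup>2) + (\<Sum>b\<in>Basis. LINT x|lebesgue_on T. (partial_deriv \<phi> b x)\<^sup>2))"
proof -
  have cT: "compact T" using T by (simp add: convex_body_def)
  have fm: "finite_measure (lebesgue_on T)"
    by (rule convex_body_finite_measure[OF T])
  obtain m r where r: "r > 0" "cball m r \<subseteq> T" using convex_body_ball[OF T] .
  have mT: "m \<in> T" using r by (auto simp: subset_iff)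
  obtain D where D: "\<And>x. x \<in> T \<Longrightarrow> norm (x - m) \<le> D"
    using diameter_bounded_bound[OF compact_imp_bounded[OF cT] _ mT] unfolding dist_norm by blast
  have D0: "D \<ge> 0" using D[OF mT] by simp
  define H where "H = c - m \<bullet> outer_normal T F"
  have Hp: "H > 0" by (rule height_pos[OF T s r H_def D])
  define C0 where "C0 = (H + r) / (r * H)"
  have C0: "C0 > 0" using Hp r by (simp add: C0_def)
  show thesis
  proof (rule that[of "C0 * (real DIM('a) + D)"])
    show "C0 * (real DIM('a) + D) \<ge> 0" using C0 D0 by simp
    fix \<phi> :: "'a \<Rightarrow> real" assume \<phi>: "smooth \<phi>"
    let ?E = "(LINT x|lebesgue_on T. (\<phi> x)\<^sup>2) + (\<Sum>b\<in>Basis. LINT x|lebesgue_on T. (partial_deriv \<phi> b x)\<^sup>2)"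
    let ?\<psi> = "\<lambda>x. (\<phi> x)\<^sup>2"
    have int: "integrable (lebesgue_on T) f" if "continuous_on T f" for f :: "'a \<Rightarrow> real"
      by (rule square_integrable_imp_integrable'[OF fm square_integrable_continuous[OF cT that]])
    note c\<phi> = smooth_continuous[OF \<phi>, of T] and cp = smooth_continuous_partial[OF \<phi>, of _ T]
    have s\<psi>: "smooth ?\<psi>" by (rule smooth_power[OF \<phi>])
    have cg: "cgrad ?\<psi> x = (2 * \<phi> x) *\<^sub>R cgrad \<phi> x" for x
      using smooth_partial_mult[OF \<phi> \<phi>]
      by (simp add: cgrad_def power2_eq_square scaleR_sum_right mult.assoc)
    have ng: "(norm (cgrad \<phi> x))\<^sup>2 = (\<Sum>b\<in>Basis. (partial_deriv \<phi> b x)\<^sup>2)" for x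
    proof -
      have "(norm (cgrad \<phi> x))\<^sup>2 = (\<Sum>b\<in>Basis. (cgrad \<phi> x \<bullet> b)\<^sup>2)"
        unfolding power2_norm_eq_inner by (subst euclidean_inner) (simp add: power2_eq_square)
      then show ?thesis by simp
    qed
    have le: "(LINT x|facet_measure T F. ?\<psi> x)
        \<le> C0 * (real DIM('a) + D) * ?E + \<omega> * (C0 * real DIM('a) * measure lebesgue T)" if \<omega>: "\<omega> > 0" for \<omega>
    proof -
      have "(LINT x|facet_measure T F. ?\<psi> x)
          \<le> C0 * (LINT x|lebesgue_on T. real DIM('a) * (?\<psi> x + \<omega>) + (x - m) \<bullet> cgrad ?\<psi> x)"
        unfolding C0_def by (rule facet_integral_le[OF T s F r H_def D s\<psi> _ \<omega>]) auto
      also have "\<dots> \<le> C0 * (LINT x|lebesgue_on T. real DIM('a) * \<omega> + (real DIM('a) + D) * (?\<psi> x + (\<Sum>b\<in>Basis. (partial_deriv \<phi> b x)\<^sup>2)))"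
      proof (intro mult_left_mono integral_mono int)
        show "continuous_on T (\<lambda>x. real DIM('a) * (?\<psi> x + \<omega>) + (x - m) \<bullet> cgrad ?\<psi> x)"
          by (intro continuous_intros c\<phi> continuous_cgrad[OF s\<psi>])
        show "continuous_on T (\<lambda>x. real DIM('a) * \<omega> + (real DIM('a) + D) * (?\<psi> x + (\<Sum>b\<in>Basis. (partial_deriv \<phi> b x)\<^sup>2)))"
          by (intro continuous_intros c\<phi> cp)
        fix x assume "x \<in> space (lebesgue_on T)"
        then have x: "x \<in> T" by simp
        have "(x - m) \<bullet> cgrad ?\<psi> x \<le> norm (x - m) * norm (cgrad ?\<psi> x)"
          by (rule norm_cauchy_schwarz)
        also have "\<dots> \<le> D * (2 * \<bar>\<phi> x\<bar> * norm (cgrad \<phi> x))"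
          unfolding cg using D[OF x] D0 by (intro mult_mono) (auto simp: abs_mult)
        also have "\<dots> \<le> D * (?\<psi> x + (norm (cgrad \<phi> x))\<^sup>2)"
          using sum_squares_bound[of "\<bar>\<phi> x\<bar>" "norm (cgrad \<phi> x)"] D0 by (intro mult_left_mono) auto
        finally have 1: "(x - m) \<bullet> cgrad ?\<psi> x \<le> D * (?\<psi> x + (\<Sum>b\<in>Basis. (partial_deriv \<phi> b x)\<^sup>2))"
          unfolding ng .
        have "0 \<le> real DIM('a) * (\<Sum>b\<in>Basis. (partial_deriv \<phi> b x)\<^sup>2)"
          by (intro mult_nonneg_nonneg sum_nonneg) auto
        with 1 show "real DIM('a) * (?\<psi> x + \<omega>) + (x - m) \<bullet> cgrad ?\<psi> x
            \<le> real DIM('a) * \<omega> + (real DIM('a) + D) * (?\<psi> x + (\<Sum>b\<in>Basis. (partial_deriv \<phi> b x)\<^sup>2))"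
          unfolding distrib_right distrib_left by linarith
      qed (use C0 in simp)
      also have "(LINT x|lebesgue_on T. real DIM('a) * \<omega> + (real DIM('a) + D) * (?\<psi> x + (\<Sum>b\<in>Basis. (partial_deriv \<phi> b x)\<^sup>2)))
          = measure lebesgue T * (real DIM('a) * \<omega>) + (real DIM('a) + D) * ?E"
      proof -
        have i1: "integrable (lebesgue_on T) (\<lambda>x. real DIM('a) * \<omega>)" by (intro int continuous_intros)
        have i2: "integrable (lebesgue_on T) ?\<psi>" by (intro int continuous_intros c\<phi>)
        have i3: "integrable (lebesgue_on T) (\<lambda>x. (partial_deriv \<phi> b x)\<^sup>2)" if "b \<in> Basis" for b
          by (intro int continuous_intros cp that)
        have i4: "integrable (lebesgue_on T) (\<lambda>x. \<Sum>b\<in>Basis. (partial_deriv \<phi> b x)\<^sup>2)"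
          by (intro int continuous_intros cp)
        have "(LINT x|lebesgue_on T. real DIM('a) * \<omega>) = measure lebesgue T * (real DIM('a) * \<omega>)"
          using convex_body_lmeasurable(3)[OF T] by (simp add: measure_restrict_space)
        moreover have "(LINT x|lebesgue_on T. (\<Sum>b\<in>Basis. (partial_deriv \<phi> b x)\<^sup>2))
            = (\<Sum>b\<in>Basis. LINT x|lebesgue_on T. (partial_deriv \<phi> b x)\<^sup>2)"
          by (rule Bochner_Integration.integral_sum[OF i3])
        ultimately show ?thesis
          using i1 i2 i4 by simp
      qed
      finally show ?thesis by (simp add: algebra_simps)
    qed
    show "(LINT x|facet_measure T F. (\<phi> x)\<^sup>2) \<le> C0 * (real DIM('a) + D) * ?E"
    proof (rule field_le_epsilon)
      fix e :: real assume e: "e > 0"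
      define M where "M = C0 * real DIM('a) * measure lebesgue T"
      have M: "M \<ge> 0" using C0 by (simp add: M_def)
      define \<omega> where "\<omega> = e / (M + 1)"
      have \<omega>: "\<omega> > 0" using e M by (simp add: \<omega>_def)
      have "\<omega> * M \<le> e" using e M by (simp add: \<omega>_def divide_simps)
      then show "(LINT x|facet_measure T F. (\<phi> x)\<^sup>2) \<le> C0 * (real DIM('a) + D) * ?E + e"
        using le[OF \<omega>] by (simp add: M_def)
    qed
  qed
qed

section \<open>Traces\<close>

text \<open>What the theory of traces needs of an element and one of its facets.\<close>

definition body_facet :: "'a::euclidean_space set \<Rightarrow> 'a set \<Rightarrow> bool" where
  "body_facet T F \<longleftrightarrow> convex_body T \<and> F \<noteq> {} \<and> compact F \<and> (\<exists>c. supports (outer_normal T F) c T F)"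

text \<open>The squared \<open>H\<^sup>1\<close> distance of a smooth function from \<open>u\<close> with gradient \<open>G\<close>.\<close>

definition H1_dist :: "'a::euclidean_space set \<Rightarrow> ('a \<Rightarrow> real) \<Rightarrow> ('a \<Rightarrow> real) \<Rightarrow> ('a \<Rightarrow> 'a) \<Rightarrow> real" where
  "H1_dist T \<phi> u G = (LINT x|lebesgue_on T. (\<phi> x - u x)\<^sup>2)
    + (\<Sum>b\<in>Basis. LINT x|lebesgue_on T. (partial_deriv \<phi> b x - G x \<bullet> b)\<^sup>2)"

lemma weak_gradient_square_integrable:
  assumes T: "convex_body T" and u: "weak_gradient (interior T) u G"
  shows "square_integrable (lebesgue_on T) u"
    and "b \<in> Basis \<Longrightarrow> square_integrable (lebesgue_on T) (\<lambda>x. G x \<bullet> b)"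
proof -
  have wp: "weak_partial (interior T) b u (\<lambda>x. G x \<bullet> b)" if "b \<in> Basis" for b
    using u that by (simp add: weak_gradient_def)
  obtain b0 :: 'a where "b0 \<in> Basis" using nonempty_Basis by blast
  from wp[OF this] show "square_integrable (lebesgue_on T) u"
    using convex_body_square_integrable[OF T] by (auto simp: weak_partial_def)
  show "b \<in> Basis \<Longrightarrow> square_integrable (lebesgue_on T) (\<lambda>x. G x \<bullet> b)"
    using wp convex_body_square_integrable[OF T] by (auto simp: weak_partial_def)
qed

lemma square_integrable_smooth:
  assumes T: "convex_body T" and \<phi>: "smooth \<phi>"
  shows "square_integrable (lebesgue_on T) \<phi>"
    and "b \<in> Basis \<Longrightarrow> square_integrable (lebesgue_on T) (partial_deriv \<phi> b)"
  using T by (auto intro!: square_integrable_continuous smooth_continuous smooth_partial \<phi> simp: convex_body_def)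

lemma H1_dist_nonneg: "H1_dist T \<phi> u G \<ge> 0"
  unfolding H1_dist_def by (intro add_nonneg_nonneg sum_nonneg) auto

lemma H1_dist_tendsto:
  assumes "(\<lambda>m. LINT x|lebesgue_on T. (\<phi> m x - u x)\<^sup>2) \<longlonglongrightarrow> 0"
    and "\<And>b. b \<in> Basis \<Longrightarrow> (\<lambda>m. LINT x|lebesgue_on T. (partial_deriv (\<phi> m) b x - G x \<bullet> b)\<^sup>2) \<longlonglongrightarrow> 0"
  shows "(\<lambda>m. H1_dist T (\<phi> m) u G) \<longlonglongrightarrow> 0"
proof -
  have "(\<lambda>m. H1_dist T (\<phi> m) u G) \<longlonglongrightarrow> 0 + (\<Sum>b\<in>(Basis::'a set). 0)"
    unfolding H1_dist_def by (intro tendsto_add tendsto_sum assms)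
  then show ?thesis by simp
qed

text \<open>The trace inequality for the difference of two approximants. It is the form in which the trace
  inequality enters both the existence and the uniqueness of traces.\<close>

lemma facet_dist_le:
  fixes T :: "'a::euclidean_space set"
  assumes TF: "body_facet T F"
  obtains C where "C \<ge> 0" "\<And>\<phi> \<psi> u G. smooth \<phi> \<Longrightarrow> smooth \<psi> \<Longrightarrow> weak_gradient (interior T) u G \<Longrightarrow>
    (LINT x|facet_measure T F. (\<phi> x - \<psi> x)\<^sup>2) \<le> C * (H1_dist T \<phi> u G + H1_dist T \<psi> u G)"
proof -
  obtain c where T: "convex_body T" and F: "F \<noteq> {}" "compact F" and s: "supports (outer_normal T F) c T F"
    using TF by (auto simp: body_facet_def)
  obtain C where C: "C \<ge> 0" "\<And>\<phi>. smooth \<phi> \<Longrightarrow> (LINT x|facet_measure T F. (\<phi> x)\<^sup>2)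
    \<le> C * ((LINT x|lebesgue_on T. (\<phi> x)\<^sup>2) + (\<Sum>b\<in>Basis. LINT x|lebesgue_on T. (partial_deriv \<phi> b x)\<^sup>2))"
    using trace_inequality[OF T s F] by blast
  show thesis
  proof (rule that[of "C * 2"])
    show "C * 2 \<ge> 0" using C by simp
    fix \<phi> \<psi> u :: "'a \<Rightarrow> real" and G assume \<phi>: "smooth \<phi>" and \<psi>: "smooth \<psi>" and u: "weak_gradient (interior T) u G"
    have tri: "(LINT x|lebesgue_on T. (f x - g x)\<^sup>2) \<le> 2 * (LINT x|lebesgue_on T. (f x - w x)\<^sup>2) + 2 * (LINT x|lebesgue_on T. (g x - w x)\<^sup>2)"
      if "square_integrable (lebesgue_on T) f" "square_integrable (lebesgue_on T) g" "square_integrable (lebesgue_on T) w" for f g w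
    proof -
      have "(LINT x|lebesgue_on T. (f x - g x)\<^sup>2) = (LINT x|lebesgue_on T. ((f x - w x) + (w x - g x))\<^sup>2)"
        by simp
      also have "\<dots> \<le> 2 * (LINT x|lebesgue_on T. (f x - w x)\<^sup>2) + 2 * (LINT x|lebesgue_on T. (w x - g x)\<^sup>2)"
        by (intro L2_norm_add_le square_integrable_diff that)
      finally show ?thesis by (simp add: power2_commute[of "g _"])
    qed
    note sq = square_integrable_smooth[OF T \<phi>] square_integrable_smooth[OF T \<psi>] weak_gradient_square_integrable[OF T u]
    have "(LINT x|lebesgue_on T. (\<phi> x - \<psi> x)\<^sup>2) + (\<Sum>b\<in>Basis. LINT x|lebesgue_on T. (partial_deriv \<phi> b x - partial_deriv \<psi> b x)\<^sup>2)
        \<le> (2 * (LINT x|lebesgue_on T. (\<phi> x - u x)\<^sup>2) + 2 * (LINT x|lebesgue_on T. (\<psi> x - u x)\<^sup>2))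
        + (\<Sum>b\<in>Basis. 2 * (LINT x|lebesgue_on T. (partial_deriv \<phi> b x - G x \<bullet> b)\<^sup>2)
            + 2 * (LINT x|lebesgue_on T. (partial_deriv \<psi> b x - G x \<bullet> b)\<^sup>2))"
      by (intro add_mono sum_mono tri sq)
    also have "\<dots> = 2 * (H1_dist T \<phi> u G + H1_dist T \<psi> u G)"
      by (simp add: H1_dist_def sum.distrib sum_distrib_left)
    finally have 1: "(LINT x|lebesgue_on T. (\<phi> x - \<psi> x)\<^sup>2) + (\<Sum>b\<in>Basis. LINT x|lebesgue_on T. (partial_deriv \<phi> b x - partial_deriv \<psi> b x)\<^sup>2)
        \<le> 2 * (H1_dist T \<phi> u G + H1_dist T \<psi> u G)" .
    have "(LINT x|facet_measure T F. (\<phi> x - \<psi> x)\<^sup>2)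
        \<le> C * ((LINT x|lebesgue_on T. (\<phi> x - \<psi> x)\<^sup>2) + (\<Sum>b\<in>Basis. LINT x|lebesgue_on T. (partial_deriv \<phi> b x - partial_deriv \<psi> b x)\<^sup>2))"
      using C(2)[OF smooth_diff[OF \<phi> \<psi>]] unfolding smooth_partial_diff[OF \<phi> \<psi>] .
    also have "\<dots> \<le> C * (2 * (H1_dist T \<phi> u G + H1_dist T \<psi> u G))"
      by (rule mult_left_mono[OF 1 C(1)])
    finally show "(LINT x|facet_measure T F. (\<phi> x - \<psi> x)\<^sup>2) \<le> C * 2 * (H1_dist T \<phi> u G + H1_dist T \<psi> u G)"
      by (simp only: mult.assoc)
  qed
qed

lemma body_facetD:
  assumes "body_facet T F"
  shows "convex_body T" "compact F" "finite_measure (facet_measure T F)"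
    and "continuous_on UNIV f \<Longrightarrow> square_integrable (facet_measure T F) f"
  using assms finite_facet_measure square_integrable_facet_continuous unfolding body_facet_def by blast+

lemma AE_inner_Basis_imp_AE_eq:
  fixes G G' :: "'b \<Rightarrow> 'a::euclidean_space"
  assumes "\<And>b. b \<in> Basis \<Longrightarrow> AE x in M. G x \<bullet> b = G' x \<bullet> b"
  shows "AE x in M. G x = G' x"
proof -
  have "AE x in M. \<forall>b\<in>Basis. G x \<bullet> b = G' x \<bullet> b"
    using assms by (intro AE_finite_allI) auto
  then show ?thesis
    by (rule eventually_mono) (auto intro: euclidean_eqI)
qed

lemma weak_gradient_unique:
  fixes T :: "'a::euclidean_space set"
  assumes "convex_body T" "weak_gradient (interior T) u G" "weak_gradient (interior T) u G'"
  shows "AE x in lebesgue_on T. G x = G' x"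
proof (rule AE_inner_Basis_imp_AE_eq)
  fix b :: 'a assume "b \<in> Basis"
  then have "weak_partial (interior T) b u (\<lambda>x. G x \<bullet> b)" "weak_partial (interior T) b u (\<lambda>x. G' x \<bullet> b)"
    using assms(2,3) by (simp_all add: weak_gradient_def)
  then show "AE x in lebesgue_on T. G x \<bullet> b = G' x \<bullet> b"
    by (rule weak_partial_unique[OF assms(1)])
qed

lemma weak_partial_cong_AE:
  assumes T: "convex_body T" and b: "b \<in> Basis" and u: "weak_partial (interior T) b u g"
    and u': "square_integrable (lebesgue_on T) u'" and eq: "AE x in lebesgue_on T. u x = u' x"
  shows "weak_partial (interior T) b u' g"
  unfolding weak_partial_def
proof (intro conjI allI impI)
  let ?M = "lebesgue_on (interior T)"
  show su': "square_integrable ?M u'" using u' convex_body_square_integrable[OF T] by blast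
  show "square_integrable ?M g" using u by (simp add: weak_partial_def)
  fix \<phi> assume \<phi>: "test_function (interior T) \<phi>"
  show "(LINT x|?M. u' x * partial_deriv \<phi> b x) = - (LINT x|?M. g x * \<phi> x)"
  proof -
    have "smooth \<phi>" using \<phi> by (simp add: test_function_def)
    then have m: "partial_deriv \<phi> b \<in> borel_measurable ?M"
      using square_integrable_smooth(2)[OF T _ b] convex_body_square_integrable[OF T]
      by (auto simp: square_integrable_def)
    have "(LINT x|?M. u' x * partial_deriv \<phi> b x) = (LINT x|?M. u x * partial_deriv \<phi> b x)"
    proof (rule integral_cong_AE)
      show "(\<lambda>x. u' x * partial_deriv \<phi> b x) \<in> borel_measurable ?M" "(\<lambda>x. u x * partial_deriv \<phi> b x) \<in> borel_measurable ?M"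
        using su' u m by (auto simp: square_integrable_def weak_partial_def)
      have "AE x in ?M. u x = u' x"
        using eq convex_body_AE[OF T] by blast
      then show "AE x in ?M. u' x * partial_deriv \<phi> b x = u x * partial_deriv \<phi> b x"
        by (rule eventually_mono) simp
    qed
    then show ?thesis using u \<phi> by (simp add: weak_partial_def)
  qed
qed

lemma weak_gradient_cong_AE:
  assumes "convex_body T" "weak_gradient (interior T) u G"
    and "square_integrable (lebesgue_on T) u'" "AE x in lebesgue_on T. u x = u' x"
  shows "weak_gradient (interior T) u' G"
  using weak_partial_cong_AE[OF assms(1)] assms(2-4) unfolding weak_gradient_def by blast

lemma L2_dist_cong_AE:
  assumes "square_integrable M f" "square_integrable M g" "square_integrable M g'" "AE x in M. g x = g' x"
  shows "(LINT x|M. (f x - g x)\<^sup>2) = (LINT x|M. (f x - g' x)\<^sup>2)"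
proof (rule integral_cong_AE)
  show "(\<lambda>x. (f x - g x)\<^sup>2) \<in> borel_measurable M" "(\<lambda>x. (f x - g' x)\<^sup>2) \<in> borel_measurable M"
    using square_integrable_diff[OF assms(1,2)] square_integrable_diff[OF assms(1,3)]
    by (auto simp: square_integrable_def)
  show "AE x in M. (f x - g x)\<^sup>2 = (f x - g' x)\<^sup>2"
    using assms(4) by (rule eventually_mono) simp
qed

text \<open>The witnesses of \<open>is_trace\<close>, with the gradient made explicit.\<close>

definition trace_approx :: "'a::euclidean_space set \<Rightarrow> 'a set \<Rightarrow> ('a \<Rightarrow> real) \<Rightarrow> ('a \<Rightarrow> 'a) \<Rightarrow>
    ('a \<Rightarrow> real) \<Rightarrow> (nat \<Rightarrow> 'a \<Rightarrow> real) \<Rightarrow> bool" where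
  "trace_approx T F u G g \<phi> \<longleftrightarrow>
     square_integrable (facet_measure T F) g \<and> weak_gradient (interior T) u G \<and> (\<forall>m. smooth (\<phi> m)) \<and>
     (\<lambda>m. LINT x|lebesgue_on T. (\<phi> m x - u x)\<^sup>2) \<longlonglongrightarrow> 0 \<and>
     (\<forall>b\<in>Basis. (\<lambda>m. LINT x|lebesgue_on T. (partial_deriv (\<phi> m) b x - G x \<bullet> b)\<^sup>2) \<longlonglongrightarrow> 0) \<and>
     (\<lambda>m. LINT x|facet_measure T F. (\<phi> m x - g x)\<^sup>2) \<longlonglongrightarrow> 0"

lemma is_trace_iff: "is_trace T F u g \<longleftrightarrow> (\<exists>G \<phi>. trace_approx T F u G g \<phi>)"
  unfolding is_trace_def trace_approx_def by blast

lemma trace_approxD: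
  assumes "trace_approx T F u G g \<phi>"
  shows "square_integrable (facet_measure T F) g" "smooth (\<phi> m)"
    "(\<lambda>m. LINT x|lebesgue_on T. (\<phi> m x - u x)\<^sup>2) \<longlonglongrightarrow> 0"
    "b \<in> Basis \<Longrightarrow> (\<lambda>m. LINT x|lebesgue_on T. (partial_deriv (\<phi> m) b x - G x \<bullet> b)\<^sup>2) \<longlonglongrightarrow> 0"
    "(\<lambda>m. LINT x|facet_measure T F. (\<phi> m x - g x)\<^sup>2) \<longlonglongrightarrow> 0"
    "weak_gradient (interior T) u G"
  using assms unfolding trace_approx_def by blast+

text \<open>Weak gradients are unique, so the approximants of a trace converge for every choice of gradient.\<close>

lemma is_traceE:
  fixes T :: "'a::euclidean_space set"
  assumes T: "convex_body T" and tr: "is_trace T F u g" and u: "weak_gradient (interior T) u G"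
  obtains \<phi> where "trace_approx T F u G g \<phi>"
proof -
  obtain G' \<phi> where A: "trace_approx T F u G' g \<phi>"
    using tr unfolding is_trace_iff by blast
  note * = trace_approxD[OF A]
  have "(\<lambda>m. LINT x|lebesgue_on T. (partial_deriv (\<phi> m) b x - G x \<bullet> b)\<^sup>2) \<longlonglongrightarrow> 0" if b: "b \<in> Basis" for b
  proof -
    have "AE x in lebesgue_on T. G' x = G x"
      by (rule weak_gradient_unique[OF T *(6) u])
    then have "AE x in lebesgue_on T. G' x \<bullet> b = G x \<bullet> b"
      by (rule eventually_mono) simp
    then have "(LINT x|lebesgue_on T. (partial_deriv (\<phi> m) b x - G' x \<bullet> b)\<^sup>2)
        = (LINT x|lebesgue_on T. (partial_deriv (\<phi> m) b x - G x \<bullet> b)\<^sup>2)" for m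
      by (intro L2_dist_cong_AE square_integrable_smooth(2)[OF T *(2) b]
          weak_gradient_square_integrable(2)[OF T *(6) b] weak_gradient_square_integrable(2)[OF T u b])
    with *(4)[OF b] show ?thesis by simp
  qed
  then have "trace_approx T F u G g \<phi>"
    using A u unfolding trace_approx_def by blast
  then show thesis by (rule that)
qed

text \<open>Approximants of two traces of \<open>u\<close> come together in \<open>H\<^sup>1\<close>, hence on the facet by the trace
  inequality.\<close>

lemma is_trace_unique:
  fixes T :: "'a::euclidean_space set"
  assumes TF: "body_facet T F" and tr: "is_trace T F u g" "is_trace T F u g'"
  shows "AE x in facet_measure T F. g x = g' x"
proof -
  note T = body_facetD(1)[OF TF]
  obtain G where u: "weak_gradient (interior T) u G" using tr(1) unfolding is_trace_def by blast
  obtain \<phi> where A1: "trace_approx T F u G g \<phi>"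
    by (rule is_traceE[OF T tr(1) u])
  note 1 = trace_approxD[OF A1]
  obtain \<psi> where A2: "trace_approx T F u G g' \<psi>"
    by (rule is_traceE[OF T tr(2) u])
  note 2 = trace_approxD[OF A2]
  obtain C where C: "C \<ge> 0" "\<And>\<phi> \<psi> u G. smooth \<phi> \<Longrightarrow> smooth \<psi> \<Longrightarrow> weak_gradient (interior T) u G \<Longrightarrow>
    (LINT x|facet_measure T F. (\<phi> x - \<psi> x)\<^sup>2) \<le> C * (H1_dist T \<phi> u G + H1_dist T \<psi> u G)"
    using facet_dist_le[OF TF] by blast
  have lim: "(\<lambda>m. C * (H1_dist T (\<phi> m) u G + H1_dist T (\<psi> m) u G)) \<longlonglongrightarrow> 0"
    using tendsto_mult_left[OF tendsto_add[OF H1_dist_tendsto[OF 1(3,4)] H1_dist_tendsto[OF 2(3,4)]], of C] by simp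
  have sq: "square_integrable (facet_measure T F) (\<phi> m)" "square_integrable (facet_measure T F) (\<psi> m)" for m
    by (intro body_facetD(4)[OF TF] smooth_continuous 1 2)+
  have "(\<lambda>m. LINT x|facet_measure T F. ((\<phi> m x - \<psi> m x) - 0)\<^sup>2) \<longlonglongrightarrow> 0"
  proof (rule tendsto_sandwich[OF _ _ tendsto_const lim])
    show "\<forall>\<^sub>F m in sequentially. (LINT x|facet_measure T F. ((\<phi> m x - \<psi> m x) - 0)\<^sup>2) \<le> C * (H1_dist T (\<phi> m) u G + H1_dist T (\<psi> m) u G)"
      using C(2)[OF 1(2) 2(2) u] by simp
  qed simp
  moreover have "(\<lambda>m. LINT x|facet_measure T F. ((\<phi> m x - \<psi> m x) - (g x - g' x))\<^sup>2) \<longlonglongrightarrow> 0"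
    by (rule L2_tendsto_diff[OF sq 1(1) 2(1) 1(5) 2(5)])
  ultimately have "AE x in facet_measure T F. g x - g' x = 0"
    by (intro L2_tendsto_unique[OF square_integrable_diff[OF sq] square_integrable_diff[OF 1(1) 2(1)] square_integrable_zero])
  then show ?thesis by (rule eventually_mono) simp
qed

lemma is_trace_cong_AE:
  fixes T :: "'a::euclidean_space set"
  assumes T: "convex_body T" and tr: "is_trace T F u g"
    and u': "square_integrable (lebesgue_on T) u'" and eq: "AE x in lebesgue_on T. u x = u' x"
  shows "is_trace T F u' g"
proof -
  obtain G where u: "weak_gradient (interior T) u G" using tr unfolding is_trace_def by blast
  obtain \<phi> where A1: "trace_approx T F u G g \<phi>"
    by (rule is_traceE[OF T tr u])
  note 1 = trace_approxD[OF A1]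
  have "(LINT x|lebesgue_on T. (\<phi> m x - u x)\<^sup>2) = (LINT x|lebesgue_on T. (\<phi> m x - u' x)\<^sup>2)" for m
    by (rule L2_dist_cong_AE[OF square_integrable_smooth(1)[OF T 1(2)] weak_gradient_square_integrable(1)[OF T u] u' eq])
  with 1(3) have "(\<lambda>m. LINT x|lebesgue_on T. (\<phi> m x - u' x)\<^sup>2) \<longlonglongrightarrow> 0" by simp
  then show ?thesis
    unfolding is_trace_def using 1 weak_gradient_cong_AE[OF T u u' eq] by blast
qed

lemma weak_partial_add:
  assumes T: "convex_body T" and b: "b \<in> Basis"
    and u: "weak_partial (interior T) b u g" and v: "weak_partial (interior T) b v h"
  shows "weak_partial (interior T) b (\<lambda>x. u x + v x) (\<lambda>x. g x + h x)"
  unfolding weak_partial_def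
proof (intro conjI allI impI)
  let ?M = "lebesgue_on (interior T)"
  have sq: "square_integrable ?M u" "square_integrable ?M v" "square_integrable ?M g" "square_integrable ?M h"
    using u v by (auto simp: weak_partial_def)
  show "square_integrable ?M (\<lambda>x. u x + v x)" "square_integrable ?M (\<lambda>x. g x + h x)"
    by (intro square_integrable_add sq)+
  fix \<phi> assume \<phi>: "test_function (interior T) \<phi>"
  then have "smooth \<phi>" by (simp add: test_function_def)
  then have s: "square_integrable ?M \<phi>" "square_integrable ?M (partial_deriv \<phi> b)"
    using square_integrable_smooth[OF T] b convex_body_square_integrable[OF T] by blast+
  have "(LINT x|?M. (u x + v x) * partial_deriv \<phi> b x)
      = (LINT x|?M. u x * partial_deriv \<phi> b x) + (LINT x|?M. v x * partial_deriv \<phi> b x)"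
    unfolding distrib_right by (intro Bochner_Integration.integral_add square_integrable_mult sq s)
  also have "\<dots> = - ((LINT x|?M. g x * \<phi> x) + (LINT x|?M. h x * \<phi> x))"
    using u v \<phi> by (simp add: weak_partial_def)
  also have "(LINT x|?M. g x * \<phi> x) + (LINT x|?M. h x * \<phi> x) = (LINT x|?M. (g x + h x) * \<phi> x)"
    unfolding distrib_right by (intro Bochner_Integration.integral_add[symmetric] square_integrable_mult sq s)
  finally show "(LINT x|?M. (u x + v x) * partial_deriv \<phi> b x) = - (LINT x|?M. (g x + h x) * \<phi> x)" .
qed

lemma weak_partial_cmult:
  assumes "weak_partial S b u g"
  shows "weak_partial S b (\<lambda>x. c * u x) (\<lambda>x. c * g x)"
  using assms by (auto simp: weak_partial_def square_integrable_cmult mult.assoc)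

lemma weak_gradient_add:
  "convex_body T \<Longrightarrow> weak_gradient (interior T) u G \<Longrightarrow> weak_gradient (interior T) v H \<Longrightarrow>
    weak_gradient (interior T) (\<lambda>x. u x + v x) (\<lambda>x. G x + H x)"
  by (simp add: weak_gradient_def inner_add_left weak_partial_add)

lemma weak_gradient_cmult:
  "weak_gradient S u G \<Longrightarrow> weak_gradient S (\<lambda>x. c * u x) (\<lambda>x. c *\<^sub>R G x)"
  by (simp add: weak_gradient_def weak_partial_cmult)

lemma is_trace_add:
  fixes T :: "'a::euclidean_space set"
  assumes TF: "body_facet T F" and tr: "is_trace T F u g" "is_trace T F v h"
  shows "is_trace T F (\<lambda>x. u x + v x) (\<lambda>x. g x + h x)"
proof -
  note T = body_facetD(1)[OF TF]
  obtain G H where u: "weak_gradient (interior T) u G" and v: "weak_gradient (interior T) v H"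
    using tr unfolding is_trace_def by blast
  obtain \<phi> where A1: "trace_approx T F u G g \<phi>"
    by (rule is_traceE[OF T tr(1) u])
  note 1 = trace_approxD[OF A1]
  obtain \<psi> where A2: "trace_approx T F v H h \<psi>"
    by (rule is_traceE[OF T tr(2) v])
  note 2 = trace_approxD[OF A2]
  note sq = square_integrable_smooth[OF T 1(2)] square_integrable_smooth[OF T 2(2)]
    weak_gradient_square_integrable[OF T u] weak_gradient_square_integrable[OF T v]
  have sF: "square_integrable (facet_measure T F) (\<phi> m)" "square_integrable (facet_measure T F) (\<psi> m)" for m
    by (intro body_facetD(4)[OF TF] smooth_continuous 1 2)+
  show ?thesis
    unfolding is_trace_def
  proof (intro conjI exI ballI allI)
    show "square_integrable (facet_measure T F) (\<lambda>x. g x + h x)"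
      by (intro square_integrable_add 1 2)
    show "weak_gradient (interior T) (\<lambda>x. u x + v x) (\<lambda>x. G x + H x)"
      by (rule weak_gradient_add[OF T u v])
    show "smooth (\<lambda>x. \<phi> m x + \<psi> m x)" for m by (intro smooth_add 1 2)
    show "(\<lambda>m. LINT x|lebesgue_on T. (\<phi> m x + \<psi> m x - (u x + v x))\<^sup>2) \<longlonglongrightarrow> 0"
      by (intro L2_tendsto_add sq 1 2)
    show "(\<lambda>m. LINT x|facet_measure T F. (\<phi> m x + \<psi> m x - (g x + h x))\<^sup>2) \<longlonglongrightarrow> 0"
      by (intro L2_tendsto_add sF 1 2)
    fix b :: 'a assume b: "b \<in> Basis"
    show "(\<lambda>m. LINT x|lebesgue_on T. (partial_deriv (\<lambda>x. \<phi> m x + \<psi> m x) b x - (G x + H x) \<bullet> b)\<^sup>2) \<longlonglongrightarrow> 0"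
      unfolding smooth_partial_add[OF 1(2) 2(2)] inner_add_left
      by (intro L2_tendsto_add sq b 1 2)
  qed
qed

lemma is_trace_cmult:
  fixes T :: "'a::euclidean_space set"
  assumes TF: "body_facet T F" and tr: "is_trace T F u g"
  shows "is_trace T F (\<lambda>x. c * u x) (\<lambda>x. c * g x)"
proof -
  note T = body_facetD(1)[OF TF]
  obtain G where u: "weak_gradient (interior T) u G"
    using tr unfolding is_trace_def by blast
  obtain \<phi> where A1: "trace_approx T F u G g \<phi>"
    by (rule is_traceE[OF T tr u])
  note 1 = trace_approxD[OF A1]
  show ?thesis
    unfolding is_trace_def
  proof (intro conjI exI ballI allI)
    show "square_integrable (facet_measure T F) (\<lambda>x. c * g x)"
      by (intro square_integrable_cmult 1)
    show "weak_gradient (interior T) (\<lambda>x. c * u x) (\<lambda>x. c *\<^sub>R G x)"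
      by (rule weak_gradient_cmult[OF u])
    show "smooth (\<lambda>x. c * \<phi> m x)" for m by (intro smooth_cmult 1)
    show "(\<lambda>m. LINT x|lebesgue_on T. (c * \<phi> m x - c * u x)\<^sup>2) \<longlonglongrightarrow> 0"
      by (intro L2_tendsto_cmult 1)
    show "(\<lambda>m. LINT x|facet_measure T F. (c * \<phi> m x - c * g x)\<^sup>2) \<longlonglongrightarrow> 0"
      by (intro L2_tendsto_cmult 1)
    fix b :: 'a assume b: "b \<in> Basis"
    show "(\<lambda>m. LINT x|lebesgue_on T. (partial_deriv (\<lambda>x. c * \<phi> m x) b x - (c *\<^sub>R G x) \<bullet> b)\<^sup>2) \<longlonglongrightarrow> 0"
      unfolding smooth_partial_cmult[OF 1(2)] inner_scaleR_left
      by (intro L2_tendsto_cmult 1 b)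
  qed
qed

text \<open>Completeness of \<open>L\<^sup>2\<close> of the facet: an almost everywhere convergent subsequence gives
  the limit function, and Fatou's lemma gives the convergence in mean square.\<close>

lemma is_trace_exists:
  fixes T :: "'a::euclidean_space set"
  assumes TF: "body_facet T F" and u: "weak_gradient (interior T) u G"
  shows "\<exists>g. is_trace T F u g"
proof -
  note T = body_facetD(1)[OF TF] and fm = body_facetD(3)[OF TF]
  let ?M = "facet_measure T F"
  obtain \<phi> where \<phi>: "\<And>m::nat. smooth (\<phi> m)"
    "(\<lambda>m. LINT x|lebesgue_on T. (\<phi> m x - u x)\<^sup>2) \<longlonglongrightarrow> 0"
    "\<And>b. b \<in> Basis \<Longrightarrow> (\<lambda>m. LINT x|lebesgue_on T. (partial_deriv (\<phi> m) b x - G x \<bullet> b)\<^sup>2) \<longlonglongrightarrow> 0"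
    using smooth_dense_in_H1[OF T u] by blast
  obtain C where C: "C \<ge> 0" "\<And>\<phi> \<psi> u G. smooth \<phi> \<Longrightarrow> smooth \<psi> \<Longrightarrow> weak_gradient (interior T) u G \<Longrightarrow>
    (LINT x|?M. (\<phi> x - \<psi> x)\<^sup>2) \<le> C * (H1_dist T \<phi> u G + H1_dist T \<psi> u G)"
    using facet_dist_le[OF TF] by blast
  define e where "e m = C * H1_dist T (\<phi> m) u G" for m
  have e0: "e m \<ge> 0" for m unfolding e_def by (intro mult_nonneg_nonneg C(1) H1_dist_nonneg)
  have elim: "e \<longlonglongrightarrow> 0"
    unfolding e_def[abs_def] using tendsto_mult_left[OF H1_dist_tendsto[OF \<phi>(2,3)], of C] by simp
  have dist: "(LINT x|?M. (\<phi> i x - \<phi> j x)\<^sup>2) \<le> e i + e j" for i j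
    using C(2)[OF \<phi>(1) \<phi>(1) u, of i j] by (simp add: e_def distrib_left)
  have sF: "square_integrable ?M (\<phi> m)" for m
    by (intro body_facetD(4)[OF TF] smooth_continuous \<phi>)
  have iF: "integrable ?M (\<phi> m)" for m
    by (rule square_integrable_imp_integrable'[OF fm sF])
  define \<sigma> where "\<sigma> = measure ?M (space ?M)"
  have \<sigma>: "\<sigma> \<ge> 0" by (simp add: \<sigma>_def)
  have cauchy: "\<exists>N. \<forall>i\<ge>N. \<forall>j\<ge>N. (LINT x|?M. norm (\<phi> i x - \<phi> j x)) < \<epsilon>" if \<epsilon>: "\<epsilon> > 0" for \<epsilon>
  proof -
    \<comment> \<open>from \<open>a \<le> a\<^sup>2 / \<eta> + \<eta>\<close> mean square convergence controls \<open>L\<^sup>1\<close> distances on a finite measure space\<close>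
    define \<eta> where "\<eta> = \<epsilon> / (2 * (\<sigma> + 1))"
    have \<eta>: "\<eta> > 0" "\<eta> * \<sigma> \<le> \<epsilon> / 2"
      using \<epsilon> \<sigma> by (simp_all add: \<eta>_def divide_simps)
    have "\<eta> * \<epsilon> / 4 > 0" using \<eta> \<epsilon> by simp
    then have "\<forall>\<^sub>F m in sequentially. e m < \<eta> * \<epsilon> / 4"
      by (rule order_tendstoD(2)[OF elim])
    then obtain N where N: "\<And>m. m \<ge> N \<Longrightarrow> e m < \<eta> * \<epsilon> / 4"
      unfolding eventually_sequentially by blast
    have "(LINT x|?M. norm (\<phi> i x - \<phi> j x)) < \<epsilon>" if ij: "i \<ge> N" "j \<ge> N" for i j
    proof -
      have sd: "square_integrable ?M (\<lambda>x. \<phi> i x - \<phi> j x)" by (intro square_integrable_diff sF)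
      have i2: "integrable ?M (\<lambda>x. (\<phi> i x - \<phi> j x)\<^sup>2 / \<eta> + \<eta>)"
        using sd finite_measure.integrable_const[OF fm, of \<eta>] by (simp add: square_integrable_def)
      have "(LINT x|?M. norm (\<phi> i x - \<phi> j x)) \<le> (LINT x|?M. (\<phi> i x - \<phi> j x)\<^sup>2 / \<eta> + \<eta>)"
      proof (rule integral_mono[OF integrable_norm[OF square_integrable_imp_integrable'[OF fm sd]] i2])
        fix x
        define a where "a = \<bar>\<phi> i x - \<phi> j x\<bar>"
        have "2 * a * \<eta> \<le> a\<^sup>2 + \<eta>\<^sup>2" by (rule sum_squares_bound)
        moreover have "0 \<le> a * \<eta>" using \<eta> by (simp add: a_def)
        ultimately have "a * \<eta> \<le> a\<^sup>2 + \<eta>\<^sup>2" by linarith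
        then have "a \<le> a\<^sup>2 / \<eta> + \<eta>" using \<eta>(1) by (simp add: field_simps power2_eq_square)
        then show "norm (\<phi> i x - \<phi> j x) \<le> (\<phi> i x - \<phi> j x)\<^sup>2 / \<eta> + \<eta>" by (simp add: a_def)
      qed
      also have "\<dots> = (LINT x|?M. (\<phi> i x - \<phi> j x)\<^sup>2) / \<eta> + \<eta> * \<sigma>"
        using sd finite_measure.integrable_const[OF fm, of \<eta>] by (simp add: square_integrable_def \<sigma>_def)
      also have "\<dots> < (\<eta> * \<epsilon> / 2) / \<eta> + \<epsilon> / 2"
        using dist[of i j] N[OF ij(1)] N[OF ij(2)] \<eta>
        by (intro add_less_le_mono divide_strict_right_mono) auto
      also have "\<dots> = \<epsilon>" using \<eta>(1) by simp
      finally show ?thesis .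
    qed
    then show ?thesis by blast
  qed
  obtain r where r: "strict_mono r" "AE x in ?M. Cauchy (\<lambda>i. \<phi> (r i) x)"
    using cauchy_L1_AE_cauchy_subseq[OF iF cauchy] by blast
  define g where "g x = lim (\<lambda>i. \<phi> (r i) x)" for x
  have mg: "g \<in> borel_measurable ?M"
    unfolding g_def[abs_def] using iF by (intro borel_measurable_lim_metric borel_measurable_integrable)
  have lim: "AE x in ?M. (\<lambda>i. \<phi> (r i) x) \<longlonglongrightarrow> g x"
    using r(2) by (rule eventually_mono) (simp add: g_def Cauchy_convergent_iff convergent_LIMSEQ_iff)
  have elim': "(\<lambda>i. e (r i)) \<longlonglongrightarrow> 0"
    using LIMSEQ_subseq_LIMSEQ[OF elim r(1)] by (simp add: o_def)
  have nn: "(\<integral>\<^sup>+x. ennreal ((\<phi> m x - g x)\<^sup>2) \<partial>?M) \<le> ennreal (e m)" for m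
  proof -
    have "(\<integral>\<^sup>+x. ennreal ((\<phi> m x - g x)\<^sup>2) \<partial>?M) = (\<integral>\<^sup>+x. liminf (\<lambda>i. ennreal ((\<phi> m x - \<phi> (r i) x)\<^sup>2)) \<partial>?M)"
    proof (rule nn_integral_cong_AE)
      show "AE x in ?M. ennreal ((\<phi> m x - g x)\<^sup>2) = liminf (\<lambda>i. ennreal ((\<phi> m x - \<phi> (r i) x)\<^sup>2))"
        using lim
      proof (rule eventually_mono)
        fix x assume "(\<lambda>i. \<phi> (r i) x) \<longlonglongrightarrow> g x"
        then have "(\<lambda>i. ennreal ((\<phi> m x - \<phi> (r i) x)\<^sup>2)) \<longlonglongrightarrow> ennreal ((\<phi> m x - g x)\<^sup>2)"
          by (intro tendsto_ennrealI tendsto_power tendsto_diff tendsto_const)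
        then show "ennreal ((\<phi> m x - g x)\<^sup>2) = liminf (\<lambda>i. ennreal ((\<phi> m x - \<phi> (r i) x)\<^sup>2))"
          by (intro lim_imp_Liminf[symmetric]) auto
      qed
    qed
    also have "\<dots> \<le> liminf (\<lambda>i. \<integral>\<^sup>+x. ennreal ((\<phi> m x - \<phi> (r i) x)\<^sup>2) \<partial>?M)"
    proof (rule nn_integral_liminf)
      show "(\<lambda>x. ennreal ((\<phi> m x - \<phi> (r i) x)\<^sup>2)) \<in> borel_measurable ?M" for i
        using borel_measurable_integrable[OF iF[of m]] borel_measurable_integrable[OF iF[of "r i"]] by measurable
    qed
    also have "\<dots> \<le> liminf (\<lambda>i. ennreal (e m + e (r i)))"
    proof (intro Liminf_mono always_eventually allI)
      fix i
      have "(\<integral>\<^sup>+x. ennreal ((\<phi> m x - \<phi> (r i) x)\<^sup>2) \<partial>?M) = ennreal (LINT x|?M. (\<phi> m x - \<phi> (r i) x)\<^sup>2)"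
        using square_integrable_diff[OF sF sF, of m "r i"]
        by (intro nn_integral_eq_integral AE_I2) (auto simp: square_integrable_def)
      then show "(\<integral>\<^sup>+x. ennreal ((\<phi> m x - \<phi> (r i) x)\<^sup>2) \<partial>?M) \<le> ennreal (e m + e (r i))"
        using dist[of m "r i"] by (simp add: ennreal_leI)
    qed
    also have "\<dots> = ennreal (e m)"
    proof (rule lim_imp_Liminf)
      have "(\<lambda>i. ennreal (e m + e (r i))) \<longlonglongrightarrow> ennreal (e m + 0)"
        by (intro tendsto_ennrealI tendsto_add tendsto_const elim')
      then show "(\<lambda>i. ennreal (e m + e (r i))) \<longlonglongrightarrow> ennreal (e m)" by simp
    qed simp
    finally show ?thesis .
  qed
  have sd: "square_integrable ?M (\<lambda>x. \<phi> m x - g x)" for m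
  proof -
    have m: "(\<lambda>x. \<phi> m x - g x) \<in> borel_measurable ?M"
      using mg borel_measurable_integrable[OF iF] by (intro borel_measurable_diff)
    moreover have "(\<integral>\<^sup>+x. ennreal ((\<phi> m x - g x)\<^sup>2) \<partial>?M) < \<infinity>"
      using nn[of m] by (rule le_less_trans) simp
    ultimately show ?thesis
      unfolding square_integrable_def by (intro conjI integrableI_nonneg) auto
  qed
  have sg: "square_integrable ?M g"
    using square_integrable_diff[OF sF[of 0] sd[of 0]] by simp
  have "(LINT x|?M. (\<phi> m x - g x)\<^sup>2) \<le> e m" for m
  proof -
    have "ennreal (LINT x|?M. (\<phi> m x - g x)\<^sup>2) = (\<integral>\<^sup>+x. ennreal ((\<phi> m x - g x)\<^sup>2) \<partial>?M)"
      using sd[of m] by (intro nn_integral_eq_integral[symmetric] AE_I2) (auto simp: square_integrable_def)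
    then have "ennreal (LINT x|?M. (\<phi> m x - g x)\<^sup>2) \<le> ennreal (e m)" using nn[of m] by simp
    then show ?thesis using e0 by (simp add: ennreal_le_iff)
  qed
  then have "(\<lambda>m. LINT x|?M. (\<phi> m x - g x)\<^sup>2) \<longlonglongrightarrow> 0"
    by (intro tendsto_sandwich[OF _ _ tendsto_const elim] always_eventually allI) simp_all
  then show ?thesis
    unfolding is_trace_def using sg u \<phi> by blast
qed

section \<open>Sobolev spaces on an element\<close>

lemma square_integrable_subset:
  fixes u :: "'a::euclidean_space \<Rightarrow> real"
  assumes u: "square_integrable (lebesgue_on S) u" and sub: "S' \<subseteq> S" and m: "S' \<in> sets lebesgue" "S \<in> sets lebesgue"
  shows "square_integrable (lebesgue_on S') u"
proof -
  have eq: "lebesgue_on S' = restrict_space (lebesgue_on S) S'"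
    using sub by (simp add: restrict_restrict_space m Int_absorb1)
  have mS': "S' \<inter> space (lebesgue_on S) \<in> sets (lebesgue_on S)"
    using sub m by (simp add: sets_restrict_space_iff Int_absorb2)
  have mS'': "S' \<in> sets (lebesgue_on S)"
    using sub m by (simp add: sets_restrict_space_iff)
  have 1: "u \<in> borel_measurable (lebesgue_on S)" "integrable (lebesgue_on S) (\<lambda>x. (u x)\<^sup>2)"
    using u by (auto simp: square_integrable_def)
  have "u \<in> borel_measurable (lebesgue_on S')"
    unfolding eq by (rule measurable_restrict_space1[OF 1(1)])
  moreover have "integrable (lebesgue_on S') (\<lambda>x. (u x)\<^sup>2)"
    unfolding eq integrable_restrict_space[OF mS'] by (rule integrable_mult_indicator[OF mS'' 1(2)])
  ultimately show ?thesis by (simp add: square_integrable_def)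
qed

text \<open>A test function on the smaller set vanishes outside it together with its derivatives.\<close>

lemma weak_partial_subset:
  fixes u :: "'a::euclidean_space \<Rightarrow> real"
  assumes u: "weak_partial S b u g" and sub: "S' \<subseteq> S" and m: "S' \<in> sets lebesgue" "S \<in> sets lebesgue"
  shows "weak_partial S' b u g"
  unfolding weak_partial_def
proof (intro conjI allI impI)
  show "square_integrable (lebesgue_on S') u" "square_integrable (lebesgue_on S') g"
    using u square_integrable_subset[OF _ sub m] by (auto simp: weak_partial_def)
  fix \<phi> assume \<phi>: "test_function S' \<phi>"
  then have K: "closure {x. \<phi> x \<noteq> 0} \<subseteq> S'" by (simp add: test_function_def)
  have \<phi>0: "\<phi> x = 0" "partial_deriv \<phi> b x = 0" if "x \<notin> S'" for x
  proof -
    have "x \<notin> closure {x. \<phi> x \<noteq> 0}" using K that by blast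
    then show "partial_deriv \<phi> b x = 0" by (rule partial_deriv_eq_0)
    show "\<phi> x = 0" using \<open>x \<notin> closure {x. \<phi> x \<noteq> 0}\<close> closure_subset[of "{x. \<phi> x \<noteq> 0}"] by blast
  qed
  have mS: "S \<inter> space lebesgue \<in> sets lebesgue" and mS': "S' \<inter> space lebesgue \<in> sets lebesgue"
    using m by auto
  have eq: "(LINT x|lebesgue_on S. f x * k x) = (LINT x|lebesgue_on S'. f x * k x)"
    if "\<And>x. x \<notin> S' \<Longrightarrow> k x = 0" for f k :: "'a \<Rightarrow> real"
  proof -
    have "(\<lambda>x. indicator S x *\<^sub>R (f x * k x)) = (\<lambda>x. indicator S' x *\<^sub>R (f x * k x))"
    proof
      fix x
      show "indicator S x *\<^sub>R (f x * k x) = indicator S' x *\<^sub>R (f x * k x)"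
        using sub that[of x] by (cases "x \<in> S'") (auto simp: indicator_def)
    qed
    then show ?thesis
      unfolding integral_restrict_space[OF mS] integral_restrict_space[OF mS'] by (simp only:)
  qed
  have "test_function S \<phi>" using \<phi> sub by (auto simp: test_function_def)
  then have "(LINT x|lebesgue_on S. u x * partial_deriv \<phi> b x) = - (LINT x|lebesgue_on S. g x * \<phi> x)"
    using u by (simp add: weak_partial_def)
  moreover have "(LINT x|lebesgue_on S. u x * partial_deriv \<phi> b x) = (LINT x|lebesgue_on S'. u x * partial_deriv \<phi> b x)"
    by (rule eq[OF \<phi>0(2)])
  moreover have "(LINT x|lebesgue_on S. g x * \<phi> x) = (LINT x|lebesgue_on S'. g x * \<phi> x)"
    by (rule eq[OF \<phi>0(1)])
  ultimately show "(LINT x|lebesgue_on S'. u x * partial_deriv \<phi> b x) = - (LINT x|lebesgue_on S'. g x * \<phi> x)"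
    by (simp only:)
qed

lemma sobolev_subset:
  assumes "S' \<subseteq> S" "S' \<in> sets lebesgue" "S \<in> sets lebesgue"
  shows "u \<in> sobolev m S \<Longrightarrow> u \<in> sobolev m S'"
proof (induction m arbitrary: u)
  case 0
  then show ?case using square_integrable_subset[OF _ assms] by simp
next
  case (Suc m)
  have "square_integrable (lebesgue_on S') u"
    using Suc.prems square_integrable_subset[OF _ assms] by simp
  moreover have "\<exists>g\<in>sobolev m S'. weak_partial S' b u g" if b: "b \<in> Basis" for b
  proof -
    obtain g where "g \<in> sobolev m S" "weak_partial S b u g"
      using Suc.prems b by auto
    then show ?thesis using Suc.IH weak_partial_subset[OF _ assms] by blast
  qed
  ultimately show ?case by simp
qed

lemma sobolev_square_integrable: "u \<in> sobolev m S \<Longrightarrow> square_integrable (lebesgue_on S) u"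
  by (cases m) auto

lemma sobolev_add:
  assumes T: "convex_body T"
  shows "u \<in> sobolev m (interior T) \<Longrightarrow> v \<in> sobolev m (interior T) \<Longrightarrow> (\<lambda>x. u x + v x) \<in> sobolev m (interior T)"
proof (induction m arbitrary: u v)
  case 0
  then show ?case by (simp add: square_integrable_add)
next
  case (Suc m)
  have "\<exists>g\<in>sobolev m (interior T). weak_partial (interior T) b (\<lambda>x. u x + v x) g" if b: "b \<in> Basis" for b
  proof -
    obtain g where g: "g \<in> sobolev m (interior T)" "weak_partial (interior T) b u g"
      using Suc.prems(1) b by auto
    obtain h where h: "h \<in> sobolev m (interior T)" "weak_partial (interior T) b v h"
      using Suc.prems(2) b by auto
    from weak_partial_add[OF T b g(2) h(2)] Suc.IH[OF g(1) h(1)] show ?thesis by blast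
  qed
  moreover have "square_integrable (lebesgue_on (interior T)) (\<lambda>x. u x + v x)"
    using Suc.prems by (intro square_integrable_add sobolev_square_integrable)
  ultimately show ?case by simp
qed

lemma sobolev_cmult: "u \<in> sobolev m S \<Longrightarrow> (\<lambda>x. c * u x) \<in> sobolev m S"
proof (induction m arbitrary: u)
  case 0
  then show ?case by (simp add: square_integrable_cmult)
next
  case (Suc m)
  have "\<exists>g\<in>sobolev m S. weak_partial S b (\<lambda>x. c * u x) g" if b: "b \<in> Basis" for b
  proof -
    obtain g where "g \<in> sobolev m S" "weak_partial S b u g"
      using Suc.prems b by auto
    then show ?thesis using Suc.IH[of g] weak_partial_cmult[of S b u g c] by blast
  qed
  moreover have "square_integrable (lebesgue_on S) (\<lambda>x. c * u x)"
    using Suc.prems by (intro square_integrable_cmult sobolev_square_integrable)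
  ultimately show ?case by simp
qed

lemma smooth_sobolev:
  assumes T: "convex_body T"
  shows "smooth f \<Longrightarrow> f \<in> sobolev m (interior T)"
proof (induction m arbitrary: f)
  case 0
  then show ?case
    using square_integrable_smooth(1)[OF T] convex_body_square_integrable[OF T] by auto
next
  case (Suc m)
  have "\<exists>g\<in>sobolev m (interior T). weak_partial (interior T) b f g" if b: "b \<in> Basis" for b
    using smooth_weak_partial[OF Suc.prems T b] Suc.IH[OF smooth_partial[OF Suc.prems b]] by blast
  moreover have "square_integrable (lebesgue_on (interior T)) f"
    using square_integrable_smooth(1)[OF T Suc.prems] convex_body_square_integrable[OF T] by blast
  ultimately show ?case by simp
qed

lemma weak_partial_cong:
  assumes "\<And>x. x \<in> S \<Longrightarrow> u x = u' x"
  shows "weak_partial S b u g \<longleftrightarrow> weak_partial S b u' g"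
proof -
  have "square_integrable (lebesgue_on S) u \<longleftrightarrow> square_integrable (lebesgue_on S) u'"
    using assms by (intro square_integrable_cong) simp
  moreover have "(LINT x|lebesgue_on S. u x * k x) = (LINT x|lebesgue_on S. u' x * k x)" for k
    using assms by (intro Bochner_Integration.integral_cong) auto
  ultimately show ?thesis by (simp add: weak_partial_def)
qed

lemma weak_gradient_cong:
  assumes "\<And>x. x \<in> S \<Longrightarrow> u x = u' x"
  shows "weak_gradient S u = weak_gradient S u'"
proof -
  have "weak_partial S b u g \<longleftrightarrow> weak_partial S b u' g" for b g
    by (rule weak_partial_cong[OF assms])
  then show ?thesis by (simp add: weak_gradient_def fun_eq_iff)
qed

lemma sobolev_cong:
  assumes "\<And>x. x \<in> S \<Longrightarrow> u x = u' x"
  shows "u \<in> sobolev m S \<longleftrightarrow> u' \<in> sobolev m S"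
proof -
  have "square_integrable (lebesgue_on S) u \<longleftrightarrow> square_integrable (lebesgue_on S) u'"
    using assms by (intro square_integrable_cong) simp
  moreover have "weak_partial S b u g \<longleftrightarrow> weak_partial S b u' g" for b g
    by (rule weak_partial_cong[OF assms])
  ultimately show ?thesis by (cases m) simp_all
qed

text \<open>Weak partial derivatives, each with a property of its own, are assembled into one vector field.\<close>

lemma weak_gradient_from_partials:
  assumes "\<And>b. b \<in> Basis \<Longrightarrow> \<exists>g. P b g \<and> weak_partial S b u g"
  obtains G where "weak_gradient S u G" "\<And>b. b \<in> Basis \<Longrightarrow> P b (\<lambda>x. G x \<bullet> b)"
proof -
  obtain g where g: "\<And>b. b \<in> Basis \<Longrightarrow> P b (g b)" "\<And>b. b \<in> Basis \<Longrightarrow> weak_partial S b u (g b)"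
    using assms by metis
  define G where "G x = (\<Sum>b\<in>Basis. g b x *\<^sub>R b)" for x
  have "(\<lambda>x. G x \<bullet> b) = g b" if "b \<in> Basis" for b
    using that by (simp add: G_def fun_eq_iff inner_sum_left inner_Basis if_distrib cong: if_cong)
  then show thesis
    using that[of G] g by (simp add: weak_gradient_def)
qed

lemma sobolev1_weak_gradient:
  assumes "u \<in> sobolev (Suc m) S"
  shows "\<exists>G. weak_gradient S u G"
proof -
  have "\<exists>g. True \<and> weak_partial S b u g" if "b \<in> Basis" for b
    using assms that by auto
  then show ?thesis
    using weak_gradient_from_partials[of "\<lambda>b g. True" S u] by blast
qed

lemma sobolev2_weak_gradient:
  assumes "u \<in> sobolev 2 S"
  obtains G where "weak_gradient S u G" "\<And>b. b \<in> Basis \<Longrightarrow> (\<lambda>x. G x \<bullet> b) \<in> sobolev (Suc 0) S"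
proof -
  have "u \<in> sobolev (Suc (Suc 0)) S" using assms by (simp only: numeral_2_eq_2)
  then have "\<forall>b\<in>Basis. \<exists>g\<in>sobolev (Suc 0) S. weak_partial S b u g"
    unfolding sobolev.simps(2)[of "Suc 0"] by blast
  then have ex: "\<exists>g. g \<in> sobolev (Suc 0) S \<and> weak_partial S b u g" if "b \<in> Basis" for b
    using that by blast
  show thesis
  proof (rule weak_gradient_from_partials[of "\<lambda>b g. g \<in> sobolev (Suc 0) S" S u, OF ex])
    fix G assume G: "weak_gradient S u G" "\<And>b. b \<in> Basis \<Longrightarrow> (\<lambda>x. G x \<bullet> b) \<in> sobolev (Suc 0) S"
    show thesis by (rule that[OF G])
  qed
qed

lemma sobolev2_ex_weak_gradient:
  assumes "u \<in> sobolev 2 S"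
  shows "\<exists>G. weak_gradient S u G"
proof -
  obtain G where "weak_gradient S u G" by (rule sobolev2_weak_gradient[OF assms])
  then show ?thesis by blast
qed

section \<open>Elementwise operators\<close>

text \<open>From these two properties of a simplex it follows that it is a convex body and that its facets are
  cut out by supporting hyperplanes.\<close>

definition element :: "'a::euclidean_space set \<Rightarrow> bool" where
  "element T \<longleftrightarrow> polytope T \<and> interior T \<noteq> {}"

lemma element_convex_body: "element T \<Longrightarrow> convex_body T"
  by (simp add: element_def convex_body_def polytope_imp_compact polytope_imp_convex)

lemma element_body_facet:
  assumes T: "element T" and F: "F facet_of T"
  shows "body_facet T F"
proof -
  note cb = element_convex_body[OF T]
  obtain c where "supports (outer_normal T F) c T F"
    using outer_normal_supports[OF _ _ F] T by (auto simp: element_def)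
  then show ?thesis
    using cb facet_compact[OF cb F] F by (auto simp: body_facet_def facet_of_def)
qed

lemma weak_gradient_grad:
  assumes "\<exists>G. weak_gradient (interior T) u G"
  shows "weak_gradient (interior T) u (grad T u)"
  unfolding grad_def using assms by (rule someI_ex)

lemma grad_eq_AE:
  assumes "convex_body T" "weak_gradient (interior T) u G"
  shows "AE x in lebesgue_on T. grad T u x = G x"
  using weak_gradient_unique[OF assms(1) weak_gradient_grad assms(2)] assms(2) by blast

lemma facet_trace_is_trace:
  assumes "body_facet T F" "\<exists>G. weak_gradient (interior T) u G"
  shows "is_trace T F u (facet_trace T F u)"
proof -
  have "\<exists>g. is_trace T F u g"
    using assms is_trace_exists by blast
  then show ?thesis
    unfolding facet_trace_def by (rule someI_ex)
qed

lemma facet_trace_eq_AE: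
  assumes "body_facet T F" "is_trace T F u g"
  shows "AE x in facet_measure T F. facet_trace T F u x = g x"
proof -
  have "is_trace T F u (facet_trace T F u)"
    unfolding facet_trace_def using assms(2) by (rule someI[of "is_trace T F u"])
  then show ?thesis
    by (rule is_trace_unique[OF assms(1) _ assms(2)])
qed

text \<open>The components of the gradient of an \<open>H\<^sup>2\<close> function are in \<open>H\<^sup>1\<close> and have traces.\<close>

lemma is_gradient_trace_exists:
  fixes T :: "'a::euclidean_space set"
  assumes TF: "body_facet T F" and u: "u \<in> sobolev 2 (interior T)"
  shows "\<exists>N. is_gradient_trace T F u N"
proof -
  obtain G where G: "weak_gradient (interior T) u G" "\<And>b. b \<in> Basis \<Longrightarrow> (\<lambda>x. G x \<bullet> b) \<in> sobolev (Suc 0) (interior T)"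
    using sobolev2_weak_gradient[OF u] by blast
  have "\<exists>g. is_trace T F (\<lambda>x. G x \<bullet> b) g" if "b \<in> Basis" for b
    using sobolev1_weak_gradient[OF G(2)[OF that]] is_trace_exists[OF TF] by blast
  then obtain g where g: "\<And>b. b \<in> Basis \<Longrightarrow> is_trace T F (\<lambda>x. G x \<bullet> b) (g b)" by metis
  define N where "N x = (\<Sum>b\<in>Basis. g b x *\<^sub>R b)" for x
  have "(\<lambda>x. N x \<bullet> b) = g b" if "b \<in> Basis" for b
    using that by (simp add: N_def fun_eq_iff inner_sum_left inner_Basis if_distrib cong: if_cong)
  then have "is_gradient_trace T F u N"
    unfolding is_gradient_trace_def using G(1) g by metis
  then show ?thesis by blast
qed

lemma is_gradient_trace_unique:
  fixes T :: "'a::euclidean_space set"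
  assumes TF: "body_facet T F" and N: "is_gradient_trace T F u N" "is_gradient_trace T F u N'"
  shows "AE x in facet_measure T F. N x = N' x"
proof (rule AE_inner_Basis_imp_AE_eq)
  fix b :: 'a assume b: "b \<in> Basis"
  note T = body_facetD(1)[OF TF]
  obtain G where G: "weak_gradient (interior T) u G" "is_trace T F (\<lambda>x. G x \<bullet> b) (\<lambda>x. N x \<bullet> b)"
    using N(1) b unfolding is_gradient_trace_def by blast
  obtain G' where G': "weak_gradient (interior T) u G'" "is_trace T F (\<lambda>x. G' x \<bullet> b) (\<lambda>x. N' x \<bullet> b)"
    using N(2) b unfolding is_gradient_trace_def by blast
  have "AE x in lebesgue_on T. G x \<bullet> b = G' x \<bullet> b"
    using weak_gradient_unique[OF T G(1) G'(1)] by (rule eventually_mono) simp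
  from is_trace_cong_AE[OF T G(2) weak_gradient_square_integrable(2)[OF T G'(1) b] this]
  have "is_trace T F (\<lambda>x. G' x \<bullet> b) (\<lambda>x. N x \<bullet> b)" .
  from is_trace_unique[OF TF this G'(2)] show "AE x in facet_measure T F. N x \<bullet> b = N' x \<bullet> b" .
qed

lemma is_gradient_trace_add:
  fixes T :: "'a::euclidean_space set"
  assumes TF: "body_facet T F" and N: "is_gradient_trace T F u N" "is_gradient_trace T F v N'"
  shows "is_gradient_trace T F (\<lambda>x. u x + v x) (\<lambda>x. N x + N' x)"
proof -
  note T = body_facetD(1)[OF TF]
  obtain G where G: "weak_gradient (interior T) u G" "\<And>b. b \<in> Basis \<Longrightarrow> is_trace T F (\<lambda>x. G x \<bullet> b) (\<lambda>x. N x \<bullet> b)"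
    using N(1) unfolding is_gradient_trace_def by blast
  obtain G' where G': "weak_gradient (interior T) v G'" "\<And>b. b \<in> Basis \<Longrightarrow> is_trace T F (\<lambda>x. G' x \<bullet> b) (\<lambda>x. N' x \<bullet> b)"
    using N(2) unfolding is_gradient_trace_def by blast
  show ?thesis
    unfolding is_gradient_trace_def inner_add_left
    using weak_gradient_add[OF T G(1) G'(1)] is_trace_add[OF TF G(2) G'(2)]
    by (intro exI[of _ "\<lambda>x. G x + G' x"]) (simp add: inner_add_left)
qed

lemma is_gradient_trace_cmult:
  fixes T :: "'a::euclidean_space set"
  assumes TF: "body_facet T F" and N: "is_gradient_trace T F u N"
  shows "is_gradient_trace T F (\<lambda>x. c * u x) (\<lambda>x. c *\<^sub>R N x)"
proof -
  obtain G where G: "weak_gradient (interior T) u G" "\<And>b. b \<in> Basis \<Longrightarrow> is_trace T F (\<lambda>x. G x \<bullet> b) (\<lambda>x. N x \<bullet> b)"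
    using N unfolding is_gradient_trace_def by blast
  show ?thesis
    unfolding is_gradient_trace_def
    using weak_gradient_cmult[OF G(1), of c] is_trace_cmult[OF TF G(2), of _ c]
    by (intro exI[of _ "\<lambda>x. c *\<^sub>R G x"]) simp
qed

lemma is_trace_smooth:
  assumes TF: "body_facet T F" and f: "smooth f"
  shows "is_trace T F f f"
  unfolding is_trace_def
  using smooth_weak_gradient[OF f body_facetD(1)[OF TF]] f body_facetD(4)[OF TF smooth_continuous[OF f]]
  by (intro conjI exI[of _ "cgrad f"] exI[of _ "\<lambda>m::nat. f"]) auto

lemma is_gradient_trace_smooth:
  assumes TF: "body_facet T F" and f: "smooth f"
  shows "is_gradient_trace T F f (cgrad f)"
  unfolding is_gradient_trace_def
  using smooth_weak_gradient[OF f body_facetD(1)[OF TF]] is_trace_smooth[OF TF smooth_partial[OF f]]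
  by (intro exI[of _ "cgrad f"]) auto

text \<open>The choice made inside \<open>normal_deriv\<close>.\<close>

definition gradient_trace :: "'a::euclidean_space set \<Rightarrow> 'a set \<Rightarrow> ('a \<Rightarrow> real) \<Rightarrow> 'a \<Rightarrow> 'a" where
  "gradient_trace T F u = (SOME N. is_gradient_trace T F u N)"

lemma normal_deriv_gradient_trace: "normal_deriv T F u x = gradient_trace T F u x \<bullet> outer_normal T F"
  by (simp add: normal_deriv_def gradient_trace_def)

lemma gradient_trace_eq_AE:
  assumes "body_facet T F" "is_gradient_trace T F u N"
  shows "AE x in facet_measure T F. gradient_trace T F u x = N x"
proof -
  have "is_gradient_trace T F u (gradient_trace T F u)"
    unfolding gradient_trace_def using assms(2) by (rule someI[of "is_gradient_trace T F u"])
  then show ?thesis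
    by (rule is_gradient_trace_unique[OF assms(1) _ assms(2)])
qed

lemma normal_deriv_eq_AE:
  assumes "body_facet T F" "is_gradient_trace T F u N"
  shows "AE x in facet_measure T F. normal_deriv T F u x = N x \<bullet> outer_normal T F"
  unfolding normal_deriv_gradient_trace
  using gradient_trace_eq_AE[OF assms] by (rule eventually_mono) simp

context
  fixes T F :: "'a::euclidean_space set"
  assumes TF: "body_facet T F"
begin

lemma square_integrable_facet_trace:
  assumes "u \<in> sobolev 2 (interior T)"
  shows "square_integrable (facet_measure T F) (facet_trace T F u)"
  using facet_trace_is_trace[OF TF sobolev2_ex_weak_gradient[OF assms]] by (simp add: is_trace_def)

lemma square_integrable_normal_deriv:
  assumes "u \<in> sobolev 2 (interior T)"
  shows "square_integrable (facet_measure T F) (normal_deriv T F u)"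
proof -
  have "is_gradient_trace T F u (gradient_trace T F u)"
    unfolding gradient_trace_def using is_gradient_trace_exists[OF TF assms] by (rule someI_ex)
  then have "square_integrable (facet_measure T F) (\<lambda>x. gradient_trace T F u x \<bullet> b)" if "b \<in> Basis" for b
    using that by (auto simp: is_gradient_trace_def is_trace_def)
  then have "square_integrable (facet_measure T F) (\<lambda>x. \<Sum>b\<in>Basis. (outer_normal T F \<bullet> b) * (gradient_trace T F u x \<bullet> b))"
    by (intro square_integrable_sum square_integrable_cmult)
  also have "(\<lambda>x. \<Sum>b\<in>Basis. (outer_normal T F \<bullet> b) * (gradient_trace T F u x \<bullet> b)) = normal_deriv T F u"
    unfolding normal_deriv_gradient_trace fun_eq_iff by (subst (3) euclidean_inner) (simp add: mult.commute)
  finally show ?thesis .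
qed

lemma facet_trace_add:
  assumes "u \<in> sobolev 2 (interior T)" "v \<in> sobolev 2 (interior T)"
  shows "AE x in facet_measure T F. facet_trace T F (\<lambda>x. u x + v x) x = facet_trace T F u x + facet_trace T F v x"
  by (intro facet_trace_eq_AE[OF TF] is_trace_add[OF TF] facet_trace_is_trace[OF TF] sobolev2_ex_weak_gradient assms)

lemma facet_trace_cmult:
  assumes "u \<in> sobolev 2 (interior T)"
  shows "AE x in facet_measure T F. facet_trace T F (\<lambda>x. c * u x) x = c * facet_trace T F u x"
  by (intro facet_trace_eq_AE[OF TF] is_trace_cmult[OF TF] facet_trace_is_trace[OF TF] sobolev2_ex_weak_gradient assms)

lemma normal_deriv_add:
  assumes "u \<in> sobolev 2 (interior T)" "v \<in> sobolev 2 (interior T)"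
  shows "AE x in facet_measure T F. normal_deriv T F (\<lambda>x. u x + v x) x = normal_deriv T F u x + normal_deriv T F v x"
proof -
  have "is_gradient_trace T F w (gradient_trace T F w)" if "w \<in> sobolev 2 (interior T)" for w
    unfolding gradient_trace_def using is_gradient_trace_exists[OF TF that] by (rule someI_ex)
  from normal_deriv_eq_AE[OF TF is_gradient_trace_add[OF TF this[OF assms(1)] this[OF assms(2)]]]
  show ?thesis by (simp add: inner_add_left normal_deriv_gradient_trace)
qed

lemma normal_deriv_cmult:
  assumes "u \<in> sobolev 2 (interior T)"
  shows "AE x in facet_measure T F. normal_deriv T F (\<lambda>x. c * u x) x = c * normal_deriv T F u x"
proof -
  have "is_gradient_trace T F u (gradient_trace T F u)"
    unfolding gradient_trace_def using is_gradient_trace_exists[OF TF assms] by (rule someI_ex)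
  from normal_deriv_eq_AE[OF TF is_gradient_trace_cmult[OF TF this]]
  show ?thesis by (simp add: normal_deriv_gradient_trace)
qed

end

subsection \<open>The elementwise bilinear forms\<close>

lemma set_integrable_mult:
  assumes "square_integrable M f" "square_integrable M g" "A \<in> sets M"
  shows "set_integrable M A (\<lambda>x. f x * g x)"
  unfolding set_integrable_def
  by (rule integrable_mult_indicator[OF assms(3) square_integrable_mult[OF assms(1,2)]])

lemma set_integral_mult_add:
  fixes f f1 f2 g :: "_ \<Rightarrow> real"
  assumes sq: "square_integrable M f" "square_integrable M f1" "square_integrable M f2" "square_integrable M g"
    and A: "A \<in> sets M" and eq: "AE x in M. f x = f1 x + f2 x"
  shows "(LINT x:A|M. f x * g x) = (LINT x:A|M. f1 x * g x) + (LINT x:A|M. f2 x * g x)"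
proof -
  note s = set_integrable_mult[OF sq(1,4) A] set_integrable_mult[OF sq(2,4) A] set_integrable_mult[OF sq(3,4) A]
  have "(LINT x:A|M. f x * g x) = (LINT x:A|M. f1 x * g x + f2 x * g x)"
    unfolding set_lebesgue_integral_def
  proof (rule integral_cong_AE)
    show "(\<lambda>x. indicator A x *\<^sub>R (f x * g x)) \<in> borel_measurable M"
      using s(1) unfolding set_integrable_def by (rule borel_measurable_integrable)
    show "(\<lambda>x. indicator A x *\<^sub>R (f1 x * g x + f2 x * g x)) \<in> borel_measurable M"
      using set_integral_add(1)[OF s(2,3)] unfolding set_integrable_def by (rule borel_measurable_integrable)
    show "AE x in M. indicator A x *\<^sub>R (f x * g x) = indicator A x *\<^sub>R (f1 x * g x + f2 x * g x)"
      using eq by (rule eventually_mono) (simp add: distrib_right)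
  qed
  also have "\<dots> = (LINT x:A|M. f1 x * g x) + (LINT x:A|M. f2 x * g x)"
    by (rule set_integral_add(2)[OF s(2,3)])
  finally show ?thesis .
qed

lemma set_integral_mult_cmult:
  fixes f f1 g :: "_ \<Rightarrow> real"
  assumes sq: "square_integrable M f" "square_integrable M f1" "square_integrable M g"
    and A: "A \<in> sets M" and eq: "AE x in M. f x = c * f1 x"
  shows "(LINT x:A|M. f x * g x) = c * (LINT x:A|M. f1 x * g x)"
proof -
  note s = set_integrable_mult[OF sq(1,3) A] set_integrable_mult[OF sq(2,3) A]
  have "(LINT x:A|M. f x * g x) = (LINT x:A|M. c * (f1 x * g x))"
    unfolding set_lebesgue_integral_def
  proof (rule integral_cong_AE)
    show "(\<lambda>x. indicator A x *\<^sub>R (f x * g x)) \<in> borel_measurable M"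
      using s(1) unfolding set_integrable_def by (rule borel_measurable_integrable)
    show "(\<lambda>x. indicator A x *\<^sub>R (c * (f1 x * g x))) \<in> borel_measurable M"
      using set_integrable_mult_right[OF s(2)] unfolding set_integrable_def by (rule borel_measurable_integrable)
    show "AE x in M. indicator A x *\<^sub>R (f x * g x) = indicator A x *\<^sub>R (c * (f1 x * g x))"
      using eq by (rule eventually_mono) simp
  qed
  then show ?thesis by simp
qed

lemma facet_frontier_sets: "body_facet T F \<Longrightarrow> F \<inter> frontier \<Omega> \<in> sets (facet_measure T F)"
  using body_facetD(2)[of T F]
  by (auto simp: sets_facet_measure sets_restrict_space image_iff intro!: bexI[of _ "frontier \<Omega>"])

text \<open>The contribution of one element to the penalty term, without the factor \<open>1 / h\<close>.\<close>

definition Ns_elem :: "'a::euclidean_space set \<Rightarrow> 'a set \<Rightarrow> ('a \<Rightarrow> real) \<Rightarrow> ('a \<Rightarrow> real) \<Rightarrow> real" where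
  "Ns_elem \<Omega> T u v = boundary_integral \<Omega> T (\<lambda>F x. facet_trace T F u x * facet_trace T F v x)"

lemma Ns_form_eq: "Ns_form \<Omega> \<T> h u v = 1 / h * (\<Sum>T\<in>\<T>. Ns_elem \<Omega> T u v)"
  by (simp add: Ns_form_def Ns_elem_def)

lemma Ns_elem_commute: "Ns_elem \<Omega> T u v = Ns_elem \<Omega> T v u"
  by (simp add: Ns_elem_def mult.commute)

lemma Ns_elem_nonneg: "Ns_elem \<Omega> T u u \<ge> 0"
  unfolding Ns_elem_def boundary_integral_def set_lebesgue_integral_def
  by (intro sum_nonneg integral_nonneg_AE AE_I2) (simp add: indicator_def)

context
  fixes T :: "'a::euclidean_space set" and \<Omega> :: "'a set" and u v w :: "'a \<Rightarrow> real"
  assumes T: "element T"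
    and u: "u \<in> sobolev 2 (interior T)" and v: "v \<in> sobolev 2 (interior T)" and w: "w \<in> sobolev 2 (interior T)"
begin

lemma uv_sobolev: "(\<lambda>x. u x + v x) \<in> sobolev 2 (interior T)" and cu_sobolev: "(\<lambda>x. c * u x) \<in> sobolev 2 (interior T)"
  by (rule sobolev_add[OF element_convex_body[OF T] u v]) (rule sobolev_cmult[OF u])

lemma Ns_elem_add_left: "Ns_elem \<Omega> T (\<lambda>x. u x + v x) w = Ns_elem \<Omega> T u w + Ns_elem \<Omega> T v w"
  unfolding Ns_elem_def boundary_integral_def sum.distrib[symmetric]
proof (rule sum.cong[OF refl])
  fix F assume "F \<in> {F. F facet_of T}"
  then have TF: "body_facet T F" using element_body_facet[OF T] by simp
  show "(LINT x:F \<inter> frontier \<Omega>|facet_measure T F. facet_trace T F (\<lambda>x. u x + v x) x * facet_trace T F w x)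
      = (LINT x:F \<inter> frontier \<Omega>|facet_measure T F. facet_trace T F u x * facet_trace T F w x)
      + (LINT x:F \<inter> frontier \<Omega>|facet_measure T F. facet_trace T F v x * facet_trace T F w x)"
    by (intro set_integral_mult_add square_integrable_facet_trace[OF TF] facet_trace_add[OF TF] facet_frontier_sets[OF TF] u v w uv_sobolev)
qed

lemma Ns_elem_cmult_left: "Ns_elem \<Omega> T (\<lambda>x. c * u x) w = c * Ns_elem \<Omega> T u w"
  unfolding Ns_elem_def boundary_integral_def sum_distrib_left
proof (rule sum.cong[OF refl])
  fix F assume "F \<in> {F. F facet_of T}"
  then have TF: "body_facet T F" using element_body_facet[OF T] by simp
  show "(LINT x:F \<inter> frontier \<Omega>|facet_measure T F. facet_trace T F (\<lambda>x. c * u x) x * facet_trace T F w x)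
      = c * (LINT x:F \<inter> frontier \<Omega>|facet_measure T F. facet_trace T F u x * facet_trace T F w x)"
    by (intro set_integral_mult_cmult square_integrable_facet_trace[OF TF] facet_trace_cmult[OF TF] facet_frontier_sets[OF TF] u w cu_sobolev)
qed

lemma set_integral_uminus_mult: "(LINT x:A|M. - f x * g x) = - (LINT x:A|M. f x * (g x :: real))"
  by (simp add: set_lebesgue_integral_def)

lemma Nc_elem_add_left: "Nc_elem \<Omega> T (\<lambda>x. u x + v x) w = Nc_elem \<Omega> T u w + Nc_elem \<Omega> T v w"
  unfolding Nc_elem_def boundary_integral_def sum.distrib[symmetric] set_integral_uminus_mult
proof (rule sum.cong[OF refl])
  fix F assume "F \<in> {F. F facet_of T}"
  then have TF: "body_facet T F" using element_body_facet[OF T] by simp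
  have "(LINT x:F \<inter> frontier \<Omega>|facet_measure T F. normal_deriv T F (\<lambda>x. u x + v x) x * facet_trace T F w x)
      = (LINT x:F \<inter> frontier \<Omega>|facet_measure T F. normal_deriv T F u x * facet_trace T F w x)
      + (LINT x:F \<inter> frontier \<Omega>|facet_measure T F. normal_deriv T F v x * facet_trace T F w x)"
    by (intro set_integral_mult_add square_integrable_normal_deriv[OF TF] square_integrable_facet_trace[OF TF]
        normal_deriv_add[OF TF] facet_frontier_sets[OF TF] u v w uv_sobolev)
  then show "- (LINT x:F \<inter> frontier \<Omega>|facet_measure T F. normal_deriv T F (\<lambda>x. u x + v x) x * facet_trace T F w x)
      = - (LINT x:F \<inter> frontier \<Omega>|facet_measure T F. normal_deriv T F u x * facet_trace T F w x)
      + - (LINT x:F \<inter> frontier \<Omega>|facet_measure T F. normal_deriv T F v x * facet_trace T F w x)"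
    by simp
qed

lemma Nc_elem_cmult_left: "Nc_elem \<Omega> T (\<lambda>x. c * u x) w = c * Nc_elem \<Omega> T u w"
  unfolding Nc_elem_def boundary_integral_def sum_distrib_left set_integral_uminus_mult
proof (rule sum.cong[OF refl])
  fix F assume "F \<in> {F. F facet_of T}"
  then have TF: "body_facet T F" using element_body_facet[OF T] by simp
  have "(LINT x:F \<inter> frontier \<Omega>|facet_measure T F. normal_deriv T F (\<lambda>x. c * u x) x * facet_trace T F w x)
      = c * (LINT x:F \<inter> frontier \<Omega>|facet_measure T F. normal_deriv T F u x * facet_trace T F w x)"
    by (intro set_integral_mult_cmult square_integrable_normal_deriv[OF TF] square_integrable_facet_trace[OF TF]
        normal_deriv_cmult[OF TF] facet_frontier_sets[OF TF] u w cu_sobolev)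
  then show "- (LINT x:F \<inter> frontier \<Omega>|facet_measure T F. normal_deriv T F (\<lambda>x. c * u x) x * facet_trace T F w x)
      = c * - (LINT x:F \<inter> frontier \<Omega>|facet_measure T F. normal_deriv T F u x * facet_trace T F w x)"
    by simp
qed

lemma Nc_elem_add_right: "Nc_elem \<Omega> T w (\<lambda>x. u x + v x) = Nc_elem \<Omega> T w u + Nc_elem \<Omega> T w v"
  unfolding Nc_elem_def boundary_integral_def sum.distrib[symmetric] set_integral_uminus_mult
proof (rule sum.cong[OF refl])
  fix F assume "F \<in> {F. F facet_of T}"
  then have TF: "body_facet T F" using element_body_facet[OF T] by simp
  have "(LINT x:F \<inter> frontier \<Omega>|facet_measure T F. facet_trace T F (\<lambda>x. u x + v x) x * normal_deriv T F w x)
      = (LINT x:F \<inter> frontier \<Omega>|facet_measure T F. facet_trace T F u x * normal_deriv T F w x)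
      + (LINT x:F \<inter> frontier \<Omega>|facet_measure T F. facet_trace T F v x * normal_deriv T F w x)"
    by (intro set_integral_mult_add square_integrable_normal_deriv[OF TF] square_integrable_facet_trace[OF TF]
        facet_trace_add[OF TF] facet_frontier_sets[OF TF] u v w uv_sobolev)
  then show "- (LINT x:F \<inter> frontier \<Omega>|facet_measure T F. normal_deriv T F w x * facet_trace T F (\<lambda>x. u x + v x) x)
      = - (LINT x:F \<inter> frontier \<Omega>|facet_measure T F. normal_deriv T F w x * facet_trace T F u x)
      + - (LINT x:F \<inter> frontier \<Omega>|facet_measure T F. normal_deriv T F w x * facet_trace T F v x)"
    by (simp add: mult.commute[of "normal_deriv T F w _"])
qed

lemma Nc_elem_cmult_right: "Nc_elem \<Omega> T w (\<lambda>x. c * u x) = c * Nc_elem \<Omega> T w u"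
  unfolding Nc_elem_def boundary_integral_def sum_distrib_left set_integral_uminus_mult
proof (rule sum.cong[OF refl])
  fix F assume "F \<in> {F. F facet_of T}"
  then have TF: "body_facet T F" using element_body_facet[OF T] by simp
  have "(LINT x:F \<inter> frontier \<Omega>|facet_measure T F. facet_trace T F (\<lambda>x. c * u x) x * normal_deriv T F w x)
      = c * (LINT x:F \<inter> frontier \<Omega>|facet_measure T F. facet_trace T F u x * normal_deriv T F w x)"
    by (intro set_integral_mult_cmult square_integrable_normal_deriv[OF TF] square_integrable_facet_trace[OF TF]
        facet_trace_cmult[OF TF] facet_frontier_sets[OF TF] u w cu_sobolev)
  then show "- (LINT x:F \<inter> frontier \<Omega>|facet_measure T F. normal_deriv T F w x * facet_trace T F (\<lambda>x. c * u x) x)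
      = c * - (LINT x:F \<inter> frontier \<Omega>|facet_measure T F. normal_deriv T F w x * facet_trace T F u x)"
    by (simp add: mult.commute[of "normal_deriv T F w _"])
qed

end

lemma a_elem_commute: "a_elem T u v = a_elem T v u"
  by (simp add: a_elem_def inner_commute)

lemma a_elem_nonneg: "a_elem T u u \<ge> 0"
  unfolding a_elem_def by (intro integral_nonneg_AE AE_I2) simp

lemma integrable_weak_gradient_inner:
  fixes T :: "'a::euclidean_space set"
  assumes T: "convex_body T" and G: "weak_gradient (interior T) u G" and H: "weak_gradient (interior T) v H"
  shows "integrable (lebesgue_on T) (\<lambda>x. G x \<bullet> H x)"
proof -
  have "integrable (lebesgue_on T) (\<lambda>x. \<Sum>b\<in>Basis. (G x \<bullet> b) * (H x \<bullet> b))"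
    by (intro Bochner_Integration.integrable_sum square_integrable_mult
        weak_gradient_square_integrable(2)[OF T G] weak_gradient_square_integrable(2)[OF T H])
  also have "(\<lambda>x. \<Sum>b\<in>Basis. (G x \<bullet> b) * (H x \<bullet> b)) = (\<lambda>x. G x \<bullet> H x)"
    by (rule ext, rule euclidean_inner[symmetric])
  finally show ?thesis .
qed

lemma a_elem_eq:
  fixes T :: "'a::euclidean_space set"
  assumes T: "convex_body T" and G: "weak_gradient (interior T) u G" and H: "weak_gradient (interior T) v H"
  shows "a_elem T u v = (LINT x|lebesgue_on T. G x \<bullet> H x)"
  unfolding a_elem_def
proof (rule integral_cong_AE)
  have g: "weak_gradient (interior T) u (grad T u)" "weak_gradient (interior T) v (grad T v)"
    using weak_gradient_grad G H by blast+
  show "(\<lambda>x. grad T u x \<bullet> grad T v x) \<in> borel_measurable (lebesgue_on T)"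
    by (rule borel_measurable_integrable[OF integrable_weak_gradient_inner[OF T g]])
  show "(\<lambda>x. G x \<bullet> H x) \<in> borel_measurable (lebesgue_on T)"
    by (rule borel_measurable_integrable[OF integrable_weak_gradient_inner[OF T G H]])
  show "AE x in lebesgue_on T. grad T u x \<bullet> grad T v x = G x \<bullet> H x"
    using grad_eq_AE[OF T G] grad_eq_AE[OF T H] by (rule eventually_elim2) simp
qed

lemma a_elem_add_left:
  fixes T :: "'a::euclidean_space set"
  assumes T: "convex_body T" and G: "weak_gradient (interior T) u G" and H: "weak_gradient (interior T) v H"
    and K: "weak_gradient (interior T) w K"
  shows "a_elem T (\<lambda>x. u x + v x) w = a_elem T u w + a_elem T v w"
  unfolding a_elem_eq[OF T weak_gradient_add[OF T G H] K] a_elem_eq[OF T G K] a_elem_eq[OF T H K] inner_add_left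
  by (rule Bochner_Integration.integral_add[OF integrable_weak_gradient_inner[OF T G K] integrable_weak_gradient_inner[OF T H K]])

lemma a_elem_cmult_left:
  fixes T :: "'a::euclidean_space set"
  assumes T: "convex_body T" and G: "weak_gradient (interior T) u G" and K: "weak_gradient (interior T) w K"
  shows "a_elem T (\<lambda>x. c * u x) w = c * a_elem T u w"
  unfolding a_elem_eq[OF T weak_gradient_cmult[OF G] K] a_elem_eq[OF T G K] by simp

subsection \<open>Independence of the representative\<close>

text \<open>Functions that agree almost everywhere have the same weak gradients and traces as predicates, so even
  the representatives that are chosen from them coincide.\<close>

lemma weak_gradient_eq_of_AE:
  assumes T: "convex_body T" and u: "square_integrable (lebesgue_on T) u" "square_integrable (lebesgue_on T) u'"
    and eq: "AE x in lebesgue_on T. u x = u' x"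
  shows "weak_gradient (interior T) u = weak_gradient (interior T) u'"
proof
  fix G
  have eq': "AE x in lebesgue_on T. u' x = u x"
    using eq by (rule eventually_mono) simp
  show "weak_gradient (interior T) u G = weak_gradient (interior T) u' G"
    using weak_gradient_cong_AE[OF T _ u(2) eq] weak_gradient_cong_AE[OF T _ u(1) eq'] by blast
qed

lemma is_trace_eq_of_AE:
  fixes T :: "'a::euclidean_space set"
  assumes T: "convex_body T" and u: "square_integrable (lebesgue_on T) u" "square_integrable (lebesgue_on T) u'"
    and eq: "AE x in lebesgue_on T. u x = u' x"
  shows "is_trace T F u = is_trace T F u'"
proof
  fix g
  have eq': "AE x in lebesgue_on T. u' x = u x"
    using eq by (rule eventually_mono) simp
  show "is_trace T F u g = is_trace T F u' g"
    using is_trace_cong_AE[OF T _ u(2) eq] is_trace_cong_AE[OF T _ u(1) eq'] by blast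
qed

section \<open>Polynomials\<close>

definition monomial_fun :: "('a::euclidean_space \<Rightarrow> nat) \<Rightarrow> 'a \<Rightarrow> real" where
  "monomial_fun \<alpha> x = (\<Prod>b\<in>Basis. (x \<bullet> b) ^ \<alpha> b)"

text \<open>Polynomials are handled through their coefficients, so that the space of coefficients provides the
  finite-dimensional vector space for \<open>riesz_finite\<close>.\<close>

definition poly_of :: "nat \<Rightarrow> (('a::euclidean_space \<Rightarrow> nat) \<Rightarrow> real) \<Rightarrow> 'a \<Rightarrow> real" where
  "poly_of k c x = (\<Sum>\<alpha>\<in>multi_indices k. c \<alpha> * monomial_fun \<alpha> x)"

lemma polys_eq: "polys k = range (poly_of k)"
  by (auto simp: polys_def poly_of_def[abs_def] monomial_fun_def fun_eq_iff)

lemma poly_of_add: "poly_of k (\<lambda>\<alpha>. c \<alpha> + d \<alpha>) = (\<lambda>x. poly_of k c x + poly_of k d x)"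
  by (simp add: poly_of_def fun_eq_iff distrib_right sum.distrib)

lemma poly_of_cmult: "poly_of k (\<lambda>\<alpha>. t * c \<alpha>) = (\<lambda>x. t * poly_of k c x)"
  by (simp add: poly_of_def fun_eq_iff sum_distrib_left mult.assoc)

lemma smooth_poly_of: "smooth (poly_of k c)"
  unfolding poly_of_def[abs_def] monomial_fun_def
  by (intro smooth_sum smooth_cmult smooth_prod smooth_power smooth_inner)

lemma polys_smooth: "p \<in> polys k \<Longrightarrow> smooth p"
  by (auto simp: polys_eq smooth_poly_of)

lemma polys_add: "p \<in> polys k \<Longrightarrow> q \<in> polys k \<Longrightarrow> (\<lambda>x. p x + q x) \<in> polys k"
  by (auto simp: polys_eq poly_of_add[symmetric])

lemma polys_cmult: "p \<in> polys k \<Longrightarrow> (\<lambda>x. t * p x) \<in> polys k"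
  by (auto simp: polys_eq poly_of_cmult[symmetric])

lemma finite_multi_indices: "finite (multi_indices k :: ('a::euclidean_space \<Rightarrow> nat) set)"
proof (rule finite_subset)
  show "(multi_indices k :: ('a \<Rightarrow> nat) set) \<subseteq> {f. \<forall>x. (x \<in> Basis \<longrightarrow> f x \<in> {..k}) \<and> (x \<notin> Basis \<longrightarrow> f x = 0)}"
  proof
    fix \<alpha> :: "'a \<Rightarrow> nat" assume \<alpha>: "\<alpha> \<in> multi_indices k"
    have "\<alpha> b \<le> k" if "b \<in> Basis" for b
    proof -
      have "\<alpha> b \<le> (\<Sum>b\<in>Basis. \<alpha> b)" using that by (intro member_le_sum) auto
      then show ?thesis using \<alpha> by (simp add: multi_indices_def)
    qed
    then show "\<alpha> \<in> {f. \<forall>x. (x \<in> Basis \<longrightarrow> f x \<in> {..k}) \<and> (x \<notin> Basis \<longrightarrow> f x = 0)}"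
      using \<alpha> by (simp add: multi_indices_def)
  qed
  show "finite {f. \<forall>x::'a. (x \<in> Basis \<longrightarrow> f x \<in> {..k}) \<and> (x \<notin> Basis \<longrightarrow> f x = 0)}"
    by (rule finite_set_of_finite_funs) auto
qed

lemma polys_const: "(\<lambda>x::'a::euclidean_space. a) \<in> polys k"
proof -
  let ?z = "\<lambda>_::'a. 0::nat"
  have z: "?z \<in> multi_indices k" by (simp add: multi_indices_def)
  have "poly_of k (\<lambda>\<alpha>. if \<alpha> = ?z then a else 0) x = a" for x :: 'a
  proof -
    have "poly_of k (\<lambda>\<alpha>. if \<alpha> = ?z then a else 0) x
        = (\<Sum>\<alpha>\<in>multi_indices k. if \<alpha> = ?z then a * monomial_fun \<alpha> x else 0)"
      unfolding poly_of_def by (intro sum.cong refl) simp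
    also have "\<dots> = a * monomial_fun ?z x"
      using z by (subst sum.delta[OF finite_multi_indices]) simp
    finally show ?thesis by (simp add: monomial_fun_def)
  qed
  then have "(\<lambda>x. a) = poly_of k (\<lambda>\<alpha>. if \<alpha> = ?z then a else 0)" by (simp add: fun_eq_iff)
  then show ?thesis unfolding polys_eq by blast
qed

text \<open>On every line a polynomial is a univariate polynomial, which has finitely many roots or
  vanishes.\<close>

lemma polys_eq_0_if_eq_0_on_open:
  fixes p :: "'a::euclidean_space \<Rightarrow> real"
  assumes p: "p \<in> polys k" and U: "open U" "U \<noteq> {}" "\<And>x. x \<in> U \<Longrightarrow> p x = 0"
  shows "p x = 0"
proof -
  obtain c where c: "p = poly_of k c" using p by (auto simp: polys_eq)
  obtain x0 where "x0 \<in> U" using U(2) by blast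
  then obtain e where e: "e > 0" "ball x0 e \<subseteq> U" using U(1) openE by blast
  define v where "v = x - x0"
  define q where "q = (\<Sum>\<alpha>\<in>multi_indices k. Polynomial.smult (c \<alpha>) (\<Prod>b\<in>Basis. [:x0 \<bullet> b, v \<bullet> b:] ^ \<alpha> b))"
  have q: "poly q t = p (x0 + t *\<^sub>R v)" for t
    by (simp add: q_def c poly_of_def monomial_fun_def poly_sum poly_prod inner_add_left)
  have "poly q t = 0" if t: "0 < t" "t < e / (norm v + 1)" for t
  proof -
    have "norm v + 1 > 0" by (simp add: add_nonneg_pos)
    then have "t * (norm v + 1) < e" using t by (simp add: pos_less_divide_eq)
    moreover have "norm (t *\<^sub>R v) \<le> t * (norm v + 1)" using t by simp
    ultimately have "x0 + t *\<^sub>R v \<in> ball x0 e" by (simp add: dist_norm)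
    then show ?thesis using q U(3) e(2) by auto
  qed
  then have "{0<..<e / (norm v + 1)} \<subseteq> {t. poly q t = 0}" by auto
  moreover have "infinite {0<..<e / (norm v + 1)}"
    using e(1) by (intro infinite_Ioo divide_pos_pos) (simp_all add: add_nonneg_pos)
  ultimately have "infinite {t. poly q t = 0}" using infinite_super by blast
  then have "q = 0" using poly_roots_finite by blast
  then show ?thesis using q[of 1] by (simp add: v_def)
qed

lemma a_elem_smooth:
  assumes "convex_body T" "smooth f" "smooth g"
  shows "a_elem T f g = (LINT x|lebesgue_on T. cgrad f x \<bullet> cgrad g x)"
  using assms by (intro a_elem_eq smooth_weak_gradient)

text \<open>A continuous gradient that vanishes almost everywhere on the element vanishes in its interior, where
  the polynomial therefore is constant; constancy then extends to the whole space.\<close>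

lemma polys_a_elem_0_imp_const:
  fixes p :: "'a::euclidean_space \<Rightarrow> real"
  assumes T: "convex_body T" and p: "p \<in> polys k" and a0: "a_elem T p p = 0"
  obtains c where "p = (\<lambda>x. c)"
proof -
  note sp = polys_smooth[OF p]
  have "AE x in lebesgue_on T. cgrad p x \<bullet> cgrad p x = 0"
    using integral_nonneg_eq_0_iff_AE[OF integrable_weak_gradient_inner[OF T smooth_weak_gradient[OF sp T] smooth_weak_gradient[OF sp T]]]
      a0 a_elem_smooth[OF T sp sp] by simp
  then have "AE x in lebesgue_on (interior T). cgrad p x \<bullet> cgrad p x = 0"
    using convex_body_AE[OF T] by blast
  then have ae: "AE x in lebesgue. x \<in> interior T \<longrightarrow> cgrad p x = 0"
    using convex_body_lmeasurable(4)[OF T] by (subst (asm) AE_restrict_space_iff) auto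
  define U where "U = interior T \<inter> cgrad p -` (- {0})"
  have "open U"
    unfolding U_def by (rule continuous_open_preimage[OF continuous_cgrad[OF sp]]) auto
  have "AE x in lebesgue. x \<notin> U"
    using ae by (rule eventually_mono) (auto simp: U_def)
  then have "U \<in> null_sets lebesgue"
    using borel_open[OF \<open>open U\<close>] by (subst AE_iff_null_sets) auto
  then have "U = {}"
    using open_not_negligible[OF \<open>open U\<close>] by (auto simp: negligible_iff_null_sets)
  then have "cgrad p x = 0" if "x \<in> interior T" for x using that by (auto simp: U_def)
  then have "frechet_derivative p (at x) = (\<lambda>h. 0)" if "x \<in> interior T" for x
    using that by (simp add: fun_eq_iff frechet_derivative_cgrad[OF sp])
  then have "(p has_derivative (\<lambda>h. 0)) (at x within interior T)" if "x \<in> interior T" for x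
    using smooth_has_derivative[OF sp, of x] that by (simp add: has_derivative_at_withinI)
  then have "\<exists>c. \<forall>x\<in>interior T. p x = c"
    using T by (intro has_derivative_zero_constant) (auto simp: convex_body_def convex_interior)
  then obtain c where c: "\<And>x. x \<in> interior T \<Longrightarrow> p x = c" by blast
  have "(\<lambda>x. p x + (- c)) \<in> polys k" by (intro polys_add p polys_const)
  then have "p x + (- c) = 0" for x
    by (rule polys_eq_0_if_eq_0_on_open[where U = "interior T"]) (use T c in \<open>auto simp: convex_body_def\<close>)
  then show thesis by (intro that[of c]) (simp add: fun_eq_iff)
qed

section \<open>The lifting operator\<close>

text \<open>Riesz representation for a positive semidefinite form on a finite-dimensional space, by
  Gram--Schmidt orthogonalisation; the functional has to vanish where the form degenerates.\<close>

lemma riesz_finite: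
  fixes \<beta> :: "('i \<Rightarrow> real) \<Rightarrow> ('i \<Rightarrow> real) \<Rightarrow> real"
  assumes J: "finite J"
    and add: "\<And>c c' d. \<beta> (\<lambda>i. c i + c' i) d = \<beta> c d + \<beta> c' d"
    and scale: "\<And>t c d. \<beta> (\<lambda>i. t * c i) d = t * \<beta> c d"
    and sym: "\<And>c d. \<beta> c d = \<beta> d c" and pos: "\<And>c. \<beta> c c \<ge> 0"
    and ladd: "\<And>c c'. l (\<lambda>i. c i + c' i) = l c + l c'"
    and lscale: "\<And>t c. l (\<lambda>i. t * c i) = t * l c"
    and null: "\<And>c. \<beta> c c = 0 \<Longrightarrow> l c = (0::real)"
  shows "\<exists>c. (\<forall>i. i \<notin> J \<longrightarrow> c i = 0) \<and> (\<forall>d. (\<forall>i. i \<notin> J \<longrightarrow> d i = 0) \<longrightarrow> \<beta> c d = l d)"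
  using J ladd lscale null
proof (induction J arbitrary: l)
  case empty
  have "\<beta> (\<lambda>i. 0) d = 0" for d using scale[of 0 "\<lambda>i. 0" d] by simp
  moreover have "l (\<lambda>i. 0) = 0" using empty(2)[of 0 "\<lambda>i. 0"] by simp
  moreover have "d = (\<lambda>i. 0)" if "\<forall>i. i \<notin> {} \<longrightarrow> d i = 0" for d :: "'i \<Rightarrow> real"
    using that by (intro ext) blast
  ultimately have "\<forall>d. (\<forall>i. i \<notin> {} \<longrightarrow> d i = 0) \<longrightarrow> \<beta> (\<lambda>i. 0) d = l d" by metis
  then show ?case by (intro exI[of _ "\<lambda>i. 0"] conjI) simp_all
next
  case (insert j J)
  have addr: "\<beta> d (\<lambda>i. c i + c' i) = \<beta> d c + \<beta> d c'" for c c' d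
    using add[of c c' d] by (simp add: sym[of d])
  have scaler: "\<beta> d (\<lambda>i. t * c i) = t * \<beta> d c" for t c d
    using scale[of t c d] by (simp add: sym[of d])
  \<comment> \<open>Cauchy--Schwarz for a semidefinite form: \<open>\<beta> (e + t c) (e + t c)\<close> is affine in t and nonnegative\<close>
  have degenerate: "\<beta> e c = 0" if c: "\<beta> c c = 0" for c e
  proof (rule ccontr)
    assume ne: "\<beta> e c \<noteq> 0"
    define t where "t = - (\<beta> e e + 1) / (2 * \<beta> e c)"
    have "\<beta> (\<lambda>i. e i + t * c i) (\<lambda>i. e i + t * c i) = \<beta> e e + 2 * t * \<beta> e c"
      by (simp add: add addr scale scaler c sym[of c e])
    also have "2 * t * \<beta> e c = - (\<beta> e e + 1)" using ne by (simp add: t_def del: minus_add_distrib)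
    also have "\<beta> e e + - (\<beta> e e + 1) = -1" by simp
    finally show False using pos[of "\<lambda>i. e i + t * c i"] by simp
  qed
  \<comment> \<open>e' is the part of the new basis vector e that is orthogonal to the old space\<close>
  define e where "e i = (if i = j then 1 else 0 :: real)" for i
  have "\<exists>q. (\<forall>i. i \<notin> J \<longrightarrow> q i = 0) \<and> (\<forall>d. (\<forall>i. i \<notin> J \<longrightarrow> d i = 0) \<longrightarrow> \<beta> q d = \<beta> e d)"
    by (rule insert.IH, rule addr, rule scaler, rule degenerate, assumption)
  then obtain q where q: "\<And>i. i \<notin> J \<Longrightarrow> q i = 0" "\<And>d. (\<forall>i. i \<notin> J \<longrightarrow> d i = 0) \<Longrightarrow> \<beta> q d = \<beta> e d"
    by blast
  have "\<exists>p. (\<forall>i. i \<notin> J \<longrightarrow> p i = 0) \<and> (\<forall>d. (\<forall>i. i \<notin> J \<longrightarrow> d i = 0) \<longrightarrow> \<beta> p d = l d)"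
    by (rule insert.IH, rule insert.prems, rule insert.prems, rule insert.prems, assumption)
  then obtain p where p: "\<And>i. i \<notin> J \<Longrightarrow> p i = 0" "\<And>d. (\<forall>i. i \<notin> J \<longrightarrow> d i = 0) \<Longrightarrow> \<beta> p d = l d"
    by blast
  define e' where "e' i = e i + (-1) * q i" for i
  have orth: "\<beta> e' d = 0" if "\<forall>i. i \<notin> J \<longrightarrow> d i = 0" for d
    using q(2)[OF that] unfolding e'_def[abs_def] add scale by simp
  have pe': "\<beta> p e' = 0" using orth[of p] p(1) sym by metis
  define s where "s = (if \<beta> e' e' = 0 then 0 else l e' / \<beta> e' e')"
  have s: "s * \<beta> e' e' = l e'" using insert.prems(3)[of e'] by (simp add: s_def)
  show ?case
  proof (intro exI[of _ "\<lambda>i. p i + s * e' i"] conjI allI impI)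
    fix i assume "i \<notin> insert j J"
    then show "p i + s * e' i = 0" using p(1) q(1) by (simp add: e'_def e_def)
  next
    fix d :: "'i \<Rightarrow> real" assume d: "\<forall>i. i \<notin> insert j J \<longrightarrow> d i = 0"
    define d0 where "d0 i = d i + (- d j) * e' i" for i
    have d0: "\<forall>i. i \<notin> J \<longrightarrow> d0 i = 0"
    proof (intro allI impI)
      fix i assume "i \<notin> J"
      then show "d0 i = 0"
        using d q(1) insert.hyps by (cases "i = j") (auto simp: d0_def e'_def e_def)
    qed
    have "d = (\<lambda>i. d0 i + d j * e' i)" by (simp add: d0_def fun_eq_iff)
    then have 1: "\<beta> c d = \<beta> c d0 + d j * \<beta> c e'" "l d = l d0 + d j * l e'" for c
      using addr[of c d0 "\<lambda>i. d j * e' i"] scaler[of c "d j" e'] insert.prems(1)[of d0 "\<lambda>i. d j * e' i"]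
        insert.prems(2)[of "d j" e'] by simp_all
    have "\<beta> (\<lambda>i. p i + s * e' i) d = \<beta> p d + s * \<beta> e' d"
      by (simp add: add scale)
    also have "\<beta> p d = l d0" using 1(1)[of p] p(2)[OF d0] pe' by simp
    also have "\<beta> e' d = d j * \<beta> e' e'" using 1(1)[of e'] orth[OF d0] by simp
    also have "l d0 + s * (d j * \<beta> e' e') = l d0 + d j * (s * \<beta> e' e')" by simp
    also have "\<dots> = l d" unfolding s 1(2) ..
    finally show "\<beta> (\<lambda>i. p i + s * e' i) d = l d" .
  qed
qed

lemma poly_of_restrict:
  "poly_of k (\<lambda>\<alpha>. if \<alpha> \<in> multi_indices k then c \<alpha> else 0) = poly_of k c"
  unfolding poly_of_def[abs_def] by (intro ext sum.cong refl) simp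

lemma measure_convex_body_pos:
  assumes "convex_body T"
  shows "measure lebesgue T > 0"
proof (rule ccontr)
  assume "\<not> measure lebesgue T > 0"
  then have "measure lebesgue T = 0" using measure_nonneg[of lebesgue T] by linarith
  then have "negligible T" using convex_body_lmeasurable(1)[OF assms] negligible_iff_measure by blast
  then have "negligible (interior T)" by (rule negligible_subset) (rule interior_subset)
  then show False using open_not_negligible[of "interior T"] assms by (auto simp: convex_body_def)
qed

lemma integral_const_element:
  assumes "convex_body T"
  shows "(LINT x|lebesgue_on T. c) = measure lebesgue T * (c::real)"
  using convex_body_lmeasurable(3)[OF assms] by (simp add: measure_restrict_space)

lemma integrable_polys:
  assumes "convex_body T" "p \<in> polys k"
  shows "integrable (lebesgue_on T) p"
  by (rule square_integrable_imp_integrable'[OF convex_body_finite_measure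
        square_integrable_smooth(1)[OF _ polys_smooth]]) (rule assms)+

lemma polys0_subtract_mean:
  assumes T: "convex_body T" and p: "p \<in> polys k"
  shows "\<exists>m. (\<lambda>x. p x + (- m)) \<in> polys0 k T"
proof -
  define m where "m = (LINT x|lebesgue_on T. p x) / measure lebesgue T"
  have "(LINT x|lebesgue_on T. p x + (- m)) = (LINT x|lebesgue_on T. p x) + (LINT x|lebesgue_on T. - m)"
    by (rule Bochner_Integration.integral_add[OF integrable_polys[OF T p] integrable_polys[OF T polys_const]])
  also have "\<dots> = 0"
    unfolding integral_const_element[OF T] using measure_convex_body_pos[OF T] by (simp add: m_def)
  finally have 0: "(LINT x|lebesgue_on T. p x + (- m)) = 0" .
  have "(\<lambda>x. p x + (- m)) \<in> polys0 k T"
    unfolding polys0_def mem_Collect_eq by (intro conjI 0 polys_add p polys_const)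
  then show ?thesis by blast
qed

lemma cgrad_const: "cgrad (\<lambda>x. c) x = 0"
proof -
  have "partial_deriv (\<lambda>x::'a. c) b x = 0" for b by (rule partial_deriv_eq) simp
  then show ?thesis by (simp add: cgrad_def)
qed

lemma a_elem_const: "element T \<Longrightarrow> smooth f \<Longrightarrow> a_elem T (\<lambda>x. c) f = 0"
  by (simp add: a_elem_smooth[OF element_convex_body smooth_const] cgrad_const)

lemma sobolev_polys: "element T \<Longrightarrow> p \<in> polys k \<Longrightarrow> p \<in> sobolev m (interior T)"
  by (rule smooth_sobolev[OF element_convex_body polys_smooth])

lemma weak_gradient_polys: "element T \<Longrightarrow> p \<in> polys k \<Longrightarrow> weak_gradient (interior T) p (cgrad p)"
  by (rule smooth_weak_gradient[OF polys_smooth element_convex_body])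

context
  fixes T :: "'a::euclidean_space set" and \<Omega> :: "'a set" and k :: nat and u :: "'a \<Rightarrow> real"
  assumes T: "element T" and u: "u \<in> sobolev 2 (interior T)"
begin

lemma Nc_elem_const_left: "Nc_elem \<Omega> T (\<lambda>x. c) u = 0"
  unfolding Nc_elem_def boundary_integral_def set_lebesgue_integral_def
proof (intro sum.neutral ballI integral_eq_zero_AE)
  fix F assume "F \<in> {F. F facet_of T}"
  then have TF: "body_facet T F" using element_body_facet[OF T] by simp
  have "AE x in facet_measure T F. normal_deriv T F (\<lambda>x. c) x = cgrad (\<lambda>x. c) x \<bullet> outer_normal T F"
    by (rule normal_deriv_eq_AE[OF TF is_gradient_trace_smooth[OF TF smooth_const]])
  then show "AE x in facet_measure T F. indicator (F \<inter> frontier \<Omega>) x *\<^sub>R (- normal_deriv T F (\<lambda>x. c) x * facet_trace T F u x) = 0"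
    by (rule eventually_mono) (simp add: cgrad_const)
qed

text \<open>The lifting is first found among all polynomials, where the form degenerates exactly on the
  constants; these have normal derivative 0, as the Riesz representation requires. Subtracting the
  mean then gives an element of \<open>polys0\<close> with the same gradient.\<close>

lemma is_lift_elem_exists: "\<exists>p. is_lift_elem \<Omega> k T u p"
proof -
  note cb = element_convex_body[OF T]
  have P: "poly_of k c \<in> polys k" for c :: "('a \<Rightarrow> nat) \<Rightarrow> real" by (auto simp: polys_eq)
  define \<beta> where "\<beta> c d = a_elem T (poly_of k c) (poly_of k d)" for c d
  define l where "l c = Nc_elem \<Omega> T (poly_of k c) u" for c
  have "\<exists>c. (\<forall>i. i \<notin> multi_indices k \<longrightarrow> c i = 0) \<and> (\<forall>d. (\<forall>i. i \<notin> multi_indices k \<longrightarrow> d i = 0) \<longrightarrow> \<beta> c d = l d)"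
  proof (rule riesz_finite[OF finite_multi_indices])
    show "\<beta> (\<lambda>i. c i + c' i) d = \<beta> c d + \<beta> c' d" for c c' d
      unfolding \<beta>_def poly_of_add by (rule a_elem_add_left[OF cb weak_gradient_polys[OF T] weak_gradient_polys[OF T] weak_gradient_polys[OF T]]) (rule P)+
    show "\<beta> (\<lambda>i. t * c i) d = t * \<beta> c d" for t c d
      unfolding \<beta>_def poly_of_cmult by (rule a_elem_cmult_left[OF cb weak_gradient_polys[OF T] weak_gradient_polys[OF T]]) (rule P)+
    show "\<beta> c d = \<beta> d c" for c d unfolding \<beta>_def by (rule a_elem_commute)
    show "\<beta> c c \<ge> 0" for c unfolding \<beta>_def by (rule a_elem_nonneg)
    show "l (\<lambda>i. c i + c' i) = l c + l c'" for c c'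
      unfolding l_def poly_of_add by (rule Nc_elem_add_left[OF T sobolev_polys[OF T P] sobolev_polys[OF T P] u])
    show "l (\<lambda>i. t * c i) = t * l c" for t c
      unfolding l_def poly_of_cmult by (rule Nc_elem_cmult_left[OF T sobolev_polys[OF T P] u u])
    show "l c = 0" if "\<beta> c c = 0" for c
    proof -
      obtain a where "poly_of k c = (\<lambda>x. a)"
        using polys_a_elem_0_imp_const[OF cb P] \<open>\<beta> c c = 0\<close> unfolding \<beta>_def by blast
      then show ?thesis by (simp add: l_def Nc_elem_const_left)
    qed
  qed
  then obtain c where c: "\<And>d. (\<forall>i. i \<notin> multi_indices k \<longrightarrow> d i = 0) \<Longrightarrow> \<beta> c d = l d" by blast
  define p where "p = poly_of k c"
  have p: "p \<in> polys k" unfolding p_def by (rule P)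
  have pv: "a_elem T p v = Nc_elem \<Omega> T v u" if "v \<in> polys k" for v
  proof -
    obtain d where d: "v = poly_of k d" using \<open>v \<in> polys k\<close> by (auto simp: polys_eq)
    have "\<beta> c (\<lambda>\<alpha>. if \<alpha> \<in> multi_indices k then d \<alpha> else 0) = l (\<lambda>\<alpha>. if \<alpha> \<in> multi_indices k then d \<alpha> else 0)"
      by (rule c) simp
    then show ?thesis by (simp only: \<beta>_def l_def poly_of_restrict p_def d)
  qed
  obtain m where m: "(\<lambda>x. p x + (- m)) \<in> polys0 k T"
    using polys0_subtract_mean[OF cb p] by blast
  have "is_lift_elem \<Omega> k T u (\<lambda>x. p x + (- m))"
    unfolding is_lift_elem_def
  proof (intro conjI ballI)
    show "(\<lambda>x. p x + - m) \<in> polys0 k T" by (rule m)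
    fix v assume "v \<in> polys0 k T"
    then have v: "v \<in> polys k" by (simp add: polys0_def)
    have "a_elem T (\<lambda>x. p x + - m) v = a_elem T p v + a_elem T (\<lambda>x. - m) v"
      by (rule a_elem_add_left[OF cb weak_gradient_polys[OF T p] weak_gradient_polys[OF T polys_const] weak_gradient_polys[OF T v]])
    then show "a_elem T (\<lambda>x. p x + - m) v = Nc_elem \<Omega> T v u"
      using pv[OF v] a_elem_const[OF T polys_smooth[OF v]] by simp
  qed
  then show ?thesis by blast
qed

lemma is_lift_elem_unique:
  assumes "is_lift_elem \<Omega> k T u p" "is_lift_elem \<Omega> k T u p'"
  shows "p = p'"
proof -
  note cb = element_convex_body[OF T]
  have p: "p \<in> polys k" "p' \<in> polys k" and m: "(LINT x|lebesgue_on T. p x) = 0" "(LINT x|lebesgue_on T. p' x) = 0"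
    and l: "\<And>v. v \<in> polys0 k T \<Longrightarrow> a_elem T p v = Nc_elem \<Omega> T v u" "\<And>v. v \<in> polys0 k T \<Longrightarrow> a_elem T p' v = Nc_elem \<Omega> T v u"
    using assms by (auto simp: is_lift_elem_def polys0_def)
  define w where "w x = p x + (-1) * p' x" for x
  have p'': "(\<lambda>x. (-1) * p' x) \<in> polys k" by (rule polys_cmult[OF p(2)])
  have w: "w \<in> polys k" unfolding w_def[abs_def] by (rule polys_add[OF p(1) p''])
  note int = integrable_polys[OF cb]
  have mw: "(LINT x|lebesgue_on T. w x) = 0"
    unfolding w_def using m Bochner_Integration.integral_add[OF int[OF p(1)] int[OF p'']] by simp
  then have w0: "w \<in> polys0 k T" using w by (simp add: polys0_def)
  have "a_elem T w w = a_elem T p w + a_elem T (\<lambda>x. (-1) * p' x) w"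
    unfolding w_def[abs_def]
    by (rule a_elem_add_left[OF cb weak_gradient_polys[OF T p(1)] weak_gradient_polys[OF T p''] weak_gradient_polys[OF T w[unfolded w_def[abs_def]]]])
  also have "a_elem T (\<lambda>x. (-1) * p' x) w = (-1) * a_elem T p' w"
    by (rule a_elem_cmult_left[OF cb weak_gradient_polys[OF T p(2)] weak_gradient_polys[OF T w]])
  finally have "a_elem T w w = 0" using l[OF w0] by simp
  then obtain a where a: "w = (\<lambda>x. a)" using polys_a_elem_0_imp_const[OF cb w] by blast
  then have "(LINT x|lebesgue_on T. a) = 0" using mw by (simp only:)
  then have "measure lebesgue T * a = 0" by (simp only: integral_const_element[OF cb])
  then have "a = 0" using measure_convex_body_pos[OF cb] by simp
  then show ?thesis using a by (simp add: w_def fun_eq_iff)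
qed

text \<open>On an element away from the boundary the right-hand side of the defining equation vanishes, so
  that the value 0 satisfies the same equation and no case distinction remains.\<close>

lemma is_lift_elem_lift_elem: "is_lift_elem \<Omega> k T u (lift_elem \<Omega> k T u)"
proof (cases "boundary_element \<Omega> T")
  case True
  have "\<exists>!p. is_lift_elem \<Omega> k T u p"
    using is_lift_elem_exists is_lift_elem_unique by blast
  from theI'[OF this] show ?thesis using True by (simp add: lift_elem_def)
next
  case False
  have "Nc_elem \<Omega> T v u = 0" for v
    unfolding Nc_elem_def boundary_integral_def set_lebesgue_integral_def
  proof (intro sum.neutral ballI integral_eq_zero_AE)
    fix F assume F: "F \<in> {F. F facet_of T}"
    then have TF: "body_facet T F" using element_body_facet[OF T] by simp
    have "emeasure (facet_measure T F) (F \<inter> frontier \<Omega>) = 0"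
      using False F by (auto simp: boundary_element_def)
    then have "F \<inter> frontier \<Omega> \<in> null_sets (facet_measure T F)"
      using facet_frontier_sets[OF TF] by (intro null_setsI)
    then have "AE x in facet_measure T F. x \<notin> F \<inter> frontier \<Omega>" by (rule AE_not_in)
    then show "AE x in facet_measure T F. indicator (F \<inter> frontier \<Omega>) x *\<^sub>R (- normal_deriv T F v x * facet_trace T F u x) = 0"
      by (rule eventually_mono) (simp add: indicator_def)
  qed
  moreover have "a_elem T (\<lambda>x. 0) v = 0" if "v \<in> polys k" for v
    by (rule a_elem_const[OF T polys_smooth[OF that]])
  ultimately have "is_lift_elem \<Omega> k T u (\<lambda>x. 0)"
    using polys_const[of 0 k] by (simp add: is_lift_elem_def polys0_def)
  then show ?thesis using False by (simp add: lift_elem_def)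
qed

lemma lift_elem_polys: "lift_elem \<Omega> k T u \<in> polys k"
  using is_lift_elem_lift_elem by (simp add: is_lift_elem_def polys0_def)

text \<open>Subtracting its mean puts a polynomial into the test space and changes neither side.\<close>

lemma a_elem_lift_elem:
  assumes p: "p \<in> polys k"
  shows "a_elem T (lift_elem \<Omega> k T u) p = Nc_elem \<Omega> T p u"
proof -
  note cb = element_convex_body[OF T]
  obtain m where "(\<lambda>x. p x + (- m)) \<in> polys0 k T"
    using polys0_subtract_mean[OF cb p] by blast
  then have "a_elem T (lift_elem \<Omega> k T u) (\<lambda>x. p x + (- m)) = Nc_elem \<Omega> T (\<lambda>x. p x + (- m)) u"
    using is_lift_elem_lift_elem unfolding is_lift_elem_def by blast
  moreover have "a_elem T (\<lambda>x. p x + (- m)) (lift_elem \<Omega> k T u)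
      = a_elem T p (lift_elem \<Omega> k T u) + a_elem T (\<lambda>x. - m) (lift_elem \<Omega> k T u)"
    by (rule a_elem_add_left[OF cb weak_gradient_polys[OF T p] weak_gradient_polys[OF T polys_const] weak_gradient_polys[OF T lift_elem_polys]])
  moreover have "Nc_elem \<Omega> T (\<lambda>x. p x + (- m)) u = Nc_elem \<Omega> T p u + Nc_elem \<Omega> T (\<lambda>x. - m) u"
    by (rule Nc_elem_add_left[OF T sobolev_polys[OF T p] sobolev_polys[OF T polys_const] u])
  ultimately show ?thesis
    using a_elem_const[OF T polys_smooth[OF lift_elem_polys]] Nc_elem_const_left
    by (simp add: a_elem_commute[of T "lift_elem \<Omega> k T u"])
qed

end

lemma polys0_add:
  assumes T: "convex_body T" and p: "p \<in> polys0 k T" "q \<in> polys0 k T"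
  shows "(\<lambda>x. p x + q x) \<in> polys0 k T"
proof -
  have pk: "p \<in> polys k" "q \<in> polys k" and m: "(LINT x|lebesgue_on T. p x) = 0" "(LINT x|lebesgue_on T. q x) = 0"
    using p by (auto simp: polys0_def)
  note int = integrable_polys[OF T]
  show ?thesis
    using Bochner_Integration.integral_add[OF int[OF pk(1)] int[OF pk(2)]] m polys_add[OF pk] by (simp add: polys0_def)
qed

lemma lift_elem_add:
  fixes T :: "'a::euclidean_space set"
  assumes T: "element T" and u: "u \<in> sobolev 2 (interior T)" and v: "v \<in> sobolev 2 (interior T)"
  shows "lift_elem \<Omega> k T (\<lambda>x. u x + v x) = (\<lambda>x. lift_elem \<Omega> k T u x + lift_elem \<Omega> k T v x)"
proof -
  note cb = element_convex_body[OF T]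
  have uv: "(\<lambda>x. u x + v x) \<in> sobolev 2 (interior T)" by (rule sobolev_add[OF cb u v])
  note L = is_lift_elem_lift_elem[OF T u, of \<Omega> k] is_lift_elem_lift_elem[OF T v, of \<Omega> k]
  note Lp = lift_elem_polys[OF T u, of \<Omega> k] lift_elem_polys[OF T v, of \<Omega> k]
  have "is_lift_elem \<Omega> k T (\<lambda>x. u x + v x) (\<lambda>x. lift_elem \<Omega> k T u x + lift_elem \<Omega> k T v x)"
    unfolding is_lift_elem_def
  proof (intro conjI ballI)
    show "(\<lambda>x. lift_elem \<Omega> k T u x + lift_elem \<Omega> k T v x) \<in> polys0 k T"
      using L polys0_add[OF cb] by (simp add: is_lift_elem_def)
    fix p assume p: "p \<in> polys0 k T"
    then have pk: "p \<in> polys k" by (simp add: polys0_def)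
    have "a_elem T (\<lambda>x. lift_elem \<Omega> k T u x + lift_elem \<Omega> k T v x) p
        = a_elem T (lift_elem \<Omega> k T u) p + a_elem T (lift_elem \<Omega> k T v) p"
      by (rule a_elem_add_left[OF cb weak_gradient_polys[OF T Lp(1)] weak_gradient_polys[OF T Lp(2)] weak_gradient_polys[OF T pk]])
    also have "\<dots> = Nc_elem \<Omega> T p u + Nc_elem \<Omega> T p v"
      using L p by (simp add: is_lift_elem_def)
    also have "\<dots> = Nc_elem \<Omega> T p (\<lambda>x. u x + v x)"
      by (rule Nc_elem_add_right[OF T u v sobolev_polys[OF T pk], symmetric])
    finally show "a_elem T (\<lambda>x. lift_elem \<Omega> k T u x + lift_elem \<Omega> k T v x) p = Nc_elem \<Omega> T p (\<lambda>x. u x + v x)" .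
  qed
  then show ?thesis
    by (rule is_lift_elem_unique[OF T uv is_lift_elem_lift_elem[OF T uv]])
qed

lemma lift_elem_cmult:
  fixes T :: "'a::euclidean_space set"
  assumes T: "element T" and u: "u \<in> sobolev 2 (interior T)"
  shows "lift_elem \<Omega> k T (\<lambda>x. c * u x) = (\<lambda>x. c * lift_elem \<Omega> k T u x)"
proof -
  note cb = element_convex_body[OF T]
  have cu: "(\<lambda>x. c * u x) \<in> sobolev 2 (interior T)" by (rule sobolev_cmult[OF u])
  note L = is_lift_elem_lift_elem[OF T u, of \<Omega> k]
  have Lp: "lift_elem \<Omega> k T u \<in> polys k" by (rule lift_elem_polys[OF T u])
  have "is_lift_elem \<Omega> k T (\<lambda>x. c * u x) (\<lambda>x. c * lift_elem \<Omega> k T u x)"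
    unfolding is_lift_elem_def
  proof (intro conjI ballI)
    show "(\<lambda>x. c * lift_elem \<Omega> k T u x) \<in> polys0 k T"
      using L polys_cmult[OF Lp, of c] by (simp add: is_lift_elem_def polys0_def)
    fix p assume p: "p \<in> polys0 k T"
    then have pk: "p \<in> polys k" by (simp add: polys0_def)
    have "a_elem T (\<lambda>x. c * lift_elem \<Omega> k T u x) p = c * a_elem T (lift_elem \<Omega> k T u) p"
      by (rule a_elem_cmult_left[OF cb weak_gradient_polys[OF T Lp] weak_gradient_polys[OF T pk]])
    also have "\<dots> = c * Nc_elem \<Omega> T p u"
      using L p by (simp add: is_lift_elem_def)
    also have "\<dots> = Nc_elem \<Omega> T p (\<lambda>x. c * u x)"
      by (rule Nc_elem_cmult_right[OF T u u sobolev_polys[OF T pk], symmetric])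
    finally show "a_elem T (\<lambda>x. c * lift_elem \<Omega> k T u x) p = Nc_elem \<Omega> T p (\<lambda>x. c * u x)" .
  qed
  then show ?thesis
    by (rule is_lift_elem_unique[OF T cu is_lift_elem_lift_elem[OF T cu]])
qed

section \<open>The stabilised form\<close>

text \<open>The contribution of one element. All statements about the form reduce to single elements, since no
  term couples two of them.\<close>

definition A_elem :: "'a::euclidean_space set \<Rightarrow> nat \<Rightarrow> real \<Rightarrow> 'a set \<Rightarrow> ('a \<Rightarrow> real) \<Rightarrow> ('a \<Rightarrow> real) \<Rightarrow> real" where
  "A_elem \<Omega> k h T u v = a_elem T u v + Nc_elem \<Omega> T u v + Nc_elem \<Omega> T v u
     + 2 * a_elem T (lift_elem \<Omega> k T u) (lift_elem \<Omega> k T v) + 1 / h * Ns_elem \<Omega> T u v"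

lemma A_elem_commute: "A_elem \<Omega> k h T u v = A_elem \<Omega> k h T v u"
  by (simp add: A_elem_def a_elem_commute[of T u v] Ns_elem_commute[of \<Omega> T u v]
      a_elem_commute[of T "lift_elem \<Omega> k T u"])

lemma A_elem_add_left:
  assumes T: "element T" and u: "u \<in> sobolev 2 (interior T)" and v: "v \<in> sobolev 2 (interior T)" and w: "w \<in> sobolev 2 (interior T)"
  shows "A_elem \<Omega> k h T (\<lambda>x. u x + v x) w = A_elem \<Omega> k h T u w + A_elem \<Omega> k h T v w"
proof -
  note cb = element_convex_body[OF T]
  obtain G H K where G: "weak_gradient (interior T) u G" and H: "weak_gradient (interior T) v H" and K: "weak_gradient (interior T) w K"
    using sobolev2_ex_weak_gradient[OF u] sobolev2_ex_weak_gradient[OF v] sobolev2_ex_weak_gradient[OF w] by blast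
  have L: "a_elem T (\<lambda>x. lift_elem \<Omega> k T u x + lift_elem \<Omega> k T v x) (lift_elem \<Omega> k T w)
      = a_elem T (lift_elem \<Omega> k T u) (lift_elem \<Omega> k T w) + a_elem T (lift_elem \<Omega> k T v) (lift_elem \<Omega> k T w)"
    by (rule a_elem_add_left[OF cb weak_gradient_polys[OF T lift_elem_polys[OF T u]] weak_gradient_polys[OF T lift_elem_polys[OF T v]]
        weak_gradient_polys[OF T lift_elem_polys[OF T w]]])
  show ?thesis
    unfolding A_elem_def lift_elem_add[OF T u v] L a_elem_add_left[OF cb G H K]
      Nc_elem_add_left[OF T u v w] Nc_elem_add_right[OF T u v w] Ns_elem_add_left[OF T u v w]
    by (simp add: algebra_simps)
qed

lemma A_elem_cmult_left:
  assumes T: "element T" and u: "u \<in> sobolev 2 (interior T)" and w: "w \<in> sobolev 2 (interior T)"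
  shows "A_elem \<Omega> k h T (\<lambda>x. c * u x) w = c * A_elem \<Omega> k h T u w"
proof -
  note cb = element_convex_body[OF T]
  obtain G K where G: "weak_gradient (interior T) u G" and K: "weak_gradient (interior T) w K"
    using sobolev2_ex_weak_gradient[OF u] sobolev2_ex_weak_gradient[OF w] by blast
  have L: "a_elem T (\<lambda>x. c * lift_elem \<Omega> k T u x) (lift_elem \<Omega> k T w)
      = c * a_elem T (lift_elem \<Omega> k T u) (lift_elem \<Omega> k T w)"
    by (rule a_elem_cmult_left[OF cb weak_gradient_polys[OF T lift_elem_polys[OF T u]] weak_gradient_polys[OF T lift_elem_polys[OF T w]]])
  show ?thesis
    unfolding A_elem_def lift_elem_cmult[OF T u] L a_elem_cmult_left[OF cb G K]
      Nc_elem_cmult_left[OF T u w w] Nc_elem_cmult_right[OF T u w w] Ns_elem_cmult_left[OF T u w w]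
    by (simp add: algebra_simps)
qed

text \<open>For a function that is a polynomial \<open>p\<close> on the element, the lifting \<open>L\<close> tested with \<open>p\<close> turns
  the consistency term into \<open>a (L, u)\<close>. The form minus its penalty term is then
  \<open>a (u, u) + 2 a (L, u) + 2 a (L, L) = 1/2 a (u, u) + 1/2 a (u + 2 L, u + 2 L)\<close>.\<close>

lemma A_elem_coercive:
  assumes T: "element T" and u: "u \<in> sobolev 2 (interior T)" and p: "p \<in> polys k" "\<And>x. x \<in> interior T \<Longrightarrow> u x = p x"
  shows "A_elem \<Omega> k h T u u \<ge> 1 / 2 * a_elem T u u + 1 / h * Ns_elem \<Omega> T u u"
proof -
  note cb = element_convex_body[OF T]
  define L where "L = lift_elem \<Omega> k T u"
  have wL: "weak_gradient (interior T) L (cgrad L)"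
    unfolding L_def by (rule weak_gradient_polys[OF T lift_elem_polys[OF T u]])
  have wgu: "weak_gradient (interior T) u = weak_gradient (interior T) p"
    by (rule weak_gradient_cong) (rule p(2))
  have wu: "weak_gradient (interior T) u (cgrad p)"
    unfolding wgu by (rule weak_gradient_polys[OF T p(1)])
  have "Nc_elem \<Omega> T u u = Nc_elem \<Omega> T p u"
  proof -
    have "normal_deriv T F u = normal_deriv T F p" for F
      by (simp add: normal_deriv_def is_gradient_trace_def wgu)
    then show ?thesis by (simp add: Nc_elem_def)
  qed
  also have "\<dots> = a_elem T L p"
    unfolding L_def by (rule a_elem_lift_elem[OF T u p(1), symmetric])
  also have "\<dots> = a_elem T L u"
    unfolding a_elem_eq[OF cb wL wu] by (rule a_elem_eq[OF cb wL weak_gradient_polys[OF T p(1)]])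
  finally have Nc: "Nc_elem \<Omega> T u u = a_elem T L u" .
  have w2: "weak_gradient (interior T) (\<lambda>x. 2 * L x) (\<lambda>x. 2 *\<^sub>R cgrad L x)"
    by (rule weak_gradient_cmult[OF wL])
  have w3: "weak_gradient (interior T) (\<lambda>x. u x + 2 * L x) (\<lambda>x. cgrad p x + 2 *\<^sub>R cgrad L x)"
    by (rule weak_gradient_add[OF cb wu w2])
  have exp: "a_elem T (\<lambda>x. u x + 2 * L x) w = a_elem T u w + 2 * a_elem T L w"
    if "weak_gradient (interior T) w K" for w K
    using a_elem_add_left[OF cb wu w2 that] a_elem_cmult_left[OF cb wL that, of 2] by simp
  have "0 \<le> a_elem T (\<lambda>x. u x + 2 * L x) (\<lambda>x. u x + 2 * L x)" by (rule a_elem_nonneg)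
  also have "\<dots> = a_elem T (\<lambda>x. u x + 2 * L x) u + 2 * a_elem T (\<lambda>x. u x + 2 * L x) L"
    unfolding exp[OF w3] a_elem_commute[of T u] a_elem_commute[of T L] ..
  also have "\<dots> = a_elem T u u + 4 * a_elem T L u + 4 * a_elem T L L"
    unfolding exp[OF wu] exp[OF wL] by (simp add: a_elem_commute[of T u L])
  finally show ?thesis
    unfolding A_elem_def Nc L_def[symmetric] by linarith
qed

text \<open>The intersection of two elements is a face of both, and a face that meets the interior is the whole
  element.\<close>

lemma triangulation_disjoint_interior:
  assumes tri: "triangulation \<T>" and T: "T \<in> \<T>" "T' \<in> \<T>" "T \<noteq> T'"
  shows "interior T \<inter> interior T' = {}"
proof (rule ccontr)
  assume "interior T \<inter> interior T' \<noteq> {}"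
  then obtain x where x: "x \<in> interior T" "x \<in> interior T'" by blast
  then have xT: "x \<in> T \<inter> T'" using interior_subset by blast
  have face: "(T \<inter> T') face_of T" "(T \<inter> T') face_of T'"
    using tri T(1,2) unfolding triangulation_def by (blast, metis Int_commute)
  have "T \<inter> T' = T"
    using face_of_disjoint_interior[OF face(1)] x(1) xT by blast
  moreover have "T \<inter> T' = T'"
    using face_of_disjoint_interior[OF face(2)] x(2) xT by blast
  ultimately show False using T(3) by blast
qed

lemma simplex_element:
  fixes T :: "'a::euclidean_space set"
  assumes "int DIM('a) simplex T"
  shows "element T"
proof -
  have "aff_dim T = DIM('a)" using aff_dim_simplex[OF assms] .
  moreover have "convex T" using convex_simplex[OF assms] .
  moreover have "T \<noteq> {}" using calculation(1) by auto
  ultimately have "interior T \<noteq> {}"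
    using rel_interior_interior[of T] aff_dim_eq_full[of T] rel_interior_eq_empty[of T] by simp
  then show ?thesis using simplex_imp_polytope[OF assms] by (simp add: element_def)
qed

context
  fixes \<Omega> :: "'a::euclidean_space set" and \<T> :: "'a set set" and k :: nat
  assumes \<Omega>: "polyhedral_domain \<Omega>" and \<T>: "fitted_triangulation \<Omega> \<T>"
begin

lemma mesh_element: "T \<in> \<T> \<Longrightarrow> element T"
  using \<T> simplex_element by (auto simp: fitted_triangulation_def)

lemma finite_mesh: "finite \<T>"
  using \<T> by (auto simp: fitted_triangulation_def triangulation_def)

lemma mesh_interior_subset: "T \<in> \<T> \<Longrightarrow> interior T \<subseteq> \<Omega>"
proof -
  assume "T \<in> \<T>"
  then have "T \<subseteq> closure \<Omega>" using \<T> by (auto simp: fitted_triangulation_def)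
  then have "interior T \<subseteq> interior (closure \<Omega>)" by (rule interior_mono)
  then show ?thesis using \<Omega> by (simp add: polyhedral_domain_def)
qed

lemma open_domain: "open \<Omega>" using \<Omega> by (simp add: polyhedral_domain_def)

lemma domain_sets: "\<Omega> \<in> sets lebesgue"
  using open_domain by (simp add: borel_open)

lemma V_h_sobolev:
  assumes v: "v \<in> V_h \<Omega> \<T> k" and T: "T \<in> \<T>"
  shows "v \<in> sobolev 2 (interior T)"
proof -
  obtain p where p: "p \<in> polys k" "\<And>x. x \<in> T \<Longrightarrow> v x = p x"
    using v T by (auto simp: V_h_def)
  have "v \<in> sobolev 2 (interior T) \<longleftrightarrow> p \<in> sobolev 2 (interior T)"
    using p(2) interior_subset by (intro sobolev_cong) blast
  then show ?thesis using sobolev_polys[OF mesh_element[OF T] p(1)] by blast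
qed

lemma V_sum_sobolev:
  assumes u: "u \<in> V_sum \<Omega> \<T> k" and T: "T \<in> \<T>"
  shows "u \<in> sobolev 2 (interior T)"
proof -
  obtain w v where wv: "u = (\<lambda>x. w x + v x)" "w \<in> sobolev 2 \<Omega>" "v \<in> V_h \<Omega> \<T> k"
    using u by (auto simp: V_sum_def)
  have "w \<in> sobolev 2 (interior T)"
    using convex_body_lmeasurable(4)[OF element_convex_body[OF mesh_element[OF T]]]
    by (intro sobolev_subset[OF mesh_interior_subset[OF T] _ domain_sets wv(2)])
  then show ?thesis
    unfolding wv(1) by (rule sobolev_add[OF element_convex_body[OF mesh_element[OF T]] _ V_h_sobolev[OF wv(3) T]])
qed

lemma lifting_on_interior:
  assumes T: "T \<in> \<T>" and x: "x \<in> interior T"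
  shows "lifting \<Omega> \<T> k u x = lift_elem \<Omega> k T u x"
proof -
  have tri: "triangulation \<T>" using \<T> by (simp add: fitted_triangulation_def)
  have "indicator (interior T') x * lift_elem \<Omega> k T' u x = (if T' = T then lift_elem \<Omega> k T u x else 0)" if "T' \<in> \<T>" for T'
    using x triangulation_disjoint_interior[OF tri that T] by (auto simp: indicator_def)
  then have "lifting \<Omega> \<T> k u x = (\<Sum>T'\<in>\<T>. if T' = T then lift_elem \<Omega> k T u x else 0)"
    unfolding lifting_def by (intro sum.cong refl)
  also have "\<dots> = lift_elem \<Omega> k T u x"
    using T by (simp add: sum.delta[OF finite_mesh])
  finally show ?thesis .
qed

lemma weak_gradient_lifting:
  "T \<in> \<T> \<Longrightarrow> weak_gradient (interior T) (lifting \<Omega> \<T> k u) = weak_gradient (interior T) (lift_elem \<Omega> k T u)"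
  by (rule weak_gradient_cong) (rule lifting_on_interior)

lemma a_elem_lifting:
  "T \<in> \<T> \<Longrightarrow> a_elem T (lifting \<Omega> \<T> k u) (lifting \<Omega> \<T> k v) = a_elem T (lift_elem \<Omega> k T u) (lift_elem \<Omega> k T v)"
  by (simp add: a_elem_def grad_def weak_gradient_lifting)

text \<open>Inside an element the global lifting is the local one, and weak gradients only see the interior.\<close>

lemma A_star_eq: "A_star \<Omega> \<T> k h u v = (\<Sum>T\<in>\<T>. A_elem \<Omega> k h T u v)"
proof -
  have "a_form \<T> (lifting \<Omega> \<T> k u) (lifting \<Omega> \<T> k v) = (\<Sum>T\<in>\<T>. a_elem T (lift_elem \<Omega> k T u) (lift_elem \<Omega> k T v))"
    unfolding a_form_def by (intro sum.cong refl a_elem_lifting)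
  then show ?thesis
    by (simp only: A_star_def A_elem_def a_form_def Nc_form_def Ns_form_eq sum.distrib sum_distrib_left)
qed

lemma ex1_AE_I:
  assumes "P f" "\<And>f g. P f \<Longrightarrow> P g \<Longrightarrow> AE x in M. f x = g x"
  shows "ex1_AE M P"
  using assms unfolding ex1_AE_def by blast

lemma V_sum_operators_well_defined:
  assumes u: "u \<in> V_sum \<Omega> \<T> k"
  shows "operators_well_defined \<Omega> \<T> k u"
  unfolding operators_well_defined_def
proof (intro ballI conjI allI impI)
  fix T assume T: "T \<in> \<T>"
  note E = mesh_element[OF T] note cb = element_convex_body[OF E]
  note su = V_sum_sobolev[OF u T]
  obtain G where G: "weak_gradient (interior T) u G" using sobolev2_ex_weak_gradient[OF su] by blast
  show "ex1_AE (lebesgue_on T) (weak_gradient (interior T) u)"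
    by (rule ex1_AE_I[of _ G], rule G, rule weak_gradient_unique[OF cb])
  show "ex1_AE (lebesgue_on T) (weak_gradient (interior T) (lifting \<Omega> \<T> k u))"
    unfolding weak_gradient_lifting[OF T]
    by (rule ex1_AE_I, rule weak_gradient_polys[OF E lift_elem_polys[OF E su]], rule weak_gradient_unique[OF cb])
  show "\<exists>!p. is_lift_elem \<Omega> k T u p"
    using is_lift_elem_exists[OF E su] is_lift_elem_unique[OF E su] by blast
  fix F assume "F facet_of T"
  then have TF: "body_facet T F" by (rule element_body_facet[OF E])
  obtain g where g: "is_trace T F u g" using is_trace_exists[OF TF G] by blast
  show "ex1_AE (facet_measure T F) (is_trace T F u)"
    by (rule ex1_AE_I[of _ g], rule g, rule is_trace_unique[OF TF])
  obtain N where N: "is_gradient_trace T F u N" using is_gradient_trace_exists[OF TF su] by blast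
  show "ex1_AE (facet_measure T F) (is_gradient_trace T F u)"
    by (rule ex1_AE_I[of _ N], rule N, rule is_gradient_trace_unique[OF TF])
qed

lemma V_sum_integrals_exist:
  assumes u: "u \<in> V_sum \<Omega> \<T> k" and v: "v \<in> V_sum \<Omega> \<T> k"
  shows "integrals_exist \<Omega> \<T> k u v"
  unfolding integrals_exist_def
proof (intro ballI conjI allI impI)
  fix T assume T: "T \<in> \<T>"
  note E = mesh_element[OF T] note cb = element_convex_body[OF E]
  note su = V_sum_sobolev[OF u T] V_sum_sobolev[OF v T]
  have wg: "weak_gradient (interior T) u (grad T u)" "weak_gradient (interior T) v (grad T v)"
    by (intro weak_gradient_grad sobolev2_ex_weak_gradient su)+
  show "integrable (lebesgue_on T) (\<lambda>x. grad T u x \<bullet> grad T v x)"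
    by (rule integrable_weak_gradient_inner[OF cb wg])
  have "\<exists>G. weak_gradient (interior T) (lifting \<Omega> \<T> k w) G" if "w \<in> sobolev 2 (interior T)" for w
    unfolding weak_gradient_lifting[OF T] using weak_gradient_polys[OF E lift_elem_polys[OF E that]] by blast
  from weak_gradient_grad[OF this[OF su(1)]] weak_gradient_grad[OF this[OF su(2)]]
  show "integrable (lebesgue_on T) (\<lambda>x. grad T (lifting \<Omega> \<T> k u) x \<bullet> grad T (lifting \<Omega> \<T> k v) x)"
    by (rule integrable_weak_gradient_inner[OF cb])
  fix F assume "F facet_of T"
  then have TF: "body_facet T F" by (rule element_body_facet[OF E])
  have neg: "square_integrable (facet_measure T F) (\<lambda>x. - normal_deriv T F w x)" if "w \<in> sobolev 2 (interior T)" for w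
    using square_integrable_cmult[OF square_integrable_normal_deriv[OF TF that], of "-1"] by simp
  note sq = neg[OF su(1)] neg[OF su(2)] square_integrable_facet_trace[OF TF su(1)] square_integrable_facet_trace[OF TF su(2)]
  show "set_integrable (facet_measure T F) (F \<inter> frontier \<Omega>) (\<lambda>x. - normal_deriv T F u x * facet_trace T F v x)"
    by (rule set_integrable_mult[OF sq(1,4) facet_frontier_sets[OF TF]])
  show "set_integrable (facet_measure T F) (F \<inter> frontier \<Omega>) (\<lambda>x. - normal_deriv T F v x * facet_trace T F u x)"
    by (rule set_integrable_mult[OF sq(2,3) facet_frontier_sets[OF TF]])
  show "set_integrable (facet_measure T F) (F \<inter> frontier \<Omega>) (\<lambda>x. facet_trace T F u x * facet_trace T F v x)"
    by (rule set_integrable_mult[OF sq(3,4) facet_frontier_sets[OF TF]])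
qed

lemma A_elem_respects_AE:
  assumes T: "T \<in> \<T>" and u: "u \<in> V_sum \<Omega> \<T> k" "u' \<in> V_sum \<Omega> \<T> k" and ae: "AE x in lebesgue_on \<Omega>. u x = u' x"
  shows "A_elem \<Omega> k h T u v = A_elem \<Omega> k h T u' v"
proof -
  note E = mesh_element[OF T] note cb = element_convex_body[OF E]
  have sq: "square_integrable (lebesgue_on T) u" "square_integrable (lebesgue_on T) u'"
    using sobolev_square_integrable[OF V_sum_sobolev[OF u(1) T]] sobolev_square_integrable[OF V_sum_sobolev[OF u(2) T]]
      convex_body_square_integrable[OF cb] by blast+
  have "AE x in lebesgue. x \<in> \<Omega> \<longrightarrow> u x = u' x"
    using ae domain_sets by (subst (asm) AE_restrict_space_iff) auto
  then have "AE x in lebesgue. x \<in> interior T \<longrightarrow> u x = u' x"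
    by (rule eventually_mono) (use mesh_interior_subset[OF T] in blast)
  then have "AE x in lebesgue_on (interior T). u x = u' x"
    using convex_body_lmeasurable(4)[OF cb] by (subst AE_restrict_space_iff) auto
  then have aeT: "AE x in lebesgue_on T. u x = u' x"
    using convex_body_AE[OF cb] by blast
  have wg: "weak_gradient (interior T) u = weak_gradient (interior T) u'"
    by (rule weak_gradient_eq_of_AE[OF cb sq aeT])
  have tr: "is_trace T F u = is_trace T F u'" for F
    by (rule is_trace_eq_of_AE[OF cb sq aeT])
  have ft: "facet_trace T F u = facet_trace T F u'" for F by (simp add: facet_trace_def tr)
  have nd: "normal_deriv T F u = normal_deriv T F u'" for F
    by (simp add: normal_deriv_def is_gradient_trace_def wg)
  have "is_lift_elem \<Omega> k T u = is_lift_elem \<Omega> k T u'"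
    by (simp add: is_lift_elem_def Nc_elem_def ft fun_eq_iff)
  then have "lift_elem \<Omega> k T u = lift_elem \<Omega> k T u'" by (simp add: lift_elem_def)
  moreover have "grad T u = grad T u'" by (simp add: grad_def wg)
  ultimately show ?thesis
    by (simp add: A_elem_def a_elem_def Nc_elem_def Ns_elem_def ft nd)
qed

lemma A_star_respects_AE: "respects_AE (lebesgue_on \<Omega>) (V_sum \<Omega> \<T> k) (A_star \<Omega> \<T> k h)"
  unfolding respects_AE_def
proof (intro ballI impI)
  fix u v u' v' assume V: "u \<in> V_sum \<Omega> \<T> k" "v \<in> V_sum \<Omega> \<T> k" "u' \<in> V_sum \<Omega> \<T> k" "v' \<in> V_sum \<Omega> \<T> k"
    and ae: "AE x in lebesgue_on \<Omega>. u x = u' x" "AE x in lebesgue_on \<Omega>. v x = v' x"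
  have "A_elem \<Omega> k h T u v = A_elem \<Omega> k h T u' v'" if T: "T \<in> \<T>" for T
  proof -
    have "A_elem \<Omega> k h T u v = A_elem \<Omega> k h T u' v"
      by (rule A_elem_respects_AE[OF T V(1,3) ae(1)])
    also have "\<dots> = A_elem \<Omega> k h T v u'" by (rule A_elem_commute)
    also have "\<dots> = A_elem \<Omega> k h T v' u'" by (rule A_elem_respects_AE[OF T V(2,4) ae(2)])
    also have "\<dots> = A_elem \<Omega> k h T u' v'" by (rule A_elem_commute)
    finally show ?thesis .
  qed
  then show "A_star \<Omega> \<T> k h u v = A_star \<Omega> \<T> k h u' v'"
    unfolding A_star_eq by (intro sum.cong refl)
qed

lemma A_star_commute: "A_star \<Omega> \<T> k h u v = A_star \<Omega> \<T> k h v u"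
  unfolding A_star_eq by (intro sum.cong refl A_elem_commute)

lemma A_star_bilinear: "bilinear_form_on (V_sum \<Omega> \<T> k) (A_star \<Omega> \<T> k h)"
proof -
  have 1: "A_star \<Omega> \<T> k h (\<lambda>x. u x + v x) w = A_star \<Omega> \<T> k h u w + A_star \<Omega> \<T> k h v w"
    if V: "u \<in> V_sum \<Omega> \<T> k" "v \<in> V_sum \<Omega> \<T> k" "w \<in> V_sum \<Omega> \<T> k" for u v w
    unfolding A_star_eq sum.distrib[symmetric]
    by (intro sum.cong refl A_elem_add_left mesh_element V_sum_sobolev V)
  have 2: "A_star \<Omega> \<T> k h (\<lambda>x. c * u x) w = c * A_star \<Omega> \<T> k h u w"
    if V: "u \<in> V_sum \<Omega> \<T> k" "w \<in> V_sum \<Omega> \<T> k" for u w c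
    unfolding A_star_eq sum_distrib_left
    by (intro sum.cong refl A_elem_cmult_left mesh_element V_sum_sobolev V)
  show ?thesis
    unfolding bilinear_form_on_def
  proof (intro ballI allI conjI)
    fix u v w c assume V: "u \<in> V_sum \<Omega> \<T> k" "v \<in> V_sum \<Omega> \<T> k" "w \<in> V_sum \<Omega> \<T> k"
    show "A_star \<Omega> \<T> k h (\<lambda>x. u x + v x) w = A_star \<Omega> \<T> k h u w + A_star \<Omega> \<T> k h v w"
      by (rule 1[OF V])
    show "A_star \<Omega> \<T> k h (\<lambda>x. c * u x) w = c * A_star \<Omega> \<T> k h u w"
      by (rule 2[OF V(1,3)])
    show "A_star \<Omega> \<T> k h w (\<lambda>x. u x + v x) = A_star \<Omega> \<T> k h w u + A_star \<Omega> \<T> k h w v"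
      unfolding A_star_commute[of h w] by (rule 1[OF V])
    show "A_star \<Omega> \<T> k h w (\<lambda>x. c * u x) = c * A_star \<Omega> \<T> k h w u"
      unfolding A_star_commute[of h w] by (rule 2[OF V(1,3)])
  qed
qed

lemma A_star_coercive:
  assumes h: "h > 0" and u: "u \<in> V_h \<Omega> \<T> k"
  shows "A_star \<Omega> \<T> k h u u \<ge> 1 / 2 * (norm_A \<Omega> \<T> h u)\<^sup>2"
proof -
  have a: "a_form \<T> u u \<ge> 0" unfolding a_form_def by (intro sum_nonneg a_elem_nonneg)
  have n: "Ns_form \<Omega> \<T> h u u \<ge> 0"
    unfolding Ns_form_eq using h by (intro mult_nonneg_nonneg sum_nonneg Ns_elem_nonneg) simp
  have "1 / 2 * (norm_A \<Omega> \<T> h u)\<^sup>2 = 1 / 2 * (a_form \<T> u u + Ns_form \<Omega> \<T> h u u)"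
    using a n by (simp add: norm_A_def)
  also have "\<dots> \<le> 1 / 2 * a_form \<T> u u + Ns_form \<Omega> \<T> h u u"
    using n by simp
  also have "\<dots> = (\<Sum>T\<in>\<T>. 1 / 2 * a_elem T u u + 1 / h * Ns_elem \<Omega> T u u)"
    by (simp only: a_form_def Ns_form_eq sum.distrib sum_distrib_left)
  also have "\<dots> \<le> (\<Sum>T\<in>\<T>. A_elem \<Omega> k h T u u)"
  proof (rule sum_mono)
    fix T assume T: "T \<in> \<T>"
    obtain p where p: "p \<in> polys k" "\<And>x. x \<in> T \<Longrightarrow> u x = p x"
      using u T by (auto simp: V_h_def)
    show "1 / 2 * a_elem T u u + 1 / h * Ns_elem \<Omega> T u u \<le> A_elem \<Omega> k h T u u"
      by (rule A_elem_coercive[OF mesh_element[OF T] V_h_sobolev[OF u T] p(1)])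
        (use p(2) interior_subset in blast)
  qed
  finally show ?thesis by (simp only: A_star_eq)
qed

end

theorem corollary3:
  fixes \<Omega> :: "'a::euclidean_space set" and \<T> :: "'a set set"
    and k :: nat and h \<kappa> c C :: real
  assumes "polyhedral_domain \<Omega>" and "bounded \<Omega>"
    and "fitted_triangulation \<Omega> \<T>"
    and "h > 0" and "\<kappa> > 0" and "c > 0" and "C > 0"
    and "shape_regular \<kappa> \<T>" and "quasi_uniform c C h \<T>"
    and "k \<ge> 1"
  shows "((\<forall>u\<in>V_sum \<Omega> \<T> k. operators_well_defined \<Omega> \<T> k u) \<and>
          (\<forall>u\<in>V_sum \<Omega> \<T> k. \<forall>v\<in>V_sum \<Omega> \<T> k. integrals_exist \<Omega> \<T> k u v) \<and>
          respects_AE (lebesgue_on \<Omega>) (V_sum \<Omega> \<T> k) (A_star \<Omega> \<T> k h) \<and>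
          bilinear_form_on (V_sum \<Omega> \<T> k) (A_star \<Omega> \<T> k h)) \<and>
         (\<forall>u\<in>V_h \<Omega> \<T> k. A_star \<Omega> \<T> k h u u \<ge> 1 / 2 * (norm_A \<Omega> \<T> h u)\<^sup>2)"
  using V_sum_operators_well_defined[OF assms(1,3)] V_sum_integrals_exist[OF assms(1,3)]
    A_star_respects_AE[OF assms(1,3)] A_star_bilinear[OF assms(1,3)] A_star_coercive[OF assms(1,3,4)]
  by blast

end
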